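(* Let $k$ be a field of characteristic $p$, and let $G$ be a finite group of order divisible by $p$. Suppose that $\mathsf{Thick}_G\langle k\rangle=\mathsf{stmod}(B_0)$. Then the ghost number of $kG$ is finite.
   Context: $\mathsf{StMod}(kG)$ is the stable module category of $kG$: objects are $kG$-modules, and $\underline{\mathrm{Hom}}(M,N)$ is $\mathrm{Hom}_{kG}(M,N)$ modulo maps factoring through a projective. It is triangulated; $\Omega M$ (the kernel of a surjection from a projective onto $M$) is the desuspension of $M$, and $\Omega^i$ is defined for all $i\in\mathbb{Z}$. $\mathsf{stmod}(kG)$ is the full subcategory of modules stably isomorphic to finitely generated ones. $\mathsf{Thick}_G\langle k\rangle$ is the smallest full triangulated subcategory of $\mathsf{StMod}(kG)$ closed under retracts and containing the trivial module $k$. $B_0$ is the principal block of $kG$, i.e., $B_0=e_0kG$ where $e_0$ is the primitive central idempotent acting as the identity on $k$; $\mathsf{stmod}(B_0)$ is the full subcategory of $\mathsf{stmod}(kG)$ of modules whose projective-free summands lie in $B_0$ (i.e., $e_0$ acts on them as the identity). A map $f$ is a ghost if $\underline{\mathrm{Hom}}(\Omega^i k,f)=0$ for all $i\in\mathbb{Z}$. The ghost number of $kG$ is the smallest $n$ such that every composite of $n$ ghosts in $\mathsf{Thick}_G\langle k\rangle$ is stably zero (infinite if no such $n$ exists). *)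

theory Defs
  imports "HOL-Algebra.Module" "HOL-Algebra.AbelCoset" "HOL-Library.Extended_Nat"
begin

text \<open>
  The \<open>module\<close> locale of HOL-Algebra requires a commutative ring of scalars; here the
  scalars are a group algebra. Its record type \<open>('a, 'm) module\<close> is reused; the ring fields
  \<open>mult\<close> and \<open>one\<close> of that record play no role.
\<close>

locale left_module = R?: ring R + M?: abelian_group M
    for R :: "('a, 'r) ring_scheme" (structure) and M :: "('a, 'm, 's) module_scheme" (structure) +
  assumes smult_closed:
      "\<lbrakk>a \<in> carrier R; x \<in> carrier M\<rbrakk> \<Longrightarrow> a \<odot>\<^bsub>M\<^esub> x \<in> carrier M"
    and smult_l_distr:
      "\<lbrakk>a \<in> carrier R; b \<in> carrier R; x \<in> carrier M\<rbrakk> \<Longrightarrow>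
        (a \<oplus>\<^bsub>R\<^esub> b) \<odot>\<^bsub>M\<^esub> x = a \<odot>\<^bsub>M\<^esub> x \<oplus>\<^bsub>M\<^esub> b \<odot>\<^bsub>M\<^esub> x"
    and smult_r_distr:
      "\<lbrakk>a \<in> carrier R; x \<in> carrier M; y \<in> carrier M\<rbrakk> \<Longrightarrow>
        a \<odot>\<^bsub>M\<^esub> (x \<oplus>\<^bsub>M\<^esub> y) = a \<odot>\<^bsub>M\<^esub> x \<oplus>\<^bsub>M\<^esub> a \<odot>\<^bsub>M\<^esub> y"
    and smult_assoc:
      "\<lbrakk>a \<in> carrier R; b \<in> carrier R; x \<in> carrier M\<rbrakk> \<Longrightarrow>
        (a \<otimes>\<^bsub>R\<^esub> b) \<odot>\<^bsub>M\<^esub> x = a \<odot>\<^bsub>M\<^esub> (b \<odot>\<^bsub>M\<^esub> x)"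
    and smult_one:
      "x \<in> carrier M \<Longrightarrow> \<one>\<^bsub>R\<^esub> \<odot>\<^bsub>M\<^esub> x = x"

definition lmod_hom ::
  "('a, 'r) ring_scheme \<Rightarrow> ('a, 'm) module \<Rightarrow> ('a, 'n) module \<Rightarrow> ('m \<Rightarrow> 'n) set" where
  "lmod_hom R M N = {f \<in> carrier M \<rightarrow> carrier N.
     (\<forall>x\<in>carrier M. \<forall>y\<in>carrier M. f (x \<oplus>\<^bsub>M\<^esub> y) = f x \<oplus>\<^bsub>N\<^esub> f y) \<and>
     (\<forall>a\<in>carrier R. \<forall>x\<in>carrier M. f (a \<odot>\<^bsub>M\<^esub> x) = a \<odot>\<^bsub>N\<^esub> f x)}"

definition lmod_iso ::
  "('a, 'r) ring_scheme \<Rightarrow> ('a, 'm) module \<Rightarrow> ('a, 'n) module \<Rightarrow> bool" where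
  "lmod_iso R M N \<longleftrightarrow> (\<exists>f \<in> lmod_hom R M N. bij_betw f (carrier M) (carrier N))"

definition fin_gen_module :: "('a, 'r) ring_scheme \<Rightarrow> ('a, 'm) module \<Rightarrow> bool" where
  "fin_gen_module R M \<longleftrightarrow> left_module R M \<and>
     (\<exists>S. finite S \<and> S \<subseteq> carrier M \<and> (\<forall>H. submodule H R M \<and> S \<subseteq> H \<longrightarrow> H = carrier M))"

definition short_exact ::
  "('a, 'r) ring_scheme \<Rightarrow> ('a, 'm) module \<Rightarrow> ('m \<Rightarrow> 'm) \<Rightarrow> ('a, 'm) module \<Rightarrow>
    ('m \<Rightarrow> 'm) \<Rightarrow> ('a, 'm) module \<Rightarrow> bool" where
  "short_exact R A i B q C \<longleftrightarrow>
     left_module R A \<and> left_module R B \<and> left_module R C \<and>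
     i \<in> lmod_hom R A B \<and> q \<in> lmod_hom R B C \<and>
     inj_on i (carrier A) \<and> q ` carrier B = carrier C \<and>
     i ` carrier A = {b \<in> carrier B. q b = \<zero>\<^bsub>C\<^esub>}"

text \<open>
  The modules under consideration are those with underlying set inside the type \<open>'m\<close>, which
  acts as the universe; the lifting property is tested against these modules.
\<close>

definition projective_module :: "('a, 'r) ring_scheme \<Rightarrow> ('a, 'm) module \<Rightarrow> bool" where
  "projective_module R P \<longleftrightarrow> left_module R P \<and>
     (\<forall>(M :: ('a, 'm) module) (N :: ('a, 'm) module) q f.
        left_module R M \<and> left_module R N \<and>
        q \<in> lmod_hom R M N \<and> q ` carrier M = carrier N \<and> f \<in> lmod_hom R P N \<longrightarrow>
        (\<exists>h \<in> lmod_hom R P M. \<forall>x\<in>carrier P. q (h x) = f x))"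

definition direct_summand :: "('a, 'r) ring_scheme \<Rightarrow> ('a, 'm) module \<Rightarrow> 'm set \<Rightarrow> bool" where
  "direct_summand R M H \<longleftrightarrow> submodule H R M \<and>
     (\<exists>H'. submodule H' R M \<and> H \<inter> H' = {\<zero>\<^bsub>M\<^esub>} \<and> H <+>\<^bsub>M\<^esub> H' = carrier M)"

definition projective_free :: "('a, 'r) ring_scheme \<Rightarrow> ('a, 'm) module \<Rightarrow> bool" where
  "projective_free R M \<longleftrightarrow> left_module R M \<and>
     (\<forall>H. direct_summand R M H \<and> projective_module R (M\<lparr>carrier := H\<rparr>) \<longrightarrow> H = {\<zero>\<^bsub>M\<^esub>})"


section \<open>The stable module category\<close>

text \<open>
  A morphism \<open>M \<rightarrow> N\<close> of the stable category is represented by an element of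
  \<open>lmod_hom R M N\<close>, two such being identified when \<open>stably_eq\<close> holds.
\<close>

definition factors_through_projective ::
  "('a, 'r) ring_scheme \<Rightarrow> ('a, 'm) module \<Rightarrow> ('a, 'm) module \<Rightarrow> ('m \<Rightarrow> 'm) \<Rightarrow> bool" where
  "factors_through_projective R M N f \<longleftrightarrow>
     (\<exists>(P :: ('a, 'm) module) u v.
        projective_module R P \<and> u \<in> lmod_hom R M P \<and> v \<in> lmod_hom R P N \<and>
        (\<forall>x\<in>carrier M. f x = v (u x)))"

definition stably_eq ::
  "('a, 'r) ring_scheme \<Rightarrow> ('a, 'm) module \<Rightarrow> ('a, 'm) module \<Rightarrow>
    ('m \<Rightarrow> 'm) \<Rightarrow> ('m \<Rightarrow> 'm) \<Rightarrow> bool" where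
  "stably_eq R M N f g \<longleftrightarrow> factors_through_projective R M N (\<lambda>x. f x \<ominus>\<^bsub>N\<^esub> g x)"

abbreviation stably_zero ::
  "('a, 'r) ring_scheme \<Rightarrow> ('a, 'm) module \<Rightarrow> ('a, 'm) module \<Rightarrow> ('m \<Rightarrow> 'm) \<Rightarrow> bool" where
  "stably_zero R M N f \<equiv> factors_through_projective R M N f"

definition stable_iso_map ::
  "('a, 'r) ring_scheme \<Rightarrow> ('a, 'm) module \<Rightarrow> ('a, 'm) module \<Rightarrow> ('m \<Rightarrow> 'm) \<Rightarrow> bool" where
  "stable_iso_map R M N f \<longleftrightarrow>
     left_module R M \<and> left_module R N \<and> f \<in> lmod_hom R M N \<and>
     (\<exists>g \<in> lmod_hom R N M. stably_eq R M M (g \<circ> f) id \<and> stably_eq R N N (f \<circ> g) id)"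

definition stably_isomorphic ::
  "('a, 'r) ring_scheme \<Rightarrow> ('a, 'm) module \<Rightarrow> ('a, 'm) module \<Rightarrow> bool" where
  "stably_isomorphic R M N \<longleftrightarrow> (\<exists>f. stable_iso_map R M N f)"

definition stable_retract ::
  "('a, 'r) ring_scheme \<Rightarrow> ('a, 'm) module \<Rightarrow> ('a, 'm) module \<Rightarrow> bool" where
  "stable_retract R N M \<longleftrightarrow> left_module R N \<and> left_module R M \<and>
     (\<exists>s \<in> lmod_hom R N M. \<exists>r \<in> lmod_hom R M N. stably_eq R N N (r \<circ> s) id)"

text \<open>
  \<open>syzygy R M N\<close> says that \<open>N\<close> is a model of \<open>\<Omega> M\<close>. Over a group algebra of a finite group
  projectives and injectives coincide, so \<open>syzygy R N M\<close> says equally that \<open>N\<close> is a model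
  of \<open>\<Omega>\<^sup>-\<^sup>1 M\<close>, the cokernel of an embedding of \<open>M\<close> into an injective.
  \<open>is_Omega R i M N\<close> says that \<open>N\<close> is a model of \<open>\<Omega>\<^sup>i M\<close>; all models are stably isomorphic.
\<close>

definition syzygy ::
  "('a, 'r) ring_scheme \<Rightarrow> ('a, 'm) module \<Rightarrow> ('a, 'm) module \<Rightarrow> bool" where
  "syzygy R M N \<longleftrightarrow> (\<exists>i P q. projective_module R P \<and> short_exact R N i P q M)"

definition is_Omega ::
  "('a, 'r) ring_scheme \<Rightarrow> int \<Rightarrow> ('a, 'm) module \<Rightarrow> ('a, 'm) module \<Rightarrow> bool" where
  "is_Omega R i M N \<longleftrightarrow>
     (if 0 \<le> i then (syzygy R ^^ nat i) M N else (syzygy R ^^ nat (- i)) N M)"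

text \<open>
  The exact triangles of the stable category are those isomorphic to the triangle
  \<open>A \<rightarrow> B \<rightarrow> C \<rightarrow> \<Omega>\<^sup>-\<^sup>1 A\<close> of a short exact sequence. Only the first two maps are recorded:
  \<open>exact_triangle R X f Y g Z\<close> says that \<open>X \<rightarrow> Y \<rightarrow> Z\<close> can be completed to an exact triangle
  by some \<open>Z \<rightarrow> \<Omega>\<^sup>-\<^sup>1 X\<close>. Given the isomorphism on the first three terms, that third map is
  obtained by transport, so no condition on it is needed.
\<close>

definition exact_triangle ::
  "('a, 'r) ring_scheme \<Rightarrow> ('a, 'm) module \<Rightarrow> ('m \<Rightarrow> 'm) \<Rightarrow> ('a, 'm) module \<Rightarrow>
    ('m \<Rightarrow> 'm) \<Rightarrow> ('a, 'm) module \<Rightarrow> bool" where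
  "exact_triangle R X f Y g Z \<longleftrightarrow>
     f \<in> lmod_hom R X Y \<and> g \<in> lmod_hom R Y Z \<and>
     (\<exists>A i B q C \<alpha> \<beta> \<gamma>. short_exact R A i B q C \<and>
        stable_iso_map R X A \<alpha> \<and> stable_iso_map R Y B \<beta> \<and> stable_iso_map R Z C \<gamma> \<and>
        stably_eq R X B (\<beta> \<circ> f) (i \<circ> \<alpha>) \<and> stably_eq R Y C (\<gamma> \<circ> g) (q \<circ> \<beta>))"

text \<open>Full subcategories are given by their sets of objects.\<close>

definition triangulated_subcategory ::
  "('a, 'r) ring_scheme \<Rightarrow> ('a, 'm) module set \<Rightarrow> bool" where
  "triangulated_subcategory R \<C> \<longleftrightarrow>
     \<C> \<noteq> {} \<and> (\<forall>M\<in>\<C>. left_module R M) \<and>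
     (\<forall>M N. M \<in> \<C> \<and> stably_isomorphic R M N \<longrightarrow> N \<in> \<C>) \<and>
     (\<forall>M N. syzygy R M N \<longrightarrow> (M \<in> \<C> \<longleftrightarrow> N \<in> \<C>)) \<and>
     (\<forall>X f Y g Z. exact_triangle R X f Y g Z \<and> X \<in> \<C> \<and> Y \<in> \<C> \<longrightarrow> Z \<in> \<C>)"

definition thick_subcategory ::
  "('a, 'r) ring_scheme \<Rightarrow> ('a, 'm) module set \<Rightarrow> bool" where
  "thick_subcategory R \<C> \<longleftrightarrow> triangulated_subcategory R \<C> \<and>
     (\<forall>M N. M \<in> \<C> \<and> stable_retract R N M \<longrightarrow> N \<in> \<C>)"

definition stmod :: "('a, 'r) ring_scheme \<Rightarrow> ('a, 'm) module set" where
  "stmod R = {M. \<exists>N. fin_gen_module R N \<and> stably_isomorphic R M N}"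


section \<open>Group algebras, the trivial module and the principal block\<close>

definition has_characteristic :: "('k, 'r) ring_scheme \<Rightarrow> nat \<Rightarrow> bool" where
  "has_characteristic K p \<longleftrightarrow> (\<forall>n :: nat. [n] \<cdot>\<^bsub>K\<^esub> \<one>\<^bsub>K\<^esub> = \<zero>\<^bsub>K\<^esub> \<longleftrightarrow> p dvd n)"

text \<open>For finite \<open>G\<close>; the function \<open>a\<close> represents the sum of the \<open>a g \<cdot> g\<close>.\<close>

definition group_algebra ::
  "('k, 'r) ring_scheme \<Rightarrow> ('g, 's) monoid_scheme \<Rightarrow> ('g \<Rightarrow> 'k) ring" where
  "group_algebra K G = \<lparr>
     carrier = carrier G \<rightarrow>\<^sub>E carrier K,
     mult = (\<lambda>a b. \<lambda>x\<in>carrier G. \<Oplus>\<^bsub>K\<^esub>y\<in>carrier G. a y \<otimes>\<^bsub>K\<^esub> b (inv\<^bsub>G\<^esub> y \<otimes>\<^bsub>G\<^esub> x)),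
     one = (\<lambda>x\<in>carrier G. if x = \<one>\<^bsub>G\<^esub> then \<one>\<^bsub>K\<^esub> else \<zero>\<^bsub>K\<^esub>),
     zero = (\<lambda>x\<in>carrier G. \<zero>\<^bsub>K\<^esub>),
     add = (\<lambda>a b. \<lambda>x\<in>carrier G. a x \<oplus>\<^bsub>K\<^esub> b x)\<rparr>"

text \<open>Every group element acts as the identity, so \<open>a\<close> acts by its augmentation.\<close>

definition trivial_module ::
  "('k, 'r) ring_scheme \<Rightarrow> ('g, 's) monoid_scheme \<Rightarrow> ('g \<Rightarrow> 'k, 'k) module" where
  "trivial_module K G = \<lparr>
     carrier = carrier K, mult = mult K, one = one K, zero = zero K, add = add K,
     smult = (\<lambda>a x. (\<Oplus>\<^bsub>K\<^esub>g\<in>carrier G. a g) \<otimes>\<^bsub>K\<^esub> x)\<rparr>"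

text \<open>The copies of the trivial module whose underlying set lies in the universe \<open>'m\<close>.\<close>

definition is_trivial_module ::
  "('k, 'r) ring_scheme \<Rightarrow> ('g, 's) monoid_scheme \<Rightarrow> ('g \<Rightarrow> 'k, 'm) module \<Rightarrow> bool" where
  "is_trivial_module K G T \<longleftrightarrow> left_module (group_algebra K G) T \<and>
     lmod_iso (group_algebra K G) (trivial_module K G) T"

definition central_idempotent :: "('a, 'r) ring_scheme \<Rightarrow> 'a \<Rightarrow> bool" where
  "central_idempotent R e \<longleftrightarrow> e \<in> carrier R \<and> e \<otimes>\<^bsub>R\<^esub> e = e \<and>
     (\<forall>a\<in>carrier R. a \<otimes>\<^bsub>R\<^esub> e = e \<otimes>\<^bsub>R\<^esub> a)"

definition primitive_central_idempotent :: "('a, 'r) ring_scheme \<Rightarrow> 'a \<Rightarrow> bool" where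
  "primitive_central_idempotent R e \<longleftrightarrow> central_idempotent R e \<and> e \<noteq> \<zero>\<^bsub>R\<^esub> \<and>
     (\<forall>f g. central_idempotent R f \<and> central_idempotent R g \<and>
        f \<otimes>\<^bsub>R\<^esub> g = \<zero>\<^bsub>R\<^esub> \<and> e = f \<oplus>\<^bsub>R\<^esub> g \<longrightarrow> f = \<zero>\<^bsub>R\<^esub> \<or> g = \<zero>\<^bsub>R\<^esub>)"

definition principal_idempotent ::
  "('k, 'r) ring_scheme \<Rightarrow> ('g, 's) monoid_scheme \<Rightarrow> 'g \<Rightarrow> 'k" where
  "principal_idempotent K G = (THE e. primitive_central_idempotent (group_algebra K G) e \<and>
     (\<forall>x\<in>carrier (trivial_module K G). e \<odot>\<^bsub>trivial_module K G\<^esub> x = x))"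

definition stmod_principal_block ::
  "('k, 'r) ring_scheme \<Rightarrow> ('g, 's) monoid_scheme \<Rightarrow> ('g \<Rightarrow> 'k, 'm) module set" where
  "stmod_principal_block K G = {M \<in> stmod (group_algebra K G).
     \<forall>H. direct_summand (group_algebra K G) M H \<and>
         projective_free (group_algebra K G) (M\<lparr>carrier := H\<rparr>) \<longrightarrow>
         (\<forall>x\<in>H. principal_idempotent K G \<odot>\<^bsub>M\<^esub> x = x)}"


section \<open>Ghosts\<close>

definition thick_trivial ::
  "('k, 'r) ring_scheme \<Rightarrow> ('g, 's) monoid_scheme \<Rightarrow> ('g \<Rightarrow> 'k, 'm) module set" where
  "thick_trivial K G = \<Inter> {\<C>. thick_subcategory (group_algebra K G) \<C> \<and>
     (\<forall>T. is_trivial_module K G T \<longrightarrow> T \<in> \<C>)}"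

definition ghost ::
  "('k, 'r) ring_scheme \<Rightarrow> ('g, 's) monoid_scheme \<Rightarrow> ('g \<Rightarrow> 'k, 'm) module \<Rightarrow>
    ('g \<Rightarrow> 'k, 'm) module \<Rightarrow> ('m \<Rightarrow> 'm) \<Rightarrow> bool" where
  "ghost K G X Y f \<longleftrightarrow> f \<in> lmod_hom (group_algebra K G) X Y \<and>
     (\<forall>(i :: int) T W. is_trivial_module K G T \<and> is_Omega (group_algebra K G) i T W \<longrightarrow>
        (\<forall>g \<in> lmod_hom (group_algebra K G) W X. stably_zero (group_algebra K G) W Y (f \<circ> g)))"

primrec composite :: "(nat \<Rightarrow> 'm \<Rightarrow> 'm) \<Rightarrow> nat \<Rightarrow> 'm \<Rightarrow> 'm" where
  "composite f 0 = id"
| "composite f (Suc n) = f n \<circ> composite f n"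

definition ghost_composites_vanish ::
  "'m itself \<Rightarrow> ('k, 'r) ring_scheme \<Rightarrow> ('g, 's) monoid_scheme \<Rightarrow> nat \<Rightarrow> bool" where
  "ghost_composites_vanish _ K G n \<longleftrightarrow>
     (\<forall>(X :: nat \<Rightarrow> ('g \<Rightarrow> 'k, 'm) module) f.
        (\<forall>i\<le>n. X i \<in> thick_trivial K G) \<and> (\<forall>i<n. ghost K G (X i) (X (Suc i)) (f i)) \<longrightarrow>
        stably_zero (group_algebra K G) (X 0) (X n) (composite f n))"

text \<open>The infimum in \<open>enat\<close> is the minimum, or \<open>\<infinity>\<close> for the empty set.\<close>

definition ghost_number ::
  "'m itself \<Rightarrow> ('k, 'r) ring_scheme \<Rightarrow> ('g, 's) monoid_scheme \<Rightarrow> enat" where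
  "ghost_number U K G = Inf (enat ` {n. ghost_composites_vanish U K G n})"

text \<open>
  The universe \<open>'m\<close> is large enough if it has at least the cardinality of \<open>k \<times> \<nat>\<close>: it then
  contains copies of all finitely generated \<open>kG\<close>-modules and of projective covers, injective
  hulls and direct sums of its members.
\<close>

definition large_universe :: "'m itself \<Rightarrow> ('k, 'r) ring_scheme \<Rightarrow> bool" where
  "large_universe _ K \<longleftrightarrow> (\<exists>j :: 'k \<times> nat \<Rightarrow> 'm. inj_on j (carrier K \<times> UNIV))"

end

theory Submission
  imports Defs
begin

text \<open>
  Say that a module \<open>X\<close> has ghost length at most \<open>n\<close> if every composite of \<open>n\<close> ghosts out of \<open>X\<close>
  is stably zero. The trivial module has ghost length at most \<open>1\<close>. Ghost length does not increase
  under stable retracts, is invariant under \<open>\<Omega>\<close> and \<open>\<Omega>\<^sup>-\<^sup>1\<close>, and is subadditive on cones. So the modules of finite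
  ghost length form a thick subcategory (\<open>thick_finite_ghost_length\<close>), and every object of
  \<open>Thick\<langle>k\<rangle>\<close> has finite ghost length. The theorem asks for a bound that is the same for all objects.

  Here the hypothesis enters. The simple modules on which \<open>e\<^sub>0\<close> acts as the identity belong to
  \<open>stmod(B\<^sub>0) = Thick\<langle>k\<rangle>\<close>, and up to isomorphism there are only finitely many of them
  (\<open>finitely_many_simple_modules\<close>), so they have a common bound \<open>m\<close>. Ghost length is subadditive on
  extensions, and a finite direct sum of modules of length at most \<open>m\<close> has length at most \<open>m\<close>.
  A finitely generated module fixed by \<open>e\<^sub>0\<close> has a filtration with semisimple layers whose number is at most the
  length \<open>r\<close> of the left regular module, because each step enlarges the annihilators of elements; hence
  its ghost length is at most \<open>r m\<close>, independently of its dimension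
  (\<open>ghost_length_le_by_annihilators\<close>). Finally, an object of \<open>Thick\<langle>k\<rangle>\<close> is stably isomorphic to a
  finitely generated module, this is a stable retract of a projective-free direct summand
  (\<open>projective_free_summand\<close>), and \<open>e\<^sub>0\<close> fixes that summand.

  The arguments about ghosts are made with short exact sequences of modules, and depend only on the fact
  that modules over \<open>kG\<close> form a Frobenius category. That fact is obtained from relative traces, in the
  manner of Higman's criterion (\<open>frobenius_universe_KG\<close>).
\<close>

section \<open>Modules over a ring that need not be commutative\<close>

lemma lmod_homI:
  assumes "\<And>x. x \<in> carrier M \<Longrightarrow> f x \<in> carrier N"
    and "\<And>x y. x \<in> carrier M \<Longrightarrow> y \<in> carrier M \<Longrightarrow> f (x \<oplus>\<^bsub>M\<^esub> y) = f x \<oplus>\<^bsub>N\<^esub> f y"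
    and "\<And>a x. a \<in> carrier R \<Longrightarrow> x \<in> carrier M \<Longrightarrow> f (a \<odot>\<^bsub>M\<^esub> x) = a \<odot>\<^bsub>N\<^esub> f x"
  shows "f \<in> lmod_hom R M N"
  using assms by (auto simp: lmod_hom_def)

lemma lmod_hom_closed: "f \<in> lmod_hom R M N \<Longrightarrow> x \<in> carrier M \<Longrightarrow> f x \<in> carrier N"
  by (auto simp: lmod_hom_def)

lemma lmod_hom_add:
  "f \<in> lmod_hom R M N \<Longrightarrow> x \<in> carrier M \<Longrightarrow> y \<in> carrier M \<Longrightarrow> f (x \<oplus>\<^bsub>M\<^esub> y) = f x \<oplus>\<^bsub>N\<^esub> f y"
  by (auto simp: lmod_hom_def)

lemma lmod_hom_smult:
  "f \<in> lmod_hom R M N \<Longrightarrow> a \<in> carrier R \<Longrightarrow> x \<in> carrier M \<Longrightarrow> f (a \<odot>\<^bsub>M\<^esub> x) = a \<odot>\<^bsub>N\<^esub> f x"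
  by (auto simp: lmod_hom_def)

lemma lmod_hom_id: "id \<in> lmod_hom R M M"
  by (auto simp: lmod_hom_def)

lemma lmod_hom_comp:
  "g \<in> lmod_hom R N L \<Longrightarrow> f \<in> lmod_hom R M N \<Longrightarrow> g \<circ> f \<in> lmod_hom R M L"
  by (rule lmod_homI) (simp_all add: lmod_hom_closed lmod_hom_add lmod_hom_smult)

lemma left_moduleD:
  assumes "left_module R M"
  shows "ring R" "abelian_group M"
  using assms by (auto simp: left_module_def)

lemma (in abelian_group) minus_eq_zero_iff:
  assumes "x \<in> carrier G" "y \<in> carrier G"
  shows "x \<ominus> y = \<zero> \<longleftrightarrow> x = y"
proof
  assume "x \<ominus> y = \<zero>"
  then have "\<ominus> (\<ominus> y) = x" using assms by (intro minus_equality) (simp_all add: a_minus_def)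
  then show "x = y" using assms by simp
qed (use assms in \<open>simp add: a_minus_def r_neg\<close>)

lemma left_module_smult_zero:
  assumes "left_module R M" "a \<in> carrier R"
  shows "a \<odot>\<^bsub>M\<^esub> \<zero>\<^bsub>M\<^esub> = \<zero>\<^bsub>M\<^esub>"
proof -
  interpret M: left_module R M by fact
  have "a \<odot>\<^bsub>M\<^esub> \<zero>\<^bsub>M\<^esub> \<oplus>\<^bsub>M\<^esub> a \<odot>\<^bsub>M\<^esub> \<zero>\<^bsub>M\<^esub> = a \<odot>\<^bsub>M\<^esub> \<zero>\<^bsub>M\<^esub>"
    using assms M.smult_r_distr[of a "\<zero>\<^bsub>M\<^esub>" "\<zero>\<^bsub>M\<^esub>"] by simp
  then show ?thesis using assms M.smult_closed[of a "\<zero>\<^bsub>M\<^esub>"] by simp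
qed

lemma left_module_smult_minus:
  assumes "left_module R M" "a \<in> carrier R" "x \<in> carrier M"
  shows "a \<odot>\<^bsub>M\<^esub> (\<ominus>\<^bsub>M\<^esub> x) = \<ominus>\<^bsub>M\<^esub> (a \<odot>\<^bsub>M\<^esub> x)"
proof -
  interpret M: left_module R M by fact
  have "a \<odot>\<^bsub>M\<^esub> (\<ominus>\<^bsub>M\<^esub> x) \<oplus>\<^bsub>M\<^esub> a \<odot>\<^bsub>M\<^esub> x = \<zero>\<^bsub>M\<^esub>"
    using assms M.smult_r_distr[of a "\<ominus>\<^bsub>M\<^esub> x" x] left_module_smult_zero[OF assms(1,2)] by (simp add: M.l_neg)
  then show "a \<odot>\<^bsub>M\<^esub> (\<ominus>\<^bsub>M\<^esub> x) = \<ominus>\<^bsub>M\<^esub> (a \<odot>\<^bsub>M\<^esub> x)"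
    using assms by (simp add: M.smult_closed M.minus_equality)
qed

lemma left_module_zero_smult:
  assumes "left_module R M" "x \<in> carrier M"
  shows "\<zero>\<^bsub>R\<^esub> \<odot>\<^bsub>M\<^esub> x = \<zero>\<^bsub>M\<^esub>"
proof -
  interpret M: left_module R M by fact
  have "\<zero>\<^bsub>R\<^esub> \<odot>\<^bsub>M\<^esub> x \<oplus>\<^bsub>M\<^esub> \<zero>\<^bsub>R\<^esub> \<odot>\<^bsub>M\<^esub> x = \<zero>\<^bsub>R\<^esub> \<odot>\<^bsub>M\<^esub> x"
    using assms M.smult_l_distr[of "\<zero>\<^bsub>R\<^esub>" "\<zero>\<^bsub>R\<^esub>" x] by simp
  then show ?thesis using assms M.smult_closed[of "\<zero>\<^bsub>R\<^esub>" x] by simp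
qed

lemma lmod_hom_zero:
  assumes "left_module R M" "left_module R N" "f \<in> lmod_hom R M N"
  shows "f \<zero>\<^bsub>M\<^esub> = \<zero>\<^bsub>N\<^esub>"
proof -
  interpret M: left_module R M by fact
  interpret N: left_module R N by fact
  have "f \<zero>\<^bsub>M\<^esub> \<oplus>\<^bsub>N\<^esub> f \<zero>\<^bsub>M\<^esub> = f \<zero>\<^bsub>M\<^esub>"
    using lmod_hom_add[OF assms(3), of "\<zero>\<^bsub>M\<^esub>" "\<zero>\<^bsub>M\<^esub>"] by simp
  then show ?thesis using lmod_hom_closed[OF assms(3), of "\<zero>\<^bsub>M\<^esub>"] by simp
qed

lemma lmod_hom_neg:
  assumes "left_module R M" "left_module R N" "f \<in> lmod_hom R M N" "x \<in> carrier M"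
  shows "f (\<ominus>\<^bsub>M\<^esub> x) = \<ominus>\<^bsub>N\<^esub> f x"
proof -
  interpret M: left_module R M by fact
  interpret N: left_module R N by fact
  have "f (\<ominus>\<^bsub>M\<^esub> x) \<oplus>\<^bsub>N\<^esub> f x = \<zero>\<^bsub>N\<^esub>"
    using lmod_hom_add[OF assms(3), of "\<ominus>\<^bsub>M\<^esub> x" x] assms lmod_hom_zero[OF assms(1-3)]
    by (simp add: M.l_neg)
  then show ?thesis using lmod_hom_closed[OF assms(3)] assms(4) by (simp add: N.minus_equality)
qed

lemma lmod_hom_minus:
  assumes "left_module R M" "left_module R N" "f \<in> lmod_hom R M N" "x \<in> carrier M" "y \<in> carrier M"
  shows "f (x \<ominus>\<^bsub>M\<^esub> y) = f x \<ominus>\<^bsub>N\<^esub> f y"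
proof -
  interpret M: left_module R M by fact
  show ?thesis using assms by (simp add: a_minus_def lmod_hom_add lmod_hom_neg)
qed

lemma lmod_hom_plus:
  assumes "left_module R N" "f \<in> lmod_hom R M N" "g \<in> lmod_hom R M N"
  shows "(\<lambda>x. f x \<oplus>\<^bsub>N\<^esub> g x) \<in> lmod_hom R M N"
proof -
  interpret N: left_module R N by fact
  note h = lmod_hom_closed[OF assms(2)] lmod_hom_closed[OF assms(3)]
    lmod_hom_add[OF assms(2)] lmod_hom_add[OF assms(3)]
    lmod_hom_smult[OF assms(2)] lmod_hom_smult[OF assms(3)]
  show ?thesis
    by (rule lmod_homI) (simp_all add: h N.a_ac N.smult_r_distr)
qed

lemma lmod_hom_uminus:
  assumes "left_module R N" "f \<in> lmod_hom R M N"
  shows "(\<lambda>x. \<ominus>\<^bsub>N\<^esub> f x) \<in> lmod_hom R M N"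
proof -
  interpret N: left_module R N by fact
  note h = lmod_hom_closed[OF assms(2)] lmod_hom_add[OF assms(2)] lmod_hom_smult[OF assms(2)]
  show ?thesis
    by (rule lmod_homI) (simp_all add: h N.minus_add left_module_smult_minus[OF assms(1)])
qed

lemma lmod_hom_diff:
  assumes "left_module R N" "f \<in> lmod_hom R M N" "g \<in> lmod_hom R M N"
  shows "(\<lambda>x. f x \<ominus>\<^bsub>N\<^esub> g x) \<in> lmod_hom R M N"
  unfolding a_minus_def by (intro lmod_hom_plus lmod_hom_uminus assms)

lemma lmod_hom_null:
  assumes "left_module R N"
  shows "(\<lambda>x. \<zero>\<^bsub>N\<^esub>) \<in> lmod_hom R M N"
proof -
  interpret N: left_module R N by fact
  show ?thesis by (rule lmod_homI) (simp_all add: left_module_smult_zero[OF assms(1)])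
qed

text \<open>Module axioms pass along a surjection that respects the operations, so a structure on
  representatives of cosets, or on a copy of a module in another type, need not be checked
  axiom by axiom.\<close>
lemma left_module_image:
  fixes M :: "('a, 'm) module" and N :: "('a, 'n) module"
  assumes "left_module R M"
    and onto: "q ` carrier M = carrier N"
    and add: "\<And>x y. x \<in> carrier M \<Longrightarrow> y \<in> carrier M \<Longrightarrow> q x \<oplus>\<^bsub>N\<^esub> q y = q (x \<oplus>\<^bsub>M\<^esub> y)"
    and smult: "\<And>a x. a \<in> carrier R \<Longrightarrow> x \<in> carrier M \<Longrightarrow> a \<odot>\<^bsub>N\<^esub> q x = q (a \<odot>\<^bsub>M\<^esub> x)"
    and zero: "\<zero>\<^bsub>N\<^esub> = q \<zero>\<^bsub>M\<^esub>"
  shows "left_module R N"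
proof -
  interpret M: left_module R M by fact
  have all: "(\<forall>y\<in>carrier N. P y) \<longleftrightarrow> (\<forall>x\<in>carrier M. P (q x))" for P
    unfolding onto[symmetric] by blast
  have ex: "(\<exists>y\<in>carrier N. P y) \<longleftrightarrow> (\<exists>x\<in>carrier M. P (q x))" for P
    unfolding onto[symmetric] by blast
  have onto': "q x \<in> carrier N" if "x \<in> carrier M" for x using onto that by blast
  have "abelian_group N"
  proof -
    have "\<forall>x\<in>carrier N. \<forall>y\<in>carrier N. x \<oplus>\<^bsub>N\<^esub> y \<in> carrier N \<and> x \<oplus>\<^bsub>N\<^esub> y = y \<oplus>\<^bsub>N\<^esub> x"
      unfolding all by (simp add: add onto' M.a_comm)
    moreover have "\<forall>x\<in>carrier N. \<forall>y\<in>carrier N. \<forall>z\<in>carrier N. x \<oplus>\<^bsub>N\<^esub> y \<oplus>\<^bsub>N\<^esub> z = x \<oplus>\<^bsub>N\<^esub> (y \<oplus>\<^bsub>N\<^esub> z)"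
      unfolding all by (simp add: add M.a_assoc)
    moreover have "\<forall>x\<in>carrier N. \<zero>\<^bsub>N\<^esub> \<oplus>\<^bsub>N\<^esub> x = x" unfolding all by (simp add: add zero)
    moreover have "\<forall>x\<in>carrier N. \<exists>y\<in>carrier N. y \<oplus>\<^bsub>N\<^esub> x = \<zero>\<^bsub>N\<^esub>"
      unfolding all ex
    proof
      fix x assume x: "x \<in> carrier M"
      then have "q (\<ominus>\<^bsub>M\<^esub> x) \<oplus>\<^bsub>N\<^esub> q x = \<zero>\<^bsub>N\<^esub>" by (simp add: add zero M.l_neg)
      then show "\<exists>y\<in>carrier M. q y \<oplus>\<^bsub>N\<^esub> q x = \<zero>\<^bsub>N\<^esub>"
        using x by (intro bexI[of _ "\<ominus>\<^bsub>M\<^esub> x"]) simp_all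
    qed
    moreover have "\<zero>\<^bsub>N\<^esub> \<in> carrier N" by (simp add: zero onto')
    ultimately show ?thesis by (intro abelian_groupI) auto
  qed
  moreover have "left_module_axioms R N"
  proof -
    have "\<forall>x\<in>carrier N. \<forall>a\<in>carrier R. a \<odot>\<^bsub>N\<^esub> x \<in> carrier N"
      unfolding all by (simp add: smult onto' M.smult_closed)
    moreover have "\<forall>x\<in>carrier N. \<forall>a\<in>carrier R. \<forall>b\<in>carrier R.
        (a \<oplus>\<^bsub>R\<^esub> b) \<odot>\<^bsub>N\<^esub> x = a \<odot>\<^bsub>N\<^esub> x \<oplus>\<^bsub>N\<^esub> b \<odot>\<^bsub>N\<^esub> x"
      unfolding all by (simp add: smult add M.smult_closed M.smult_l_distr)
    moreover have "\<forall>x\<in>carrier N. \<forall>y\<in>carrier N. \<forall>a\<in>carrier R.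
        a \<odot>\<^bsub>N\<^esub> (x \<oplus>\<^bsub>N\<^esub> y) = a \<odot>\<^bsub>N\<^esub> x \<oplus>\<^bsub>N\<^esub> a \<odot>\<^bsub>N\<^esub> y"
      unfolding all by (simp add: smult add M.smult_closed M.smult_r_distr)
    moreover have "\<forall>x\<in>carrier N. \<forall>a\<in>carrier R. \<forall>b\<in>carrier R.
        (a \<otimes>\<^bsub>R\<^esub> b) \<odot>\<^bsub>N\<^esub> x = a \<odot>\<^bsub>N\<^esub> (b \<odot>\<^bsub>N\<^esub> x)"
      unfolding all by (simp add: smult M.smult_closed M.smult_assoc)
    moreover have "\<forall>x\<in>carrier N. \<one>\<^bsub>R\<^esub> \<odot>\<^bsub>N\<^esub> x = x"
      unfolding all by (simp add: smult M.smult_one)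
    ultimately show ?thesis unfolding left_module_axioms_def by simp
  qed
  ultimately show ?thesis
    using M.R.ring_axioms by (simp add: left_module_def)
qed

subsection \<open>Submodules and quotients\<close>

lemma submoduleD:
  assumes "left_module R M" "submodule H R M"
  shows "H \<subseteq> carrier M" "\<zero>\<^bsub>M\<^esub> \<in> H"
    "x \<in> H \<Longrightarrow> y \<in> H \<Longrightarrow> x \<oplus>\<^bsub>M\<^esub> y \<in> H"
    "x \<in> H \<Longrightarrow> \<ominus>\<^bsub>M\<^esub> x \<in> H"
    "x \<in> H \<Longrightarrow> y \<in> H \<Longrightarrow> x \<ominus>\<^bsub>M\<^esub> y \<in> H"
    "a \<in> carrier R \<Longrightarrow> x \<in> H \<Longrightarrow> a \<odot>\<^bsub>M\<^esub> x \<in> H"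
proof -
  interpret M: left_module R M by fact
  interpret H: submodule H R M by fact
  show "H \<subseteq> carrier M" using H.subset by simp
  show "\<zero>\<^bsub>M\<^esub> \<in> H" using H.one_closed by simp
  show a: "x \<oplus>\<^bsub>M\<^esub> y \<in> H" if "x \<in> H" "y \<in> H" for x y using H.m_closed that by simp
  show n: "\<ominus>\<^bsub>M\<^esub> x \<in> H" if "x \<in> H" for x using H.m_inv_closed that by (simp add: a_inv_def)
  show "x \<in> H \<Longrightarrow> y \<in> H \<Longrightarrow> x \<ominus>\<^bsub>M\<^esub> y \<in> H" by (simp add: a_minus_def a n)
  show "a \<in> carrier R \<Longrightarrow> x \<in> H \<Longrightarrow> a \<odot>\<^bsub>M\<^esub> x \<in> H" by (rule H.smult_closed)
qed

text \<open>Closure under negation follows from \<open>-x = (-1)x\<close>.\<close>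
lemma submoduleI:
  assumes "left_module R M" "H \<subseteq> carrier M" "\<zero>\<^bsub>M\<^esub> \<in> H"
    "\<And>x y. x \<in> H \<Longrightarrow> y \<in> H \<Longrightarrow> x \<oplus>\<^bsub>M\<^esub> y \<in> H"
    "\<And>a x. a \<in> carrier R \<Longrightarrow> x \<in> H \<Longrightarrow> a \<odot>\<^bsub>M\<^esub> x \<in> H"
  shows "submodule H R M"
proof -
  interpret M: left_module R M by fact
  have neg: "\<ominus>\<^bsub>M\<^esub> x \<in> H" if "x \<in> H" for x
  proof -
    have x: "x \<in> carrier M" using that assms(2) by blast
    have "(\<ominus>\<^bsub>R\<^esub> \<one>\<^bsub>R\<^esub>) \<odot>\<^bsub>M\<^esub> x \<oplus>\<^bsub>M\<^esub> x = (\<ominus>\<^bsub>R\<^esub> \<one>\<^bsub>R\<^esub> \<oplus>\<^bsub>R\<^esub> \<one>\<^bsub>R\<^esub>) \<odot>\<^bsub>M\<^esub> x"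
      using x by (subst M.smult_l_distr) (simp_all add: M.smult_one)
    also have "\<dots> = \<zero>\<^bsub>M\<^esub>"
      using x left_module_zero_smult[OF assms(1)] by (simp add: M.R.l_neg)
    finally have "\<ominus>\<^bsub>M\<^esub> x = (\<ominus>\<^bsub>R\<^esub> \<one>\<^bsub>R\<^esub>) \<odot>\<^bsub>M\<^esub> x"
      using x by (simp add: M.minus_equality M.smult_closed)
    then show ?thesis using assms(5) that by simp
  qed
  show ?thesis
    by (intro submodule.intro subgroup.intro submodule_axioms.intro)
      (use assms neg in \<open>auto simp: a_inv_def\<close>)
qed

lemma left_module_submodule:
  assumes "left_module R M" "submodule H R M"
  shows "left_module R (M\<lparr>carrier := H\<rparr>)"
proof -
  interpret M: left_module R M by fact
  note H = submoduleD[OF assms]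
  have "abelian_group (M\<lparr>carrier := H\<rparr>)"
  proof (rule abelian_groupI)
    show "\<exists>y\<in>carrier (M\<lparr>carrier := H\<rparr>). y \<oplus>\<^bsub>M\<lparr>carrier := H\<rparr>\<^esub> x = \<zero>\<^bsub>M\<lparr>carrier := H\<rparr>\<^esub>"
      if "x \<in> carrier (M\<lparr>carrier := H\<rparr>)" for x
      using that H(1) H(4)[of x] by (intro bexI[of _ "\<ominus>\<^bsub>M\<^esub> x"]) (auto simp: M.l_neg)
  qed (use H in \<open>auto simp: M.a_ac subset_iff\<close>)
  moreover have "left_module_axioms R (M\<lparr>carrier := H\<rparr>)"
    using H by (intro left_module_axioms.intro)
      (auto simp: subset_iff M.smult_l_distr M.smult_r_distr M.smult_assoc M.smult_one)
  ultimately show ?thesis using M.R.ring_axioms by (simp add: left_module_def)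
qed

lemma submodule_carrier: "left_module R M \<Longrightarrow> submodule (carrier M) R M"
proof -
  assume L: "left_module R M"
  interpret M: left_module R M by fact
  show ?thesis by (rule submoduleI[OF L]) (auto intro: M.smult_closed)
qed

lemma submodule_zero: "left_module R M \<Longrightarrow> submodule {\<zero>\<^bsub>M\<^esub>} R M"
proof -
  assume L: "left_module R M"
  interpret M: left_module R M by fact
  show ?thesis by (rule submoduleI[OF L]) (auto simp: left_module_smult_zero[OF L])
qed

lemma submodule_of_submodule:
  assumes "left_module R M" "submodule H R M"
  shows "submodule D R (M\<lparr>carrier := H\<rparr>) \<longleftrightarrow> D \<subseteq> H \<and> submodule D R M"
proof
  assume "submodule D R (M\<lparr>carrier := H\<rparr>)"
  note D = submoduleD[OF left_module_submodule[OF assms] this, simplified]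
  have "submodule D R M"
    by (rule submoduleI[OF assms(1)]) (use D submoduleD(1)[OF assms] in auto)
  then show "D \<subseteq> H \<and> submodule D R M" using D by blast
next
  assume D: "D \<subseteq> H \<and> submodule D R M"
  note D' = submoduleD[OF assms(1) conjunct2[OF D]]
  show "submodule D R (M\<lparr>carrier := H\<rparr>)"
    by (rule submoduleI[OF left_module_submodule[OF assms]]) (use D D' in auto)
qed

lemma submodule_Int:
  assumes "left_module R M" "submodule A R M" "submodule B R M"
  shows "submodule (A \<inter> B) R M"
  by (rule submoduleI[OF assms(1)])
    (use submoduleD[OF assms(1,2)] submoduleD[OF assms(1,3)] in auto)

lemma submodule_sum:
  fixes M :: "('a, 'm) module" (structure)
  assumes "left_module R M" "submodule A R M" "submodule B R M"
  shows "submodule (A <+>\<^bsub>M\<^esub> B) R M" "A \<subseteq> A <+>\<^bsub>M\<^esub> B" "B \<subseteq> A <+>\<^bsub>M\<^esub> B"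
proof -
  interpret M: left_module R M by fact
  note A = submoduleD[OF assms(1,2)] and B = submoduleD[OF assms(1,3)]
  have AB: "A \<subseteq> carrier M" "B \<subseteq> carrier M" by fact+
  have mem: "a \<oplus> b \<in> A <+>\<^bsub>M\<^esub> B" if "a \<in> A" "b \<in> B" for a b
    unfolding set_add_def' using that by blast
  have sub: "A <+>\<^bsub>M\<^esub> B \<subseteq> carrier M" using A(1) B(1) by (auto simp: set_add_def')
  show "submodule (A <+>\<^bsub>M\<^esub> B) R M"
  proof (rule submoduleI[OF assms(1) sub])
    show "\<zero> \<in> A <+>\<^bsub>M\<^esub> B" 
      using mem[OF A(2) B(2)] by simp
    show "x \<oplus> y \<in> A <+>\<^bsub>M\<^esub> B" if xy: "x \<in> A <+>\<^bsub>M\<^esub> B" "y \<in> A <+>\<^bsub>M\<^esub> B" for x y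
    proof -
      obtain a b a' b' where ab: "a \<in> A" "b \<in> B" "a' \<in> A" "b' \<in> B" "x = a \<oplus> b" "y = a' \<oplus> b'"
        using xy by (auto simp: set_add_def')
      then have "x \<oplus> y = (a \<oplus> a') \<oplus> (b \<oplus> b')"
        using AB by (simp add: M.a_ac subset_iff)
      then show ?thesis using mem[OF A(3)[OF ab(1,3)] B(3)[OF ab(2,4)]] by simp
    qed
    show "c \<odot> x \<in> A <+>\<^bsub>M\<^esub> B" if c: "c \<in> carrier R" "x \<in> A <+>\<^bsub>M\<^esub> B" for c x
    proof -
      obtain a b where ab: "a \<in> A" "b \<in> B" "x = a \<oplus> b" using c by (auto simp: set_add_def')
      then have "c \<odot> x = (c \<odot> a) \<oplus> (c \<odot> b)"
        using AB c by (simp add: M.smult_r_distr subset_iff)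
      then show ?thesis using mem[OF A(6)[OF c(1) ab(1)] B(6)[OF c(1) ab(2)]] by simp
    qed
  qed
  show "A \<subseteq> A <+>\<^bsub>M\<^esub> B" "B \<subseteq> A <+>\<^bsub>M\<^esub> B"
    using AB mem[OF _ B(2)] mem[OF A(2)] by (auto simp: subset_iff)
qed

lemma submodule_preimage:
  assumes "left_module R M" "left_module R N" "f \<in> lmod_hom R M N" "submodule H R N"
  shows "submodule {x \<in> carrier M. f x \<in> H} R M"
proof -
  interpret M: left_module R M by fact
  note H = submoduleD[OF assms(2,4)]
  show ?thesis
    by (rule submoduleI[OF assms(1)])
      (auto simp: H lmod_hom_zero[OF assms(1-3)] lmod_hom_add[OF assms(3)] lmod_hom_smult[OF assms(3)]
        M.smult_closed)
qed

lemma submodule_kernel: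
  assumes "left_module R M" "left_module R N" "f \<in> lmod_hom R M N"
  shows "submodule {x \<in> carrier M. f x = \<zero>\<^bsub>N\<^esub>} R M"
  using submodule_preimage[OF assms submodule_zero[OF assms(2)]] by simp

lemma submodule_image:
  assumes "left_module R M" "left_module R N" "f \<in> lmod_hom R M N" "submodule H R M"
  shows "submodule (f ` H) R N"
proof -
  note H = submoduleD[OF assms(1,4)]
  have f: "f x \<in> carrier N" if "x \<in> H" for x using H(1) that lmod_hom_closed[OF assms(3)] by blast
  show ?thesis
  proof (rule submoduleI[OF assms(2)])
    show "\<zero>\<^bsub>N\<^esub> \<in> f ` H" using lmod_hom_zero[OF assms(1-3)] H(2) by (metis imageI)
    show "u \<oplus>\<^bsub>N\<^esub> v \<in> f ` H" if "u \<in> f ` H" "v \<in> f ` H" for u v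
      using that H(1,3) lmod_hom_add[OF assms(3)] by (smt (verit) image_iff subset_iff)
    show "a \<odot>\<^bsub>N\<^esub> v \<in> f ` H" if "a \<in> carrier R" "v \<in> f ` H" for a v
      using that H(1,6) lmod_hom_smult[OF assms(3)] by (smt (verit) image_iff subset_iff)
  qed (use f in auto)
qed

lemma lmod_hom_inclusion: 
  assumes "left_module R M" "submodule H R M"
  shows "id \<in> lmod_hom R (M\<lparr>carrier := H\<rparr>) M"
  using submoduleD(1)[OF assms] by (auto simp: lmod_hom_def)

lemma lmod_hom_restrict:
  assumes "left_module R M" "submodule H R M" "f \<in> lmod_hom R M N"
  shows "f \<in> lmod_hom R (M\<lparr>carrier := H\<rparr>) N"
  using submoduleD(1)[OF assms(1,2)] assms(3) by (auto simp: lmod_hom_def subset_iff)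

lemma lmod_hom_corestrict:
  assumes "f \<in> lmod_hom R M N" "\<And>x. x \<in> carrier M \<Longrightarrow> f x \<in> H"
  shows "f \<in> lmod_hom R M (N\<lparr>carrier := H\<rparr>)"
  using assms by (auto simp: lmod_hom_def)

lemma inj_on_lmod_hom_iff:
  fixes M :: "('a, 'm) module" (structure)
  assumes "left_module R M" "left_module R N" "f \<in> lmod_hom R M N"
  shows "inj_on f (carrier M) \<longleftrightarrow> (\<forall>x\<in>carrier M. f x = \<zero>\<^bsub>N\<^esub> \<longrightarrow> x = \<zero>)"
proof
  interpret M: left_module R M by fact
  interpret N: left_module R N by fact
  show "\<forall>x\<in>carrier M. f x = \<zero>\<^bsub>N\<^esub> \<longrightarrow> x = \<zero>" if "inj_on f (carrier M)"
    using that lmod_hom_zero[OF assms] M.zero_closed by (metis inj_onD)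
  assume k: "\<forall>x\<in>carrier M. f x = \<zero>\<^bsub>N\<^esub> \<longrightarrow> x = \<zero>"
  show "inj_on f (carrier M)"
  proof (rule inj_onI)
    fix x y assume xy: "x \<in> carrier M" "y \<in> carrier M" "f x = f y"
    have "f (x \<ominus> y) = \<zero>\<^bsub>N\<^esub>"
      using xy lmod_hom_minus[OF assms] lmod_hom_closed[OF assms(3)] by (simp add: N.r_neg a_minus_def)
    then have "x \<ominus> y = \<zero>" using k xy by simp
    then show "x = y" using xy by (simp add: M.minus_eq_zero_iff)
  qed
qed

text \<open>The cosets are replaced by chosen representatives, so that the quotient again has its
  underlying set in the universe \<open>'m\<close>. The last clause carries over to the quotient the
  condition that a central idempotent acts as the identity; it is phrased for any \<open>a\<close>, so
  that it applies to an idempotent given by a definite description.\<close>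
lemma quotient_module_exists:
  fixes M :: "('a, 'm) module" (structure)
  assumes "left_module R M" "submodule U R M"
  obtains C :: "('a, 'm) module" and q where
    "left_module R C" "q \<in> lmod_hom R M C" "q ` carrier M = carrier C"
    "\<forall>x\<in>carrier M. q x = \<zero>\<^bsub>C\<^esub> \<longleftrightarrow> x \<in> U"
    "\<forall>a. (\<forall>x\<in>carrier M. a \<odot> x = x) \<longrightarrow> (\<forall>x\<in>carrier C. a \<odot>\<^bsub>C\<^esub> x = x)"
proof -
  interpret M: left_module R M by fact
  note U = submoduleD[OF assms]
  have UM: "x \<in> carrier M" if "x \<in> U" for x using U(1) that by blast
  define r where "r x = (SOME y. y \<in> carrier M \<and> (\<exists>u\<in>U. y = x \<oplus> u))" for x
  have r: "r x \<in> carrier M \<and> (\<exists>u\<in>U. r x = x \<oplus> u)" if "x \<in> carrier M" for x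
    unfolding r_def by (rule someI[of _ x]) (use that U(2) in \<open>auto intro!: bexI[of _ "\<zero>"]\<close>)
  have eq: "r (x \<oplus> u) = r x" if "x \<in> carrier M" "u \<in> U" for x u
  proof -
    have "(\<exists>v\<in>U. y = (x \<oplus> u) \<oplus> v) \<longleftrightarrow> (\<exists>v\<in>U. y = x \<oplus> v)" for y
    proof
      assume "\<exists>v\<in>U. y = (x \<oplus> u) \<oplus> v"
      then obtain v where v: "v \<in> U" "y = (x \<oplus> u) \<oplus> v" by blast
      then show "\<exists>v\<in>U. y = x \<oplus> v" using that U(3) UM
        by (intro bexI[of _ "u \<oplus> v"]) (auto simp: M.a_assoc)
    next
      assume "\<exists>v\<in>U. y = x \<oplus> v"
      then obtain v where v: "v \<in> U" "y = x \<oplus> v" by blast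
      moreover have "x \<oplus> v = (x \<oplus> u) \<oplus> (\<ominus> u \<oplus> v)"
        using v that UM by (simp add: M.a_assoc M.r_neg2)
      ultimately show "\<exists>v\<in>U. y = (x \<oplus> u) \<oplus> v" using that U(3,4)
        by (intro bexI[of _ "\<ominus> u \<oplus> v"]) auto
    qed
    then show ?thesis by (simp add: r_def)
  qed
  have rcl: "r x \<in> carrier M" if "x \<in> carrier M" for x using r[OF that] by blast
  have req: "r (r x) = r x" if "x \<in> carrier M" for x using r[OF that] eq[OF that] by metis
  have radd: "r (r x \<oplus> r y) = r (x \<oplus> y)" if "x \<in> carrier M" "y \<in> carrier M" for x y
  proof -
    obtain u v where uv: "u \<in> U" "r x = x \<oplus> u" "v \<in> U" "r y = y \<oplus> v"
      using r[OF \<open>x \<in> carrier M\<close>] r[OF \<open>y \<in> carrier M\<close>] by blast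
    have "r x \<oplus> r y = (x \<oplus> y) \<oplus> (u \<oplus> v)" using uv UM that by (simp add: M.a_ac)
    then show ?thesis using eq that uv U(3) by simp
  qed
  have rsm: "r (a \<odot> r x) = r (a \<odot> x)" if "a \<in> carrier R" "x \<in> carrier M" for a x
  proof -
    obtain u where u: "u \<in> U" "r x = x \<oplus> u" using r[OF \<open>x \<in> carrier M\<close>] by blast
    then show ?thesis using that UM U(6) eq by (simp add: M.smult_r_distr M.smult_closed)
  qed
  define C :: "('a, 'm) module" where "C = \<lparr>carrier = r ` carrier M, mult = undefined,
    one = undefined, zero = r \<zero>, add = \<lambda>x y. r (x \<oplus> y), smult = \<lambda>a x. r (a \<odot> x)\<rparr>"
  show thesis
  proof (rule that)
    show "left_module R C"
      by (rule left_module_image[OF assms(1), of r]) (simp_all add: C_def radd rsm)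
    show "r \<in> lmod_hom R M C" by (rule lmod_homI) (simp_all add: C_def radd rsm)
    show "r ` carrier M = carrier C" by (simp add: C_def)
    show "\<forall>x\<in>carrier M. r x = \<zero>\<^bsub>C\<^esub> \<longleftrightarrow> x \<in> U"
    proof (intro ballI iffI)
      fix x assume x: "x \<in> carrier M"
      assume "r x = \<zero>\<^bsub>C\<^esub>"
      then have "r x = r \<zero>" by (simp add: C_def)
      moreover obtain u v where uv: "u \<in> U" "r x = x \<oplus> u" "v \<in> U" "r \<zero> = \<zero> \<oplus> v"
        using r[OF x] r[OF M.zero_closed] by blast
      ultimately have "x \<oplus> u = v" using UM by simp
      then have "x = v \<ominus> u" using x uv UM by (auto simp: a_minus_def M.a_assoc M.r_neg)
      then show "x \<in> U" using uv U(5) by simp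
    next
      fix x assume "x \<in> U"
      then show "r x = \<zero>\<^bsub>C\<^esub>" using eq[of "\<zero>" x] UM by (simp add: C_def)
    qed
    show "\<forall>a. (\<forall>x\<in>carrier M. a \<odot> x = x) \<longrightarrow> (\<forall>x\<in>carrier C. a \<odot>\<^bsub>C\<^esub> x = x)"
      by (auto simp: C_def rcl req)
  qed
qed

lemma factor_through_surjection:
  fixes N :: "('a, 'm) module" (structure)
  assumes "left_module R M" "left_module R C" "left_module R N"
    and q: "q \<in> lmod_hom R M C" "q ` carrier M = carrier C" and f: "f \<in> lmod_hom R M N"
    and ker: "\<And>x. x \<in> carrier M \<Longrightarrow> q x = \<zero>\<^bsub>C\<^esub> \<Longrightarrow> f x = \<zero>"
  obtains h where "h \<in> lmod_hom R C N" "\<forall>x\<in>carrier M. h (q x) = f x"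
proof -
  interpret M: left_module R M by fact
  interpret C: left_module R C by fact
  interpret N: left_module R N by fact
  define s where "s c = (SOME x. x \<in> carrier M \<and> q x = c)" for c
  have s: "s c \<in> carrier M \<and> q (s c) = c" if "c \<in> carrier C" for c
    unfolding s_def by (rule someI_ex) (use that in \<open>auto simp flip: q(2)\<close>)
  have h: "f (s (q x)) = f x" if x: "x \<in> carrier M" for x
  proof -
    have qx: "q x \<in> carrier C" using x lmod_hom_closed[OF q(1)] by blast
    have "q (s (q x) \<ominus>\<^bsub>M\<^esub> x) = \<zero>\<^bsub>C\<^esub>"
      using s[OF qx] x qx lmod_hom_minus[OF assms(1,2) q(1)] by (simp add: C.r_neg a_minus_def)
    then have "f (s (q x) \<ominus>\<^bsub>M\<^esub> x) = \<zero>" using ker s[OF qx] x by simp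
    then have "f (s (q x)) \<ominus> f x = \<zero>"
      using s[OF qx] x lmod_hom_minus[OF assms(1,3) f] by simp
    then show ?thesis using s[OF qx] x lmod_hom_closed[OF f]
      by (simp add: N.minus_eq_zero_iff)
  qed
  have "(\<lambda>c. f (s c)) \<in> lmod_hom R C N"
  proof (rule lmod_homI)
    show "f (s c) \<in> carrier N" if "c \<in> carrier C" for c using s[OF that] lmod_hom_closed[OF f] by blast
    show "f (s (c \<oplus>\<^bsub>C\<^esub> d)) = f (s c) \<oplus> f (s d)" if "c \<in> carrier C" "d \<in> carrier C" for c d
      using h[of "s c \<oplus>\<^bsub>M\<^esub> s d"] s that by (simp add: lmod_hom_add[OF q(1)] lmod_hom_add[OF f])
    show "f (s (a \<odot>\<^bsub>C\<^esub> c)) = a \<odot> f (s c)" if "a \<in> carrier R" "c \<in> carrier C" for a c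
      using h[of "a \<odot>\<^bsub>M\<^esub> s c"] s that
      by (simp add: lmod_hom_smult[OF q(1)] lmod_hom_smult[OF f] M.smult_closed)
  qed
  then show thesis using that h by blast
qed

lemma lift_through_injection:
  assumes "left_module R A" "left_module R M"
    and i: "i \<in> lmod_hom R A B" "inj_on i (carrier A)" and f: "f \<in> lmod_hom R M B"
    and im: "\<And>x. x \<in> carrier M \<Longrightarrow> f x \<in> i ` carrier A"
  obtains h where "h \<in> lmod_hom R M A" "\<forall>x\<in>carrier M. i (h x) = f x"
proof -
  interpret A: left_module R A by fact
  interpret M: left_module R M by fact
  define h where "h x = inv_into (carrier A) i (f x)" for x
  have h: "h x \<in> carrier A" "i (h x) = f x" if "x \<in> carrier M" for x
    using im[OF that] by (auto simp: h_def inv_into_into f_inv_into_f)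
  have uniq: "a = b" if "a \<in> carrier A" "b \<in> carrier A" "i a = i b" for a b
    using inj_onD[OF i(2)] that by blast
  have "h \<in> lmod_hom R M A"
  proof (rule lmod_homI)
    show "h (x \<oplus>\<^bsub>M\<^esub> y) = h x \<oplus>\<^bsub>A\<^esub> h y" if "x \<in> carrier M" "y \<in> carrier M" for x y
      by (rule uniq) (use that h in \<open>auto simp: lmod_hom_add[OF i(1)] lmod_hom_add[OF f]\<close>)
    show "h (a \<odot>\<^bsub>M\<^esub> x) = a \<odot>\<^bsub>A\<^esub> h x" if "a \<in> carrier R" "x \<in> carrier M" for a x
      by (rule uniq) (use that h in
        \<open>auto simp: lmod_hom_smult[OF i(1)] lmod_hom_smult[OF f] A.smult_closed M.smult_closed\<close>)
  qed (use h in auto)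
  then show thesis using that h by blast
qed

text \<open>The composite \<open>A \<rightarrow> M \<rightarrow> M/B\<close> is an isomorphism, and \<open>\<pi>\<close> is the projection to \<open>M/B\<close>
  followed by its inverse.\<close>
lemma complement_projection:
  fixes M :: "('a, 'm) module" (structure)
  assumes M: "left_module R M" and A: "submodule A R M" and B: "submodule B R M"
    and AB: "A \<inter> B = {\<zero>}" "A <+>\<^bsub>M\<^esub> B = carrier M"
  obtains \<pi> where "\<pi> \<in> lmod_hom R M M" "\<forall>x\<in>carrier M. \<pi> x \<in> A"
    "\<forall>x\<in>carrier M. x \<ominus> \<pi> x \<in> B" "\<forall>a\<in>A. \<pi> a = a" "\<forall>b\<in>B. \<pi> b = \<zero>"
proof -
  interpret M: left_module R M by fact
  note Ad = submoduleD[OF M A] and Bd = submoduleD[OF M B] and lA = left_module_submodule[OF M A]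
  obtain C :: "('a, 'm) module" and q where C: "left_module R C" and q: "q \<in> lmod_hom R M C"
    and ker: "\<forall>x\<in>carrier M. q x = \<zero>\<^bsub>C\<^esub> \<longleftrightarrow> x \<in> B"
    by (rule quotient_module_exists[OF M B])
  interpret C: left_module R C by (rule C)
  have "\<forall>a\<in>A. q a = \<zero>\<^bsub>C\<^esub> \<longrightarrow> a = \<zero>" using ker Ad(1) AB(1) by blast
  then have inj: "inj_on q (carrier (M\<lparr>carrier := A\<rparr>))"
    using inj_on_lmod_hom_iff[OF lA C lmod_hom_restrict[OF M A q]] by simp
  have im: "q x \<in> q ` carrier (M\<lparr>carrier := A\<rparr>)" if "x \<in> carrier M" for x
  proof -
    have "x \<in> A <+>\<^bsub>M\<^esub> B" using that AB(2) by simp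
    then obtain a b where ab: "a \<in> A" "b \<in> B" "x = a \<oplus> b" unfolding set_add_def' by blast
    then have cl: "a \<in> carrier M" "b \<in> carrier M" using Ad(1) Bd(1) by auto
    then have "q x = q a" using ab(2) ker by (simp add: ab(3) lmod_hom_add[OF q] lmod_hom_closed[OF q])
    then show ?thesis using ab(1) by simp
  qed
  obtain \<pi> where \<pi>: "\<pi> \<in> lmod_hom R M (M\<lparr>carrier := A\<rparr>)" "\<forall>x\<in>carrier M. q (\<pi> x) = q x"
    by (rule lift_through_injection[OF lA M lmod_hom_restrict[OF M A q] inj q im])
  have pA: "\<pi> x \<in> A" if "x \<in> carrier M" for x using lmod_hom_closed[OF \<pi>(1) that] by simp
  have pM: "\<pi> x \<in> carrier M" if "x \<in> carrier M" for x using pA[OF that] Ad(1) by blast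
  have eq: "\<pi> x = a" if "x \<in> carrier M" "a \<in> A" "q x = q a" for x a
    using inj_onD[OF inj, of "\<pi> x" a] \<pi>(2) pA that by simp
  show thesis
  proof (rule that)
    show "\<pi> \<in> lmod_hom R M M" using lmod_hom_comp[OF lmod_hom_inclusion[OF M A] \<pi>(1)] by simp
    show "\<forall>x\<in>carrier M. x \<ominus> \<pi> x \<in> B"
    proof
      fix x assume x: "x \<in> carrier M"
      then have "q (x \<ominus> \<pi> x) = \<zero>\<^bsub>C\<^esub>"
        using \<pi>(2) pM by (simp add: lmod_hom_minus[OF M C q] C.minus_eq_zero_iff lmod_hom_closed[OF q])
      then show "x \<ominus> \<pi> x \<in> B" using ker x pM by simp
    qed
    show "\<forall>a\<in>A. \<pi> a = a" using eq Ad(1) by blast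
    show "\<forall>b\<in>B. \<pi> b = \<zero>"
      using eq[OF _ Ad(2)] ker Bd(1) lmod_hom_zero[OF M C q] by (auto simp: subset_iff)
  qed (use pA in blast)
qed

section \<open>Stably zero maps in a Frobenius universe\<close>

lemma projective_left_module: "projective_module R P \<Longrightarrow> left_module R P"
  by (simp add: projective_module_def)

lemma projective_lift:
  fixes P :: "('a, 'm) module" and M :: "('a, 'm) module" and N :: "('a, 'm) module"
  assumes "projective_module R P" "left_module R M" "left_module R N"
    "q \<in> lmod_hom R M N" "q ` carrier M = carrier N" "f \<in> lmod_hom R P N"
  obtains h where "h \<in> lmod_hom R P M" "\<forall>x\<in>carrier P. q (h x) = f x"
  using assms unfolding projective_module_def by meson

lemma stably_zeroI:
  fixes P M N :: "('a, 'm) module"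
  assumes "projective_module R P" "u \<in> lmod_hom R M P" "v \<in> lmod_hom R P N"
    "\<And>x. x \<in> carrier M \<Longrightarrow> f x = v (u x)"
  shows "stably_zero R M N f"
  using assms unfolding factors_through_projective_def by blast

lemma stably_zeroE:
  fixes M :: "('a, 'm) module"
  assumes "stably_zero R M N f"
  obtains P :: "('a, 'm) module" and u v where "projective_module R P" "u \<in> lmod_hom R M P"
    "v \<in> lmod_hom R P N" "\<forall>x\<in>carrier M. f x = v (u x)"
  using assms unfolding factors_through_projective_def by blast

lemma stably_zero_cong:
  "stably_zero R M N f \<Longrightarrow> (\<And>x. x \<in> carrier M \<Longrightarrow> g x = f x) \<Longrightarrow> stably_zero R M N g"
  unfolding factors_through_projective_def by simp

lemma stably_zero_comp:
  fixes M N L :: "('a, 'm) module"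
  assumes "stably_zero R M N f" "g \<in> lmod_hom R N L"
  shows "stably_zero R M L (g \<circ> f)"
proof -
  obtain P :: "('a, 'm) module" and u v where P: "projective_module R P" "u \<in> lmod_hom R M P" "v \<in> lmod_hom R P N"
    "\<forall>x\<in>carrier M. f x = v (u x)" by (rule stably_zeroE[OF assms(1)])
  show ?thesis
    by (rule stably_zeroI[OF P(1,2) lmod_hom_comp[OF assms(2) P(3)]]) (simp add: P(4))
qed

lemma stably_zero_precomp:
  fixes M N L :: "('a, 'm) module"
  assumes "stably_zero R M N f" "g \<in> lmod_hom R L M"
  shows "stably_zero R L N (f \<circ> g)"
proof -
  obtain P :: "('a, 'm) module" and u v where P: "projective_module R P" "u \<in> lmod_hom R M P" "v \<in> lmod_hom R P N"
    "\<forall>x\<in>carrier M. f x = v (u x)" by (rule stably_zeroE[OF assms(1)])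
  show ?thesis
    by (rule stably_zeroI[OF P(1) lmod_hom_comp[OF P(2) assms(2)] P(3)])
      (simp add: P(4) lmod_hom_closed[OF assms(2)])
qed

lemma stably_zero_lift:
  fixes X B C :: "('a, 'm) module"
  assumes "stably_zero R X C f" "left_module R B" "left_module R C"
    "q \<in> lmod_hom R B C" "q ` carrier B = carrier C"
  obtains w where "w \<in> lmod_hom R X B" "\<forall>x\<in>carrier X. q (w x) = f x"
proof -
  obtain P :: "('a, 'm) module" and u v where P: "projective_module R P" "u \<in> lmod_hom R X P" "v \<in> lmod_hom R P C"
    "\<forall>x\<in>carrier X. f x = v (u x)" by (rule stably_zeroE[OF assms(1)])
  obtain h where h: "h \<in> lmod_hom R P B" "\<forall>x\<in>carrier P. q (h x) = v x"
    by (rule projective_lift[OF P(1) assms(2-5) P(3)])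
  show thesis
    by (rule that[of "h \<circ> u"]) (simp_all add: lmod_hom_comp[OF h(1) P(2)] h(2) P(4) lmod_hom_closed[OF P(2)])
qed

lemma short_exactD:
  assumes "short_exact R A i B q C"
  shows "left_module R A" "left_module R B" "left_module R C" "i \<in> lmod_hom R A B"
    "q \<in> lmod_hom R B C" "inj_on i (carrier A)" "q ` carrier B = carrier C"
    "x \<in> carrier A \<Longrightarrow> q (i x) = \<zero>\<^bsub>C\<^esub>"
    "b \<in> carrier B \<Longrightarrow> q b = \<zero>\<^bsub>C\<^esub> \<Longrightarrow> b \<in> i ` carrier A"
  using assms unfolding short_exact_def by blast+

lemma short_exactI:
  assumes "left_module R A" "left_module R B" "left_module R C" "i \<in> lmod_hom R A B"
    "q \<in> lmod_hom R B C" "inj_on i (carrier A)" "q ` carrier B = carrier C"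
    "\<And>b. b \<in> carrier B \<Longrightarrow> q b = \<zero>\<^bsub>C\<^esub> \<longleftrightarrow> b \<in> i ` carrier A"
  shows "short_exact R A i B q C"
  using assms lmod_hom_closed[OF assms(4)] unfolding short_exact_def by blast

lemma short_exact_quotient:
  fixes M :: "('a, 'm) module"
  assumes "left_module R A" "left_module R M" "i \<in> lmod_hom R A M" "inj_on i (carrier A)"
  obtains C :: "('a, 'm) module" and q where "short_exact R A i M q C"
    "\<forall>a. (\<forall>x\<in>carrier M. a \<odot>\<^bsub>M\<^esub> x = x) \<longrightarrow> (\<forall>x\<in>carrier C. a \<odot>\<^bsub>C\<^esub> x = x)"
proof -
  have "submodule (i ` carrier A) R M"
    by (rule submodule_image[OF assms(1-3) submodule_carrier[OF assms(1)]])
  then obtain C :: "('a, 'm) module" and q where C: "left_module R C" "q \<in> lmod_hom R M C"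
    "q ` carrier M = carrier C" "\<forall>x\<in>carrier M. q x = \<zero>\<^bsub>C\<^esub> \<longleftrightarrow> x \<in> i ` carrier A"
    "\<forall>a. (\<forall>x\<in>carrier M. a \<odot>\<^bsub>M\<^esub> x = x) \<longrightarrow> (\<forall>x\<in>carrier C. a \<odot>\<^bsub>C\<^esub> x = x)"
    by (rule quotient_module_exists[OF assms(2)])
  show thesis
    by (rule that[of q C]) (use C assms in \<open>auto intro!: short_exactI\<close>)
qed

lemma short_exact_kernel:
  assumes "left_module R B" "left_module R C" "q \<in> lmod_hom R B C" "q ` carrier B = carrier C"
  shows "short_exact R (B\<lparr>carrier := {x \<in> carrier B. q x = \<zero>\<^bsub>C\<^esub>}\<rparr>) id B q C"
  using submodule_kernel[OF assms(1-3)] assms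
  by (intro short_exactI left_module_submodule lmod_hom_inclusion) auto

text \<open>The exact category of modules with underlying set in \<open>'m\<close> is a Frobenius category: it
  has enough projectives, the projectives are injective, and every module embeds in one.
  These properties alone give the calculus of stably zero maps, syzygies and ghosts below.
  The parameter \<open>U\<close> only names the type \<open>'m\<close>.\<close>
locale frobenius_universe =
  fixes R :: "('a, 'r) ring_scheme" and U :: "'m itself"
  assumes projective_embedding: "left_module R (X :: ('a, 'm) module) \<Longrightarrow>
      \<exists>(P :: ('a, 'm) module) u. projective_module R P \<and> u \<in> lmod_hom R X P \<and> inj_on u (carrier X)"
    and projective_quotient: "left_module R (X :: ('a, 'm) module) \<Longrightarrow>
      \<exists>(P :: ('a, 'm) module) q. projective_module R P \<and> q \<in> lmod_hom R P X \<and> q ` carrier P = carrier X"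
    and projective_extend: "projective_module R (P :: ('a, 'm) module) \<Longrightarrow>
      left_module R (A :: ('a, 'm) module) \<Longrightarrow> left_module R (B :: ('a, 'm) module) \<Longrightarrow>
      i \<in> lmod_hom R A B \<Longrightarrow> inj_on i (carrier A) \<Longrightarrow> u \<in> lmod_hom R A P \<Longrightarrow>
      \<exists>e \<in> lmod_hom R B P. \<forall>x\<in>carrier A. e (i x) = u x"
begin

lemma stably_zero_extend:
  fixes A B Y :: "('a, 'm) module"
  assumes "stably_zero R A Y f" "left_module R A" "left_module R B"
    "i \<in> lmod_hom R A B" "inj_on i (carrier A)"
  obtains e where "e \<in> lmod_hom R B Y" "stably_zero R B Y e" "\<forall>x\<in>carrier A. e (i x) = f x"
proof -
  obtain P :: "('a, 'm) module" and u v where P: "projective_module R P" "u \<in> lmod_hom R A P" "v \<in> lmod_hom R P Y"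
    "\<forall>x\<in>carrier A. f x = v (u x)" by (rule stably_zeroE[OF assms(1)])
  obtain e where e: "e \<in> lmod_hom R B P" "\<forall>x\<in>carrier A. e (i x) = u x"
    using projective_extend[OF P(1) assms(2-5) P(2)] by blast
  show thesis
    by (rule that[of "v \<circ> e"])
      (simp_all add: lmod_hom_comp[OF P(3) e(1)] e(2) P(4) stably_zeroI[OF P(1) e(1) P(3)])
qed

lemma stably_zero_through_embedding:
  fixes X Y :: "('a, 'm) module"
  assumes "left_module R X" "stably_zero R X Y f"
    "projective_module R (I :: ('a, 'm) module)" "u \<in> lmod_hom R X I" "inj_on u (carrier X)"
  obtains e where "e \<in> lmod_hom R I Y" "\<forall>x\<in>carrier X. f x = e (u x)"
proof -
  obtain e where e: "e \<in> lmod_hom R I Y" "\<forall>x\<in>carrier X. e (u x) = f x"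
    by (rule stably_zero_extend[OF assms(2,1) projective_left_module[OF assms(3)] assms(4,5)])
  show thesis by (rule that[OF e(1)]) (simp add: e(2))
qed

text \<open>Two stably zero maps out of \<open>X\<close> factor through the same embedding of \<open>X\<close> into a
  projective, hence so does their difference.\<close>

lemma stably_zero_diff:
  fixes X Y :: "('a, 'm) module"
  assumes "left_module R X" "left_module R Y" "stably_zero R X Y f" "stably_zero R X Y g"
  shows "stably_zero R X Y (\<lambda>x. f x \<ominus>\<^bsub>Y\<^esub> g x)"
proof -
  obtain I :: "('a, 'm) module" and u where I: "projective_module R I" "u \<in> lmod_hom R X I" "inj_on u (carrier X)"
    using projective_embedding[OF assms(1)] by blast
  obtain e e' where "e \<in> lmod_hom R I Y" "\<forall>x\<in>carrier X. f x = e (u x)"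
    "e' \<in> lmod_hom R I Y" "\<forall>x\<in>carrier X. g x = e' (u x)"
    using stably_zero_through_embedding[OF assms(1) _ I] assms(3,4) by metis
  then show ?thesis
    by (intro stably_zeroI[OF I(1,2) lmod_hom_diff[OF assms(2)]]) auto
qed

lemma stably_zero_null:
  fixes X Y :: "('a, 'm) module"
  assumes "left_module R X" "left_module R Y" "\<And>x. x \<in> carrier X \<Longrightarrow> f x = \<zero>\<^bsub>Y\<^esub>"
  shows "stably_zero R X Y f"
proof -
  obtain I :: "('a, 'm) module" and u where I: "projective_module R I" "u \<in> lmod_hom R X I"
    using projective_embedding[OF assms(1)] by blast
  show ?thesis by (rule stably_zeroI[OF I lmod_hom_null[OF assms(2)]]) (simp add: assms(3))
qed

lemma stably_zero_plus:
  fixes X Y :: "('a, 'm) module"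
  assumes "left_module R X" "left_module R Y" "stably_zero R X Y f" "stably_zero R X Y g"
    and g: "\<And>x. x \<in> carrier X \<Longrightarrow> f x \<in> carrier Y" "\<And>x. x \<in> carrier X \<Longrightarrow> g x \<in> carrier Y"
  shows "stably_zero R X Y (\<lambda>x. f x \<oplus>\<^bsub>Y\<^esub> g x)"
proof -
  interpret Y: left_module R Y by fact
  have "stably_zero R X Y (\<lambda>x. \<zero>\<^bsub>Y\<^esub> \<ominus>\<^bsub>Y\<^esub> g x)"
    by (rule stably_zero_diff[OF assms(1,2) stably_zero_null[OF assms(1,2)] assms(4)]) simp
  then have "stably_zero R X Y (\<lambda>x. f x \<ominus>\<^bsub>Y\<^esub> (\<zero>\<^bsub>Y\<^esub> \<ominus>\<^bsub>Y\<^esub> g x))"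
    by (rule stably_zero_diff[OF assms(1-3)])
  then show ?thesis by (rule stably_zero_cong) (simp add: g a_minus_def)
qed

subsection \<open>Syzygies and ladders\<close>

definition projective_sequence where
  "projective_sequence N i P q M \<longleftrightarrow> projective_module R (P :: ('a, 'm) module) \<and> short_exact R N i P q M"

text \<open>A morphism of short exact sequences with projective middle terms: \<open>f\<close> is then a model
  of \<open>\<Omega> g\<close>. Ladders stand in for the functor \<open>\<Omega>\<close>, so that no models of syzygies have to be
  chosen functorially.\<close>
definition ladder where
  "ladder N i P q M N' i' P' q' M' f g \<longleftrightarrow>
    projective_sequence N i P q M \<and> projective_sequence N' i' P' q' M' \<and>
    f \<in> lmod_hom R N N' \<and> g \<in> lmod_hom R M M' \<and>
    (\<exists>F \<in> lmod_hom R P P'. (\<forall>x\<in>carrier N. F (i x) = i' (f x)) \<and> (\<forall>x\<in>carrier P. q' (F x) = g (q x)))"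

text \<open>The cokernel term is a model of \<open>\<Omega>\<^sup>-\<^sup>1 X\<close>.\<close>
lemma projective_sequence_from:
  assumes "left_module R (X :: ('a, 'm) module)"
  obtains i P q M where "projective_sequence X i P q M"
proof -
  obtain I :: "('a, 'm) module" and u where I: "projective_module R I" "u \<in> lmod_hom R X I" "inj_on u (carrier X)"
    using projective_embedding[OF assms(1)] by blast
  obtain C :: "('a, 'm) module" and q where "short_exact R X u I q C"
    by (rule short_exact_quotient[OF assms projective_left_module[OF I(1)] I(2,3)])
  then show thesis using I(1) that unfolding projective_sequence_def by blast
qed

lemma projective_sequence_to:
  assumes "left_module R (X :: ('a, 'm) module)"
  obtains i P q N where "projective_sequence N i P q X"
proof -
  obtain P :: "('a, 'm) module" and q where P: "projective_module R P" "q \<in> lmod_hom R P X" "q ` carrier P = carrier X"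
    using projective_quotient[OF assms(1)] by blast
  show thesis
    using short_exact_kernel[OF projective_left_module[OF P(1)] assms P(2,3)] P(1) that
    unfolding projective_sequence_def by blast
qed

lemma ladder_extend:
  assumes "projective_sequence N i P q M" "projective_sequence N' i' P' q' M'" "f \<in> lmod_hom R N N'"
  obtains g where "ladder N i P q M N' i' P' q' M' f g"
proof -
  have P: "projective_module R P" "projective_module R P'"
    using assms unfolding projective_sequence_def by blast+
  have e: "short_exact R N i P q M" "short_exact R N' i' P' q' M'"
    using assms unfolding projective_sequence_def by blast+
  note E = short_exactD[OF e(1)] and E' = short_exactD[OF e(2)]
  obtain F where F: "F \<in> lmod_hom R P P'" "\<forall>x\<in>carrier N. F (i x) = (i' \<circ> f) x"
    using projective_extend[OF P(2) E(1,2,4,6) lmod_hom_comp[OF E'(4) assms(3)]] by blast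
  obtain g where g: "g \<in> lmod_hom R M M'" "\<forall>x\<in>carrier P. g (q x) = (q' \<circ> F) x"
  proof (rule factor_through_surjection[OF E(2,3) E'(3) E(5,7) lmod_hom_comp[OF E'(5) F(1)]])
    fix x assume "x \<in> carrier P" "q x = \<zero>\<^bsub>M\<^esub>"
    then obtain n where "n \<in> carrier N" "x = i n" using E(9) by blast
    then show "(q' \<circ> F) x = \<zero>\<^bsub>M'\<^esub>" using F(2) E'(8) lmod_hom_closed[OF assms(3)] by simp
  qed
  show thesis
    by (rule that) (use assms F g in \<open>auto simp: ladder_def intro!: bexI[of _ F]\<close>)
qed

lemma ladder_lift:
  assumes "projective_sequence N i P q M" "projective_sequence N' i' P' q' M'" "g \<in> lmod_hom R M M'"
  obtains f where "ladder N i P q M N' i' P' q' M' f g"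
proof -
  have P: "projective_module R P" "projective_module R P'"
    using assms unfolding projective_sequence_def by blast+
  have e: "short_exact R N i P q M" "short_exact R N' i' P' q' M'"
    using assms unfolding projective_sequence_def by blast+
  note E = short_exactD[OF e(1)] and E' = short_exactD[OF e(2)]
  obtain F where F: "F \<in> lmod_hom R P P'" "\<forall>x\<in>carrier P. q' (F x) = (g \<circ> q) x"
    by (rule projective_lift[OF P(1) E'(2,3,5,7) lmod_hom_comp[OF assms(3) E(5)]])
  obtain f where f: "f \<in> lmod_hom R N N'" "\<forall>x\<in>carrier N. i' (f x) = (F \<circ> i) x"
  proof (rule lift_through_injection[OF E'(1) E(1) E'(4,6) lmod_hom_comp[OF F(1) E(4)]])
    fix x assume x: "x \<in> carrier N"
    then have ix: "i x \<in> carrier P" using lmod_hom_closed[OF E(4)] by blast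
    have "q' (F (i x)) = \<zero>\<^bsub>M'\<^esub>"
      using bspec[OF F(2) ix] E(8)[OF x] lmod_hom_zero[OF E(3) E'(3) assms(3)] by simp
    then show "(F \<circ> i) x \<in> i' ` carrier N'"
      using E'(9) lmod_hom_closed[OF F(1) ix] by simp
  qed
  show thesis
    by (rule that) (use assms F f in \<open>auto simp: ladder_def intro!: bexI[of _ F]\<close>)
qed

lemma ladder_comp:
  assumes "ladder N i P q M N' i' P' q' M' f g" "ladder N' i' P' q' M' N'' i'' P'' q'' M'' f' g'"
  shows "ladder N i P q M N'' i'' P'' q'' M'' (f' \<circ> f) (g' \<circ> g)"
proof -
  obtain F F' where F: "F \<in> lmod_hom R P P'" "\<forall>x\<in>carrier N. F (i x) = i' (f x)"
      "\<forall>x\<in>carrier P. q' (F x) = g (q x)"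
    and F': "F' \<in> lmod_hom R P' P''" "\<forall>x\<in>carrier N'. F' (i' x) = i'' (f' x)"
      "\<forall>x\<in>carrier P'. q'' (F' x) = g' (q' x)"
    using assms unfolding ladder_def by blast
  have "f \<in> lmod_hom R N N'" using assms unfolding ladder_def by blast
  then have "\<forall>x\<in>carrier N. (F' \<circ> F) (i x) = i'' ((f' \<circ> f) x)"
    using F(2) F'(2) by (simp add: lmod_hom_closed)
  moreover have "\<forall>x\<in>carrier P. q'' ((F' \<circ> F) x) = (g' \<circ> g) (q x)"
    using F F'(3) by (simp add: lmod_hom_closed[OF F(1)])
  moreover have "f' \<circ> f \<in> lmod_hom R N N''" "g' \<circ> g \<in> lmod_hom R M M''"
    using assms unfolding ladder_def by (blast intro: lmod_hom_comp)+
  ultimately show ?thesis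
    using assms lmod_hom_comp[OF F'(1) F(1)] unfolding ladder_def
    by (intro conjI bexI[of _ "F' \<circ> F"]) (simp_all add: lmod_hom_comp)
qed

text \<open>If one of the outer maps factors through a projective, extend it over (respectively lift it
  to) the middle term and correct \<open>F\<close> by the result; the corrected map kills the opposite end,
  so it exhibits the other outer map as factoring through \<open>P'\<close> (respectively \<open>P\<close>).\<close>

lemma ladder_stably_zero_iff:
  assumes "ladder N i P q M N' i' P' q' M' f g"
  shows "stably_zero R N N' f \<longleftrightarrow> stably_zero R M M' g"
proof -
  have P: "projective_module R P" "projective_module R P'"
    using assms unfolding ladder_def projective_sequence_def by blast+
  have e: "short_exact R N i P q M" "short_exact R N' i' P' q' M'"
    using assms unfolding ladder_def projective_sequence_def by blast+
  note E = short_exactD[OF e(1)] and E' = short_exactD[OF e(2)]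
  obtain F where F: "F \<in> lmod_hom R P P'" "\<forall>x\<in>carrier N. F (i x) = i' (f x)"
      "\<forall>x\<in>carrier P. q' (F x) = g (q x)"
    using assms unfolding ladder_def by blast
  have fg: "f \<in> lmod_hom R N N'" "g \<in> lmod_hom R M M'" using assms unfolding ladder_def by blast+
  interpret P': left_module R P' by (rule E'(2))
  interpret M': left_module R M' by (rule E'(3))
  note cl = lmod_hom_closed[OF E(4)] lmod_hom_closed[OF E(5)] lmod_hom_closed[OF E'(4)]
    lmod_hom_closed[OF E'(5)] lmod_hom_closed[OF F(1)] lmod_hom_closed[OF fg(1)] lmod_hom_closed[OF fg(2)]
  show ?thesis
  proof
    assume "stably_zero R N N' f"
    then obtain e where e: "e \<in> lmod_hom R P N'" "\<forall>x\<in>carrier N. e (i x) = f x"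
      by (rule stably_zero_extend[OF _ E(1,2,4,6)])
    have d: "(\<lambda>x. F x \<ominus>\<^bsub>P'\<^esub> (i' \<circ> e) x) \<in> lmod_hom R P P'"
      by (rule lmod_hom_diff[OF E'(2) F(1) lmod_hom_comp[OF E'(4) e(1)]])
    obtain w where w: "w \<in> lmod_hom R M P'" "\<forall>x\<in>carrier P. w (q x) = F x \<ominus>\<^bsub>P'\<^esub> (i' \<circ> e) x"
    proof (rule factor_through_surjection[OF E(2,3) E'(2) E(5,7) d])
      fix x assume "x \<in> carrier P" "q x = \<zero>\<^bsub>M\<^esub>"
      then obtain n where n: "n \<in> carrier N" "x = i n" using E(9) by blast
      then show "F x \<ominus>\<^bsub>P'\<^esub> (i' \<circ> e) x = \<zero>\<^bsub>P'\<^esub>"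
        using F(2) e(2) cl by (simp add: P'.minus_eq_zero_iff)
    qed
    show "stably_zero R M M' g"
    proof (rule stably_zeroI[OF P(2) w(1) E'(5)])
      fix y assume "y \<in> carrier M"
      then have "y \<in> q ` carrier P" using E(7) by simp
      then obtain x where x: "x \<in> carrier P" "y = q x" by blast
      have ex: "e x \<in> carrier N'" using lmod_hom_closed[OF e(1) x(1)] .
      have "q' (w y) = q' (F x) \<ominus>\<^bsub>M'\<^esub> q' (i' (e x))"
        using bspec[OF w(2) x(1)] x cl ex by (simp add: lmod_hom_minus[OF E'(2,3,5)])
      also have "\<dots> = g y" using F(3) x E'(8)[OF ex] cl by (simp add: a_minus_def)
      finally show "g y = q' (w y)" ..
    qed
  next
    assume "stably_zero R M M' g"
    then obtain w where w: "w \<in> lmod_hom R M P'" "\<forall>x\<in>carrier M. q' (w x) = g x"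
      by (rule stably_zero_lift[OF _ E'(2,3,5,7)])
    have d: "(\<lambda>x. F x \<ominus>\<^bsub>P'\<^esub> (w \<circ> q) x) \<in> lmod_hom R P P'"
      by (rule lmod_hom_diff[OF E'(2) F(1) lmod_hom_comp[OF w(1) E(5)]])
    obtain e where e: "e \<in> lmod_hom R P N'" "\<forall>x\<in>carrier P. i' (e x) = F x \<ominus>\<^bsub>P'\<^esub> (w \<circ> q) x"
    proof (rule lift_through_injection[OF E'(1) E(2) E'(4,6) d])
      fix x assume x: "x \<in> carrier P"
      have wx: "w (q x) \<in> carrier P'" using lmod_hom_closed[OF w(1)] cl(2)[OF x] .
      have "q' (F x \<ominus>\<^bsub>P'\<^esub> (w \<circ> q) x) = \<zero>\<^bsub>M'\<^esub>"
        using x cl wx F(3) bspec[OF w(2) cl(2)[OF x]]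
        by (simp add: lmod_hom_minus[OF E'(2,3,5)] M'.minus_eq_zero_iff)
      then show "F x \<ominus>\<^bsub>P'\<^esub> (w \<circ> q) x \<in> i' ` carrier N'" using E'(9) x cl wx by simp
    qed
    show "stably_zero R N N' f"
    proof (rule stably_zeroI[OF P(1) E(4) e(1)])
      fix x assume x: "x \<in> carrier N"
      have "i' (e (i x)) = F (i x) \<ominus>\<^bsub>P'\<^esub> \<zero>\<^bsub>P'\<^esub>"
        using e(2) cl x E(8) lmod_hom_zero[OF E(3) E'(2) w(1)] by simp
      also have "\<dots> = i' (f x)" using F(2) x cl by (simp add: a_minus_def)
      finally show "f x = e (i x)"
        using inj_onD[OF E'(6)] lmod_hom_closed[OF e(1)] cl x by metis
    qed
  qed
qed

section \<open>Ghosts and ghost length\<close>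

text \<open>All models of all \<open>\<Omega>\<^sup>i T\<close> with \<open>T\<close> in \<open>\<T>\<close>. With \<open>\<T>\<close> the copies of the trivial module,
  the ghosts relative to \<open>\<T>\<close> are the ghosts.\<close>
definition test_modules :: "('a, 'm) module set \<Rightarrow> ('a, 'm) module set" where
  "test_modules \<T> = {W. \<exists>T\<in>\<T>. \<exists>i. is_Omega R i T W}"

definition relative_ghost :: "('a, 'm) module set \<Rightarrow> ('a, 'm) module \<Rightarrow> ('a, 'm) module \<Rightarrow> ('m \<Rightarrow> 'm) \<Rightarrow> bool"
  where "relative_ghost \<T> X Y f \<longleftrightarrow> f \<in> lmod_hom R X Y \<and>
    (\<forall>W\<in>test_modules \<T>. \<forall>g\<in>lmod_hom R W X. stably_zero R W Y (f \<circ> g))"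

lemma syzygy_iff: "syzygy R M N \<longleftrightarrow> (\<exists>i P q. projective_sequence N i P q M)"
  by (auto simp: syzygy_def projective_sequence_def)

lemma syzygy_left_module:
  assumes "syzygy R M N" shows "left_module R M" "left_module R N"
  using assms unfolding syzygy_def by (auto dest: short_exactD(1,3))

text \<open>For \<open>i \<ge> 1\<close> the module \<open>W\<close> is by definition a syzygy of a model of \<open>\<Omega>\<^sup>i\<^sup>-\<^sup>1 T\<close>; for \<open>i
  \<le> 0\<close> such a \<open>V\<close> is the cokernel of an embedding of \<open>W\<close> into a projective. The shift in the
  other direction is dual.\<close>
lemma is_Omega_shift:
  fixes T W :: "('a, 'm) module"
  assumes "left_module R T" "is_Omega R i T W"
  shows "left_module R W" "\<exists>V. is_Omega R (i - 1) T V \<and> syzygy R V W"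
    "\<exists>V. is_Omega R (i + 1) T V \<and> syzygy R W V"
proof -
  have lm: "left_module R Y \<longleftrightarrow> left_module R X" if "(syzygy R ^^ n) X Y" for n X Y
    using that by (induction n arbitrary: Y) (auto dest: syzygy_left_module)
  show W: "left_module R W" 
    using assms lm unfolding is_Omega_def by (auto split: if_splits)
  show "\<exists>V. is_Omega R (i - 1) T V \<and> syzygy R V W"
  proof (cases "i \<ge> 1")
    case True
    then have n: "nat i = Suc (nat (i - 1))" by simp
    have "(syzygy R ^^ nat i) T W" using assms(2) True by (simp add: is_Omega_def)
    then have "((syzygy R ^^ nat (i - 1)) OO syzygy R) T W" unfolding n by simp
    then obtain V where "(syzygy R ^^ nat (i - 1)) T V" "syzygy R V W" by blast
    then show ?thesis using True by (auto simp: is_Omega_def)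
  next
    case False
    obtain V where V: "syzygy R V W" using projective_sequence_from[OF W] unfolding syzygy_iff by metis
    have n: "nat (1 - i) = Suc (nat (- i))" using False by simp
    have "(syzygy R ^^ nat (- i)) W T" using assms(2) False by (cases "i = 0") (auto simp: is_Omega_def)
    then have "(syzygy R ^^ Suc (nat (- i))) V T" using V by (meson relpowp_Suc_I2)
    then have "is_Omega R (i - 1) T V" using False n by (simp add: is_Omega_def)
    then show ?thesis using V by blast
  qed
  show "\<exists>V. is_Omega R (i + 1) T V \<and> syzygy R W V"
  proof (cases "i \<ge> 0")
    case True
    obtain V where V: "syzygy R W V" using projective_sequence_to[OF W] unfolding syzygy_iff by metis
    have n: "nat (i + 1) = Suc (nat i)" using True by simp
    have "(syzygy R ^^ Suc (nat i)) T V"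
      using assms(2) True V by (auto simp: is_Omega_def)
    then have "is_Omega R (i + 1) T V" using True n by (simp add: is_Omega_def)
    then show ?thesis using V by blast
  next
    case False
    then have n: "nat (- i) = Suc (nat (- (i + 1)))" by simp
    have "(syzygy R ^^ nat (- i)) W T" using assms(2) False by (simp add: is_Omega_def)
    then obtain V where V: "syzygy R W V" "(syzygy R ^^ nat (- (i + 1))) V T"
      unfolding n by (meson relpowp_Suc_E2)
    then have "is_Omega R (i + 1) T V" using False by (cases "i = -1") (auto simp: is_Omega_def)
    then show ?thesis using V by blast
  qed
qed

end

locale ghost_setting = frobenius_universe R U
  for R :: "('a, 'r) ring_scheme" and U :: "'m itself" +
  fixes \<T> :: "('a, 'm) module set"
  assumes test_left_module: "T \<in> \<T> \<Longrightarrow> left_module R T"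
begin

abbreviation "ghostly \<equiv> relative_ghost \<T>"

lemma test_moduleD:
  assumes "W \<in> test_modules \<T>"
  shows "left_module R W" "\<exists>V\<in>test_modules \<T>. syzygy R V W" "\<exists>V\<in>test_modules \<T>. syzygy R W V"
  using assms is_Omega_shift test_left_module unfolding test_modules_def by blast+

lemma ghostly_hom: "ghostly X Y f \<Longrightarrow> f \<in> lmod_hom R X Y"
  by (simp add: relative_ghost_def)

text \<open>A test module \<open>W\<close> and a map from it can be shifted along a ladder in either direction,
  and the shifted module is again a test module. Hence ghosts are stable under \<open>\<Omega>\<close> and
  \<open>\<Omega>\<^sup>-\<^sup>1\<close>.\<close>
lemma ladder_ghost_iff:
  assumes "ladder N i P q M N' i' P' q' M' f g"
  shows "ghostly N N' f \<longleftrightarrow> ghostly M M' g"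
proof -
  have ps: "projective_sequence N i P q M" and fg: "f \<in> lmod_hom R N N'" "g \<in> lmod_hom R M M'"
    using assms unfolding ladder_def by blast+
  show ?thesis
  proof
    assume gh: "ghostly N N' f"
    show "ghostly M M' g"
      unfolding relative_ghost_def
    proof (intro conjI ballI fg)
      fix W h assume W: "W \<in> test_modules \<T>" and h: "h \<in> lmod_hom R W M"
      obtain V j Q s where V: "V \<in> test_modules \<T>" "projective_sequence V j Q s W"
        using test_moduleD(3)[OF W] unfolding syzygy_iff by blast
      obtain h' where h': "ladder V j Q s W N i P q M h' h" by (rule ladder_lift[OF V(2) ps h])
      have "stably_zero R V N' (f \<circ> h')"
        using gh V(1) h' unfolding relative_ghost_def ladder_def by blast
      then show "stably_zero R W M' (g \<circ> h)"
        using ladder_stably_zero_iff[OF ladder_comp[OF h' assms]] by simp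
    qed
  next
    assume gh: "ghostly M M' g"
    show "ghostly N N' f"
      unfolding relative_ghost_def
    proof (intro conjI ballI fg)
      fix W h assume W: "W \<in> test_modules \<T>" and h: "h \<in> lmod_hom R W N"
      obtain V j Q s where V: "V \<in> test_modules \<T>" "projective_sequence W j Q s V"
        using test_moduleD(2)[OF W] unfolding syzygy_iff by blast
      obtain h' where h': "ladder W j Q s V N i P q M h h'" by (rule ladder_extend[OF V(2) ps h])
      have "stably_zero R V M' (g \<circ> h')"
        using gh V(1) h' unfolding relative_ghost_def ladder_def by blast
      then show "stably_zero R W N' (f \<circ> h)"
        using ladder_stably_zero_iff[OF ladder_comp[OF h' assms]] by simp
    qed
  qed
qed

text \<open>\<open>ghost_chain X n Y F\<close>: the map \<open>F\<close> is an arbitrary homomorphism out of \<open>X\<close> followed by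
  \<open>n\<close> ghosts. Allowing the initial homomorphism makes the notion stable under
  precomposition, and \<open>n = 0\<close> describes all homomorphisms.\<close>
inductive ghost_chain :: "('a, 'm) module \<Rightarrow> nat \<Rightarrow> ('a, 'm) module \<Rightarrow> ('m \<Rightarrow> 'm) \<Rightarrow> bool"
  for X where
  start: "left_module R Y \<Longrightarrow> F \<in> lmod_hom R X Y \<Longrightarrow> ghost_chain X 0 Y F"
| step: "ghost_chain X n Y F \<Longrightarrow> left_module R Z \<Longrightarrow> ghostly Y Z g \<Longrightarrow> ghost_chain X (Suc n) Z (g \<circ> F)"

definition ghost_length_le :: "nat \<Rightarrow> ('a, 'm) module \<Rightarrow> bool" where
  "ghost_length_le n X \<longleftrightarrow> left_module R X \<and> (\<forall>Y F. ghost_chain X n Y F \<longrightarrow> stably_zero R X Y F)"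

lemma ghost_chain_hom:
  assumes "ghost_chain X n Y F" shows "F \<in> lmod_hom R X Y" "left_module R Y"
  using assms by (induction rule: ghost_chain.induct) (auto intro: lmod_hom_comp ghostly_hom)

lemma ghost_chain_precomp:
  assumes "ghost_chain X n Y F" "h \<in> lmod_hom R X' X"
  shows "ghost_chain X' n Y (F \<circ> h)"
  using assms
  by (induction rule: ghost_chain.induct)
    (auto intro: ghost_chain.intros lmod_hom_comp simp: comp_assoc)

lemma ghost_chain_split:
  assumes "ghost_chain X (m + n) Y F"
  obtains Z F1 F2 where "ghost_chain X m Z F1" "ghost_chain Z n Y F2" "F = F2 \<circ> F1"
proof -
  have "\<exists>Z F1 F2. ghost_chain X m Z F1 \<and> ghost_chain Z n Y F2 \<and> F = F2 \<circ> F1"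
    using assms
  proof (induction n arbitrary: Y F)
    case 0
    then have "ghost_chain Y 0 Y id" by (intro start lmod_hom_id ghost_chain_hom(2))
    then show ?case using 0 by (metis add.right_neutral id_comp)
  next
    case (Suc n)
    obtain Y' F' g where Y': "ghost_chain X (m + n) Y' F'" "left_module R Y" "ghostly Y' Y g" "F = g \<circ> F'"
      using Suc.prems by (auto elim: ghost_chain.cases)
    obtain Z F1 F2 where "ghost_chain X m Z F1" "ghost_chain Z n Y' F2" "F' = F2 \<circ> F1"
      using Suc.IH[OF Y'(1)] by blast
    then show ?case using Y' step[of Z n Y' F2 Y g] by (metis comp_assoc)
  qed
  then show thesis using that by blast
qed

lemma ghost_length_leD: "ghost_length_le n X \<Longrightarrow> ghost_chain X n Y F \<Longrightarrow> stably_zero R X Y F"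
  by (simp add: ghost_length_le_def)

lemma ghost_length_le_mono:
  assumes "ghost_length_le m X" "m \<le> n" shows "ghost_length_le n X"
  unfolding ghost_length_le_def
proof (intro conjI allI impI)
  show "left_module R X" using assms by (simp add: ghost_length_le_def)
  fix Y F assume "ghost_chain X n Y F"
  then have "ghost_chain X (m + (n - m)) Y F" using assms by simp
  then obtain Z F1 F2 where F: "ghost_chain X m Z F1" "ghost_chain Z (n - m) Y F2" "F = F2 \<circ> F1"
    by (rule ghost_chain_split)
  show "stably_zero R X Y F"
    unfolding F(3) by (rule stably_zero_comp[OF ghost_length_leD[OF assms(1) F(1)] ghost_chain_hom(1)[OF F(2)]])
qed

lemma ghost_length_le_zero:
  assumes "left_module R X" "carrier X = {\<zero>\<^bsub>X\<^esub>}" shows "ghost_length_le 0 X"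
  unfolding ghost_length_le_def
proof (intro conjI allI impI assms)
  fix Y F assume "ghost_chain X 0 Y F"
  note F = ghost_chain_hom[OF this]
  show "stably_zero R X Y F"
    using assms lmod_hom_zero[OF assms(1) F(2,1)] by (intro stably_zero_null F) simp_all
qed

text \<open>A test module \<open>T\<close> is its own \<open>\<Omega>\<^sup>0 T\<close>, so the definition of a ghost applies to any map
  out of it.\<close>
lemma ghost_length_le_test:
  assumes "T \<in> \<T>" shows "ghost_length_le 1 T"
  unfolding ghost_length_le_def
proof (intro conjI allI impI test_left_module[OF assms])
  fix Z F assume "ghost_chain T 1 Z F"
  then obtain Y F' g where F: "ghost_chain T 0 Y F'" "ghostly Y Z g" "F = g \<circ> F'"
    by (auto elim: ghost_chain.cases)
  have "is_Omega R 0 T T" by (simp add: is_Omega_def)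
  then have "T \<in> test_modules \<T>" using assms unfolding test_modules_def by blast
  then show "stably_zero R T Z F"
    using F ghost_chain_hom(1)[OF F(1)] unfolding relative_ghost_def by simp
qed

text \<open>If \<open>rs\<close> differs from the identity of \<open>N\<close> by a stably zero map, then \<open>F\<close> differs from
  \<open>(Fr)s\<close> by a stably zero map, and \<open>Fr\<close> is a chain of ghosts out of \<open>M\<close>.\<close>
lemma ghost_length_le_retract:
  assumes "stable_retract R N M" "ghost_length_le n M" shows "ghost_length_le n N"
  unfolding ghost_length_le_def
proof (intro conjI allI impI)
  show N: "left_module R N" using assms(1) by (simp add: stable_retract_def)
  fix Y F assume chain: "ghost_chain N n Y F"
  note F = ghost_chain_hom[OF chain]
  interpret Y: left_module R Y by (rule F(2))
  obtain s r where sr: "s \<in> lmod_hom R N M" "r \<in> lmod_hom R M N"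
    "stably_zero R N N (\<lambda>x. (r \<circ> s) x \<ominus>\<^bsub>N\<^esub> id x)"
    using assms(1) unfolding stable_retract_def stably_eq_def by blast
  have 1: "stably_zero R N Y ((F \<circ> r) \<circ> s)"
    by (rule stably_zero_precomp[OF ghost_length_leD[OF assms(2) ghost_chain_precomp[OF chain sr(2)]] sr(1)])
  have 2: "stably_zero R N Y (F \<circ> (\<lambda>x. (r \<circ> s) x \<ominus>\<^bsub>N\<^esub> id x))"
    by (rule stably_zero_comp[OF sr(3) F(1)])
  show "stably_zero R N Y F"
  proof (rule stably_zero_cong[OF stably_zero_diff[OF N F(2) 1 2]])
    fix x assume x: "x \<in> carrier N"
    have rs: "r (s x) \<in> carrier N" using x by (simp add: lmod_hom_closed[OF sr(1)] lmod_hom_closed[OF sr(2)])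
    have "F (r (s x)) \<ominus>\<^bsub>Y\<^esub> (F (r (s x)) \<ominus>\<^bsub>Y\<^esub> F x) = F x"
      using x rs by (simp add: lmod_hom_closed[OF F(1)] a_minus_def Y.minus_add Y.r_neg1 Y.a_assoc[symmetric] Y.r_neg)
    then show "F x = ((F \<circ> r) \<circ> s) x \<ominus>\<^bsub>Y\<^esub> (F \<circ> (\<lambda>x. (r \<circ> s) x \<ominus>\<^bsub>N\<^esub> id x)) x"
      using x rs by (simp add: lmod_hom_minus[OF N F(2,1)])
  qed
qed

lemma stable_retract_of_iso_map:
  assumes "stable_iso_map R M N f" shows "stable_retract R M N" "stable_retract R N M"
  using assms unfolding stable_iso_map_def stable_retract_def by blast+

text \<open>A chain of ghosts is shifted one ghost at a time, by ladders with a common sequence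
  for consecutive steps.\<close>
lemma ghost_chain_shift:
  assumes "projective_sequence N i P q M"
  shows "ghost_chain N n Y F \<Longrightarrow> \<exists>j Q s Y' F'. ladder N i P q M Y j Q s Y' F F' \<and> ghost_chain M n Y' F'"
    and "ghost_chain M n Y' F' \<Longrightarrow> \<exists>j Q s Y F. ladder N i P q M Y j Q s Y' F F' \<and> ghost_chain N n Y F"
proof -
  show "\<exists>j Q s Y' F'. ladder N i P q M Y j Q s Y' F F' \<and> ghost_chain M n Y' F'" if "ghost_chain N n Y F"
    using that
  proof induction
    case (start Y F)
    obtain j Q s Y' where ps: "projective_sequence Y j Q s Y'" using projective_sequence_from[OF start(1)] .
    then obtain F' where F': "ladder N i P q M Y j Q s Y' F F'" by (rule ladder_extend[OF assms _ start(2)])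
    have "left_module R Y'" using ps short_exactD(3) unfolding projective_sequence_def by blast
    then have "ghost_chain M 0 Y' F'" using F' by (intro ghost_chain.start) (auto simp: ladder_def)
    then show ?case using F' by blast
  next
    case (step n Y F Z g)
    obtain j Q s Y' F' where IH: "ladder N i P q M Y j Q s Y' F F'" "ghost_chain M n Y' F'"
      using step.IH by blast
    have psY: "projective_sequence Y j Q s Y'" using IH(1) by (simp add: ladder_def)
    obtain k Q' t Z' where ps: "projective_sequence Z k Q' t Z'" using projective_sequence_from[OF step(2)] .
    then obtain g' where g': "ladder Y j Q s Y' Z k Q' t Z' g g'"
      by (rule ladder_extend[OF psY _ ghostly_hom[OF step(3)]])
    have "left_module R Z'" using ps short_exactD(3) unfolding projective_sequence_def by blast
    then have "ghost_chain M (Suc n) Z' (g' \<circ> F')"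
      using step(3) ladder_ghost_iff[OF g'] by (intro ghost_chain.step[OF IH(2)]) auto
    then show ?case using ladder_comp[OF IH(1) g'] by blast
  qed
  show "\<exists>j Q s Y F. ladder N i P q M Y j Q s Y' F F' \<and> ghost_chain N n Y F" if "ghost_chain M n Y' F'"
    using that
  proof induction
    case (start Y' F')
    obtain j Q s Y where ps: "projective_sequence Y j Q s Y'" using projective_sequence_to[OF start(1)] .
    then obtain F where F: "ladder N i P q M Y j Q s Y' F F'" by (rule ladder_lift[OF assms _ start(2)])
    have "left_module R Y" using ps short_exactD(1) unfolding projective_sequence_def by blast
    then have "ghost_chain N 0 Y F" using F by (intro ghost_chain.start) (auto simp: ladder_def)
    then show ?case using F by blast
  next
    case (step n Y' F' Z' g')
    obtain j Q s Y F where IH: "ladder N i P q M Y j Q s Y' F F'" "ghost_chain N n Y F"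
      using step.IH by blast
    have psY: "projective_sequence Y j Q s Y'" using IH(1) by (simp add: ladder_def)
    obtain k Q' t Z where ps: "projective_sequence Z k Q' t Z'" using projective_sequence_to[OF step(2)] .
    then obtain g where g: "ladder Y j Q s Y' Z k Q' t Z' g g'"
      by (rule ladder_lift[OF psY _ ghostly_hom[OF step(3)]])
    have "left_module R Z" using ps short_exactD(1) unfolding projective_sequence_def by blast
    then have "ghost_chain N (Suc n) Z (g \<circ> F)"
      using step(3) ladder_ghost_iff[OF g] by (intro ghost_chain.step[OF IH(2)]) auto
    then show ?case using ladder_comp[OF IH(1) g] by blast
  qed
qed

lemma ghost_length_le_syzygy:
  assumes "syzygy R M N" shows "ghost_length_le n M \<longleftrightarrow> ghost_length_le n N"
proof -
  obtain i P q where ps: "projective_sequence N i P q M" using assms unfolding syzygy_iff by blast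
  note lm = syzygy_left_module[OF assms]
  show ?thesis
  proof
    assume M: "ghost_length_le n M"
    show "ghost_length_le n N"
      unfolding ghost_length_le_def
    proof (intro conjI allI impI lm)
      fix Y F assume "ghost_chain N n Y F"
      then obtain j Q s Y' F' where "ladder N i P q M Y j Q s Y' F F'" "ghost_chain M n Y' F'"
        using ghost_chain_shift(1)[OF ps] by blast
      then show "stably_zero R N Y F" using ghost_length_leD[OF M] ladder_stably_zero_iff by blast
    qed
  next
    assume N: "ghost_length_le n N"
    show "ghost_length_le n M"
      unfolding ghost_length_le_def
    proof (intro conjI allI impI lm)
      fix Y' F' assume "ghost_chain M n Y' F'"
      then obtain j Q s Y F where "ladder N i P q M Y j Q s Y' F F'" "ghost_chain N n Y F"
        using ghost_chain_shift(2)[OF ps] by blast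
      then show "stably_zero R M Y' F'" using ghost_length_leD[OF N] ladder_stably_zero_iff by blast
    qed
  qed
qed

text \<open>The first \<open>b\<close> ghosts out of \<open>C\<close> vanish on \<open>B\<close>, so their composite extends from \<open>B\<close> to a
  projective \<open>Q\<close> containing \<open>B\<close>.  The extension vanishes on \<open>A\<close>, and thus the composite factors
  through \<open>Q/A\<close>, which is a model of \<open>\<Omega>\<^sup>-\<^sup>1 A\<close>.\<close>

lemma ghost_length_le_cone:
  assumes ses: "short_exact R A i B q C" and A: "ghost_length_le a A" and B: "ghost_length_le b B"
  shows "ghost_length_le (b + a) C"
  unfolding ghost_length_le_def
proof (intro conjI allI impI)
  note E = short_exactD[OF ses]
  show "left_module R C" by (rule E(3))
  fix Z F assume "ghost_chain C (b + a) Z F"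
  then obtain Y F1 F2 where F: "ghost_chain C b Y F1" "ghost_chain Y a Z F2" "F = F2 \<circ> F1"
    by (rule ghost_chain_split)
  note F1 = ghost_chain_hom[OF F(1)]
  obtain j Q s V where ps: "projective_sequence B j Q s V" using projective_sequence_from[OF E(2)] .
  have Q: "projective_module R Q" "left_module R Q" "j \<in> lmod_hom R B Q" "inj_on j (carrier B)"
    using ps short_exactD[of R B j Q s V] unfolding projective_sequence_def by blast+
  have "stably_zero R B Y (F1 \<circ> q)"
    by (rule ghost_length_leD[OF B ghost_chain_precomp[OF F(1) E(5)]])
  then obtain h where h: "h \<in> lmod_hom R Q Y" "\<forall>x\<in>carrier B. (F1 \<circ> q) x = h (j x)"
    by (rule stably_zero_through_embedding[OF E(2) _ Q(1,3,4)])
  have ji: "j \<circ> i \<in> lmod_hom R A Q" by (rule lmod_hom_comp[OF Q(3) E(4)])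
  have injji: "inj_on (j \<circ> i) (carrier A)"
    by (rule comp_inj_on[OF E(6)], rule inj_on_subset[OF Q(4)])
      (use lmod_hom_closed[OF E(4)] in auto)
  obtain W :: "('a, 'm) module" and t where ses': "short_exact R A (j \<circ> i) Q t W"
    by (rule short_exact_quotient[OF E(1) Q(2) ji injji])
  note E' = short_exactD[OF ses']
  have "syzygy R W A" unfolding syzygy_def using ses' Q(1) by blast
  then have W: "ghost_length_le a W" using A ghost_length_le_syzygy by blast
  obtain k where k: "k \<in> lmod_hom R W Y" "\<forall>x\<in>carrier Q. k (t x) = h x"
  proof (rule factor_through_surjection[OF E'(2,3) F1(2) E'(5,7) h(1)])
    fix x assume "x \<in> carrier Q" "t x = \<zero>\<^bsub>W\<^esub>"
    then obtain y where y: "y \<in> carrier A" "x = j (i y)" using E'(9) by force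
    then have "h x = F1 (q (i y))" using h(2) lmod_hom_closed[OF E(4)] by simp
    also have "\<dots> = \<zero>\<^bsub>Y\<^esub>" using E(8)[OF y(1)] lmod_hom_zero[OF E(3) F1(2,1)] by simp
    finally show "h x = \<zero>\<^bsub>Y\<^esub>" .
  qed
  obtain c where c: "c \<in> lmod_hom R C W" "\<forall>x\<in>carrier B. c (q x) = (t \<circ> j) x"
  proof (rule factor_through_surjection[OF E(2,3) E'(3) E(5,7) lmod_hom_comp[OF E'(5) Q(3)]])
    fix x assume "x \<in> carrier B" "q x = \<zero>\<^bsub>C\<^esub>"
    then obtain y where "y \<in> carrier A" "x = i y" using E(9) by blast
    then show "(t \<circ> j) x = \<zero>\<^bsub>W\<^esub>" using E'(8) by simp
  qed
  have "stably_zero R C Z ((F2 \<circ> k) \<circ> c)"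
    by (rule stably_zero_precomp[OF ghost_length_leD[OF W ghost_chain_precomp[OF F(2) k(1)]] c(1)])
  then show "stably_zero R C Z F"
  proof (rule stably_zero_cong)
    fix y assume "y \<in> carrier C"
    then have "y \<in> q ` carrier B" using E(7) by simp
    then obtain x where x: "x \<in> carrier B" "y = q x" by blast
    then have "k (c y) = F1 y" using c(2) k(2) h(2) lmod_hom_closed[OF Q(3)] by simp
    then show "F y = ((F2 \<circ> k) \<circ> c) y" by (simp add: F(3))
  qed
qed

text \<open>The first \<open>a\<close> ghosts out of \<open>B\<close> vanish stably on \<open>A\<close>; subtracting a stably zero extension
  of that restriction leaves a map which factors through \<open>C\<close>.\<close>

lemma ghost_length_le_extension:
  assumes ses: "short_exact R A i B q C" and A: "ghost_length_le a A" and C: "ghost_length_le c C"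
  shows "ghost_length_le (a + c) B"
  unfolding ghost_length_le_def
proof (intro conjI allI impI)
  note E = short_exactD[OF ses]
  show "left_module R B" by (rule E(2))
  fix Z F assume "ghost_chain B (a + c) Z F"
  then obtain Y F1 F2 where F: "ghost_chain B a Y F1" "ghost_chain Y c Z F2" "F = F2 \<circ> F1"
    by (rule ghost_chain_split)
  note F1 = ghost_chain_hom[OF F(1)] and F2 = ghost_chain_hom[OF F(2)]
  interpret Y: left_module R Y by (rule F1(2))
  interpret Z: left_module R Z by (rule F2(2))
  have "stably_zero R A Y (F1 \<circ> i)"
    by (rule ghost_length_leD[OF A ghost_chain_precomp[OF F(1) E(4)]])
  then obtain h where h: "h \<in> lmod_hom R B Y" "stably_zero R B Y h"
    "\<forall>x\<in>carrier A. h (i x) = (F1 \<circ> i) x"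
    by (rule stably_zero_extend[OF _ E(1,2,4,6)])
  have d: "(\<lambda>x. F1 x \<ominus>\<^bsub>Y\<^esub> h x) \<in> lmod_hom R B Y" by (rule lmod_hom_diff[OF F1(2,1) h(1)])
  obtain k where k: "k \<in> lmod_hom R C Y" "\<forall>x\<in>carrier B. k (q x) = F1 x \<ominus>\<^bsub>Y\<^esub> h x"
  proof (rule factor_through_surjection[OF E(2,3) F1(2) E(5,7) d])
    fix x assume "x \<in> carrier B" "q x = \<zero>\<^bsub>C\<^esub>"
    then obtain y where "y \<in> carrier A" "x = i y" using E(9) by blast
    then show "F1 x \<ominus>\<^bsub>Y\<^esub> h x = \<zero>\<^bsub>Y\<^esub>"
      using h(3) lmod_hom_closed[OF E(4)] lmod_hom_closed[OF F1(1)] by (simp add: Y.minus_eq_zero_iff)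
  qed
  have 1: "stably_zero R B Z ((F2 \<circ> k) \<circ> q)"
    by (rule stably_zero_precomp[OF ghost_length_leD[OF C ghost_chain_precomp[OF F(2) k(1)]] E(5)])
  have 2: "stably_zero R B Z (F2 \<circ> h)" by (rule stably_zero_comp[OF h(2) F2(1)])
  have cl: "F1 x \<in> carrier Y" "h x \<in> carrier Y" if "x \<in> carrier B" for x
    using that by (simp_all add: lmod_hom_closed[OF F1(1)] lmod_hom_closed[OF h(1)])
  have eq: "((F2 \<circ> k) \<circ> q) x = F2 (F1 x) \<ominus>\<^bsub>Z\<^esub> F2 (h x)" if "x \<in> carrier B" for x
    using that cl by (simp add: k(2) lmod_hom_minus[OF F1(2) F2(2,1)])
  show "stably_zero R B Z F"
  proof (rule stably_zero_cong[OF stably_zero_plus[OF E(2) F2(2) 1 2]])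
    fix x assume x: "x \<in> carrier B"
    note cl2 = cl[OF x, THEN lmod_hom_closed[OF F2(1)]]
    show "((F2 \<circ> k) \<circ> q) x \<in> carrier Z" "(F2 \<circ> h) x \<in> carrier Z" using eq[OF x] cl2 by simp_all
    show "F x = ((F2 \<circ> k) \<circ> q) x \<oplus>\<^bsub>Z\<^esub> (F2 \<circ> h) x"
      unfolding eq[OF x] using cl2 by (simp add: F(3) a_minus_def Z.a_assoc Z.l_neg)
  qed
qed

lemma ghost_length_le_direct_sum:
  assumes M: "left_module R M" and sub: "submodule A R M" "submodule B R M"
    and AB: "A \<inter> B = {\<zero>\<^bsub>M\<^esub>}" "A <+>\<^bsub>M\<^esub> B = carrier M"
    and A: "ghost_length_le n (M\<lparr>carrier := A\<rparr>)" and B: "ghost_length_le n (M\<lparr>carrier := B\<rparr>)"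
  shows "ghost_length_le n M"
  unfolding ghost_length_le_def
proof (intro conjI allI impI M)
  fix Y F assume chain: "ghost_chain M n Y F"
  note F = ghost_chain_hom[OF chain]
  interpret M: left_module R M by fact
  interpret Y: left_module R Y by (rule F(2))
  obtain \<pi> where \<pi>: "\<pi> \<in> lmod_hom R M M" "\<forall>x\<in>carrier M. \<pi> x \<in> A"
    "\<forall>x\<in>carrier M. x \<ominus>\<^bsub>M\<^esub> \<pi> x \<in> B"
    by (rule complement_projection[OF M sub AB])
  have pA: "\<pi> \<in> lmod_hom R M (M\<lparr>carrier := A\<rparr>)" by (rule lmod_hom_corestrict[OF \<pi>(1)]) (simp add: \<pi>(2))
  have "(\<lambda>x. id x \<ominus>\<^bsub>M\<^esub> \<pi> x) \<in> lmod_hom R M M" by (rule lmod_hom_diff[OF M lmod_hom_id \<pi>(1)])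
  then have pB: "(\<lambda>x. id x \<ominus>\<^bsub>M\<^esub> \<pi> x) \<in> lmod_hom R M (M\<lparr>carrier := B\<rparr>)"
    by (rule lmod_hom_corestrict) (simp add: \<pi>(3))
  have 1: "stably_zero R M Y ((F \<circ> id) \<circ> \<pi>)"
    by (rule stably_zero_precomp[OF ghost_length_leD[OF A ghost_chain_precomp[OF chain]] pA])
      (rule lmod_hom_inclusion[OF M sub(1)])
  have 2: "stably_zero R M Y ((F \<circ> id) \<circ> (\<lambda>x. id x \<ominus>\<^bsub>M\<^esub> \<pi> x))"
    by (rule stably_zero_precomp[OF ghost_length_leD[OF B ghost_chain_precomp[OF chain]] pB])
      (rule lmod_hom_inclusion[OF M sub(2)])
  show "stably_zero R M Y F"
  proof (rule stably_zero_cong[OF stably_zero_plus[OF M F(2) 1 2]])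
    fix x assume x: "x \<in> carrier M"
    have px: "\<pi> x \<in> carrier M" using x by (simp add: lmod_hom_closed[OF \<pi>(1)])
    have cl: "F x \<in> carrier Y" "F (\<pi> x) \<in> carrier Y" using x px by (simp_all add: lmod_hom_closed[OF F(1)])
    show "((F \<circ> id) \<circ> \<pi>) x \<in> carrier Y" "((F \<circ> id) \<circ> (\<lambda>x. id x \<ominus>\<^bsub>M\<^esub> \<pi> x)) x \<in> carrier Y"
      using x px cl by (simp_all add: lmod_hom_minus[OF M F(2,1)])
    show "F x = ((F \<circ> id) \<circ> \<pi>) x \<oplus>\<^bsub>Y\<^esub> ((F \<circ> id) \<circ> (\<lambda>x. id x \<ominus>\<^bsub>M\<^esub> \<pi> x)) x"
      using x px cl by (simp add: lmod_hom_minus[OF M F(2,1)]) (simp add: a_minus_def Y.a_lcomm Y.r_neg)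
  qed
qed

lemma stable_retract_of_iso:
  assumes "left_module R M" "left_module R N" "lmod_iso R M N"
  shows "stable_retract R N (M :: ('a, 'm) module)"
proof -
  interpret N: left_module R N by fact
  obtain f where f: "f \<in> lmod_hom R M N" "inj_on f (carrier M)" "f ` carrier M = carrier N"
    using assms(3) unfolding lmod_iso_def bij_betw_def by blast
  obtain h where h: "h \<in> lmod_hom R N M" "\<forall>x\<in>carrier N. f (h x) = id x"
    using lift_through_injection[OF assms(1,2) f(1,2) lmod_hom_id[of R N]] f(3) by (metis id_apply)
  have "stably_eq R N N (f \<circ> h) id"
    unfolding stably_eq_def
    by (rule stably_zero_null[OF assms(2,2)]) (simp add: h(2) N.minus_eq_zero_iff)
  then show ?thesis unfolding stable_retract_def using assms f h by blast
qed

text \<open>Collects the closure properties above; the module \<open>X0\<close> supplies a zero object.\<close>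
lemma thick_finite_ghost_length:
  assumes "left_module R (X0 :: ('a, 'm) module)"
  shows "thick_subcategory R {X. \<exists>n. ghost_length_le n X}"
  unfolding thick_subcategory_def triangulated_subcategory_def
proof (intro conjI allI impI ballI)
  let ?C = "{X. \<exists>n. ghost_length_le n X}"
  have "ghost_length_le 0 (X0\<lparr>carrier := {\<zero>\<^bsub>X0\<^esub>}\<rparr>)"
    by (rule ghost_length_le_zero) (simp_all add: left_module_submodule submodule_zero assms)
  then show "?C \<noteq> {}" by blast
  show "left_module R M" if "M \<in> ?C" for M using that by (auto simp: ghost_length_le_def)
  have retract: "N \<in> ?C" if "M \<in> ?C" "stable_retract R N M" for M N
    using that ghost_length_le_retract by blast
  show "N \<in> ?C" if "M \<in> ?C \<and> stable_retract R N M" for M N using retract that by blast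
  show "N \<in> ?C" if "M \<in> ?C \<and> stably_isomorphic R M N" for M N
    using that retract stable_retract_of_iso_map(2) unfolding stably_isomorphic_def by blast
  show "M \<in> ?C \<longleftrightarrow> N \<in> ?C" if "syzygy R M N" for M N using ghost_length_le_syzygy[OF that] by blast
  show "Z \<in> ?C" if tri: "exact_triangle R X f Y g Z \<and> X \<in> ?C \<and> Y \<in> ?C" for X f Y g Z
  proof -
    obtain A i B q C \<alpha> \<beta> \<gamma> where t: "short_exact R A i B q C" "stable_iso_map R X A \<alpha>"
      "stable_iso_map R Y B \<beta>" "stable_iso_map R Z C \<gamma>"
      using tri unfolding exact_triangle_def by blast
    have "A \<in> ?C" "B \<in> ?C" using tri t retract stable_retract_of_iso_map(2) by blast+
    then have "C \<in> ?C" using ghost_length_le_cone[OF t(1)] by blast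
    then show ?thesis using retract stable_retract_of_iso_map(1)[OF t(4)] by blast
  qed
qed

end

section \<open>Modules of finite length\<close>

text \<open>A function witnessing that chains of submodules of \<open>M\<close> have bounded length: a chain of
  strict inclusions below \<open>V\<close> has at most \<open>\<delta> V\<close> steps. It serves for choosing minimal and
  maximal submodules and as an induction measure.\<close>
definition strict_rank :: "('a, 'r) ring_scheme \<Rightarrow> ('a, 'm) module \<Rightarrow> ('m set \<Rightarrow> nat) \<Rightarrow> bool" where
  "strict_rank R M \<delta> \<longleftrightarrow> (\<forall>U V. submodule U R M \<and> submodule V R M \<and> U \<subset> V \<longrightarrow> \<delta> U < \<delta> V)"

definition finite_length :: "('a, 'r) ring_scheme \<Rightarrow> ('a, 'm) module \<Rightarrow> bool" where
  "finite_length R M \<longleftrightarrow> (\<exists>\<delta>. strict_rank R M \<delta>)"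

definition regular_module :: "('a, 'r) ring_scheme \<Rightarrow> ('a, 'a) module" where
  "regular_module R = \<lparr>carrier = carrier R, mult = mult R, one = one R, zero = zero R, add = add R,
     smult = mult R\<rparr>"

definition annihilator :: "('a, 'r) ring_scheme \<Rightarrow> ('a, 'm) module \<Rightarrow> 'm \<Rightarrow> 'a set" where
  "annihilator R M x = {a \<in> carrier R. a \<odot>\<^bsub>M\<^esub> x = \<zero>\<^bsub>M\<^esub>}"

lemma regular_module_simps [simp]:
  "carrier (regular_module R) = carrier R" "zero (regular_module R) = zero R"
  "add (regular_module R) = add R" "smult (regular_module R) = mult R"
  by (simp_all add: regular_module_def)

lemma left_module_regular:
  assumes "ring R" shows "left_module R (regular_module R)"
proof -
  interpret R: ring R by fact
  have "abelian_group (regular_module R)"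
  proof (rule abelian_groupI)
    show "\<exists>y\<in>carrier (regular_module R). y \<oplus>\<^bsub>regular_module R\<^esub> x = \<zero>\<^bsub>regular_module R\<^esub>"
      if "x \<in> carrier (regular_module R)" for x
      using that by (intro bexI[of _ "\<ominus>\<^bsub>R\<^esub> x"]) (simp_all add: R.l_neg)
  qed (simp_all add: R.a_ac)
  then show ?thesis
    using assms by (auto simp: left_module_def left_module_axioms_def R.l_distr R.r_distr R.m_assoc)
qed

lemma lmod_hom_orbit:
  fixes M :: "('a, 'm) module"
  assumes "left_module R M" "x \<in> carrier M"
  shows "(\<lambda>a. a \<odot>\<^bsub>M\<^esub> x) \<in> lmod_hom R (regular_module R) M"
proof -
  interpret M: left_module R M by fact
  show ?thesis
    by (rule lmod_homI) (simp_all add: assms(2) M.smult_closed M.smult_l_distr M.smult_assoc)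
qed

lemma submodule_orbit:
  fixes M :: "('a, 'm) module"
  assumes "left_module R M" "x \<in> carrier M"
  shows "submodule ((\<lambda>a. a \<odot>\<^bsub>M\<^esub> x) ` carrier R) R M" "x \<in> (\<lambda>a. a \<odot>\<^bsub>M\<^esub> x) ` carrier R"
proof -
  interpret M: left_module R M by fact
  have r: "left_module R (regular_module R)" by (rule left_module_regular) (rule M.R.ring_axioms)
  show "submodule ((\<lambda>a. a \<odot>\<^bsub>M\<^esub> x) ` carrier R) R M"
    using submodule_image[OF r assms(1) lmod_hom_orbit[OF assms] submodule_carrier[OF r]] by simp
  show "x \<in> (\<lambda>a. a \<odot>\<^bsub>M\<^esub> x) ` carrier R"
    using M.smult_one[OF assms(2)] M.R.one_closed by (metis imageI)
qed

lemma submodule_transporter: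
  fixes M :: "('a, 'm) module"
  assumes "left_module R M" "x \<in> carrier M" "submodule H R M"
  shows "submodule {a \<in> carrier R. a \<odot>\<^bsub>M\<^esub> x \<in> H} R (regular_module R)"
  using submodule_preimage[OF left_module_regular[OF left_moduleD(1)[OF assms(1)]] assms(1)
      lmod_hom_orbit[OF assms(1,2)] assms(3)] by simp

lemma submodule_annihilator:
  fixes M :: "('a, 'm) module"
  assumes "left_module R M" "x \<in> carrier M"
  shows "submodule (annihilator R M x) R (regular_module R)"
  using submodule_transporter[OF assms submodule_zero[OF assms(1)]] by (simp add: annihilator_def)

text \<open>Adjoining one generator \<open>x\<close> to \<open>N\<close>: a submodule \<open>U\<close> of \<open>N + Rx\<close> is determined, within a
  larger one, by \<open>U \<inter> N\<close> and by the left ideal of those \<open>a\<close> with \<open>ax \<in> U + N\<close>.\<close>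

lemma finite_length_finitely_generated:
  fixes M :: "('a, 'm) module" (structure)
  assumes M: "left_module R M" and fl: "finite_length R (regular_module R)"
    and S: "finite S" "S \<subseteq> carrier M" "\<And>H. submodule H R M \<Longrightarrow> S \<subseteq> H \<Longrightarrow> H = carrier M"
  shows "finite_length R M"
proof -
  interpret M: left_module R M by fact
  obtain \<rho> where \<rho>: "strict_rank R (regular_module R) \<rho>" using fl unfolding finite_length_def by blast
  have "\<exists>N \<delta>. submodule N R M \<and> S \<subseteq> N \<and>
    (\<forall>U V. submodule U R M \<and> submodule V R M \<and> V \<subseteq> N \<and> U \<subset> V \<longrightarrow> \<delta> U < (\<delta> V :: nat))"
    using S(1,2)
  proof (induction S rule: finite_induct)
    case empty
    have "\<not> U \<subset> V" if "submodule U R M" "V \<subseteq> {\<zero>}" for U V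
      using submoduleD(2)[OF M that(1)] that(2) by auto
    then show ?case using submodule_zero[OF M] by blast
  next
    case (insert x S)
    then have x: "x \<in> carrier M" by simp
    obtain N \<delta> where N: "submodule N R M" "S \<subseteq> N" and
      \<delta>: "\<forall>U V. submodule U R M \<and> submodule V R M \<and> V \<subseteq> N \<and> U \<subset> V \<longrightarrow> \<delta> U < (\<delta> V :: nat)"
      using insert.IH insert.prems by auto
    define Rx where "Rx = (\<lambda>a. a \<odot> x) ` carrier R"
    have Rx: "submodule Rx R M" "x \<in> Rx" unfolding Rx_def by (rule submodule_orbit[OF M x])+
    define I where "I U = {a \<in> carrier R. a \<odot> x \<in> U <+>\<^bsub>M\<^esub> N}" for U
    have I: "submodule (I U) R (regular_module R)" if "submodule U R M" for U
      unfolding I_def by (rule submodule_transporter[OF M x submodule_sum(1)[OF M that N(1)]])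
    note Nd = submoduleD[OF M N(1)]
    have NM: "n \<in> carrier M" if "n \<in> N" for n using Nd(1) that by (rule subsetD)
    have "\<delta> (U \<inter> N) + \<rho> (I U) < \<delta> (V \<inter> N) + \<rho> (I V)"
      if U: "submodule U R M" and V: "submodule V R M" and VN: "V \<subseteq> N <+>\<^bsub>M\<^esub> Rx" and UV: "U \<subset> V" for U V
    proof -
      note Ud = submoduleD[OF M U] and Vd = submoduleD[OF M V]
      have UM: "u \<in> carrier M" if "u \<in> U" for u using Ud(1) that by (rule subsetD)
      have VM: "u \<in> carrier M" if "u \<in> V" for u using Vd(1) that by (rule subsetD)
      have le1: "U \<inter> N \<subseteq> V \<inter> N" using UV by blast
      have le2: "I U \<subseteq> I V" using UV by (auto simp: I_def set_add_def')
      have "\<not> (U \<inter> N = V \<inter> N \<and> I U = I V)"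
      proof
        assume eq: "U \<inter> N = V \<inter> N \<and> I U = I V"
        have "V \<subseteq> U"
        proof
          fix v assume v: "v \<in> V"
          then have "v \<in> N <+>\<^bsub>M\<^esub> Rx" using VN by (rule subsetD[rotated])
          then obtain n a where na: "n \<in> N" "a \<in> carrier R" "v = n \<oplus> a \<odot> x"
            unfolding set_add_def' Rx_def by blast
          have ax: "a \<odot> x \<in> carrier M" using na(2) x by (rule M.smult_closed)
          have "a \<odot> x = v \<oplus> \<ominus> n"
            using na(1,3) ax NM by (simp add: M.a_ac M.r_neg2)
          moreover have "v \<oplus> \<ominus> n \<in> V <+>\<^bsub>M\<^esub> N"
            unfolding set_add_def' using v Nd(4)[OF na(1)] by blast
          ultimately have "a \<in> I V" using na(2) by (simp add: I_def)
          then have "a \<in> I U" using eq by blast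
          then have "a \<odot> x \<in> U <+>\<^bsub>M\<^esub> N" by (simp add: I_def)
          then obtain u m where um: "u \<in> U" "m \<in> N" "a \<odot> x = u \<oplus> m" unfolding set_add_def' by blast
          have uV: "u \<in> V" using um UV by blast
          have vu: "v = u \<oplus> (n \<oplus> m)"
            using na(1,3) um NM UM by (simp add: M.a_ac)
          then have "n \<oplus> m = v \<ominus> u"
            using na(1) um(1,2) NM UM by (simp add: a_minus_def M.a_ac M.r_neg M.r_neg1 M.r_neg2)
          then have "n \<oplus> m \<in> V \<inter> N" using Vd(5)[OF v uV] Nd(3)[OF na(1) um(2)] by simp
          then have "n \<oplus> m \<in> U" using eq by blast
          then show "v \<in> U" using vu Ud(3)[OF um(1)] by simp
        qed
        then show False using UV by blast
      qed
      moreover have "\<delta> (U \<inter> N) < \<delta> (V \<inter> N)" if "U \<inter> N \<noteq> V \<inter> N"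
        using \<delta> submodule_Int[OF M U N(1)] submodule_Int[OF M V N(1)] le1 that by blast
      moreover have "\<rho> (I U) < \<rho> (I V)" if "I U \<noteq> I V"
        using \<rho> I[OF U] I[OF V] le2 that unfolding strict_rank_def by blast
      ultimately show ?thesis by (metis add_le_less_mono add_less_le_mono less_imp_le order_refl)
    qed
    then show ?case
      using submodule_sum[OF M N(1) Rx(1)] N(2) Rx(2)
      by (intro exI[of _ "N <+>\<^bsub>M\<^esub> Rx"] exI[of _ "\<lambda>U. \<delta> (U \<inter> N) + \<rho> (I U)"]) blast
  qed
  then obtain N \<delta> where N: "submodule N R M" "S \<subseteq> N"
    "\<forall>U V. submodule U R M \<and> submodule V R M \<and> V \<subseteq> N \<and> U \<subset> V \<longrightarrow> \<delta> U < (\<delta> V :: nat)" by blast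
  have "N = carrier M" using S(3) N by blast
  then have "strict_rank R M \<delta>"
    using N(3) submoduleD(1)[OF M] unfolding strict_rank_def by blast
  then show ?thesis unfolding finite_length_def by blast
qed

lemma finite_length_submodule:
  assumes "left_module R M" "submodule H R M" "finite_length R M"
  shows "finite_length R (M\<lparr>carrier := H\<rparr>)"
proof -
  obtain \<delta> where "strict_rank R M \<delta>" using assms(3) unfolding finite_length_def by blast
  then have "strict_rank R (M\<lparr>carrier := H\<rparr>) \<delta>"
    unfolding strict_rank_def submodule_of_submodule[OF assms(1,2)] by simp
  then show ?thesis unfolding finite_length_def by blast
qed

lemma finite_length_image:
  assumes "left_module R M" "left_module R N" "q \<in> lmod_hom R M N" "q ` carrier M = carrier N"
    "finite_length R M"
  shows "finite_length R N"
proof -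
  obtain \<delta> where \<delta>: "strict_rank R M \<delta>" using assms(5) unfolding finite_length_def by blast
  have "\<delta> {x \<in> carrier M. q x \<in> U} < \<delta> {x \<in> carrier M. q x \<in> V}"
    if "submodule U R N" "submodule V R N" "U \<subset> V" for U V
  proof -
    have "V \<subseteq> q ` carrier M" using submoduleD(1)[OF assms(2) that(2)] assms(4) by simp
    then have "{x \<in> carrier M. q x \<in> U} \<subset> {x \<in> carrier M. q x \<in> V}" using that(3) by blast
    then show ?thesis
      using \<delta> submodule_preimage[OF assms(1-3)] that(1,2) unfolding strict_rank_def by blast
  qed
  then show ?thesis
    unfolding finite_length_def strict_rank_def by (intro exI[of _ "\<lambda>U. \<delta> {x \<in> carrier M. q x \<in> U}"]) blast
qed

definition simple_module :: "('a, 'r) ring_scheme \<Rightarrow> ('a, 'm) module \<Rightarrow> bool" where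
  "simple_module R S \<longleftrightarrow> left_module R S \<and> carrier S \<noteq> {\<zero>\<^bsub>S\<^esub>} \<and>
     (\<forall>H. submodule H R S \<longrightarrow> H = {\<zero>\<^bsub>S\<^esub>} \<or> H = carrier S)"

lemma simple_module_nonzero:
  assumes "simple_module R S" obtains x where "x \<in> carrier S" "x \<noteq> \<zero>\<^bsub>S\<^esub>"
proof -
  have S: "left_module R S" "carrier S \<noteq> {\<zero>\<^bsub>S\<^esub>}" using assms by (simp_all add: simple_module_def)
  then show thesis using submoduleD(2)[OF S(1) submodule_carrier[OF S(1)]] that by blast
qed

lemma simple_module_hom_onto:
  assumes "simple_module R S" "left_module R M" "f \<in> lmod_hom R M S" "x \<in> carrier M" "f x \<noteq> \<zero>\<^bsub>S\<^esub>"
  shows "f ` carrier M = carrier S"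
proof -
  have "submodule (f ` carrier M) R S"
    using assms(1-3) submodule_image[OF assms(2) _ assms(3) submodule_carrier[OF assms(2)]]
    by (simp add: simple_module_def)
  then show ?thesis using assms unfolding simple_module_def by blast
qed

lemma simple_module_fin_gen:
  assumes "simple_module R S" shows "fin_gen_module R S"
proof -
  obtain x where x: "x \<in> carrier S" "x \<noteq> \<zero>\<^bsub>S\<^esub>" using simple_module_nonzero[OF assms] .
  have "H = carrier S" if "submodule H R S" "{x} \<subseteq> H" for H
    using assms that x unfolding simple_module_def by blast
  then show ?thesis
    using assms x(1) unfolding fin_gen_module_def simple_module_def by (intro conjI exI[of _ "{x}"]) auto
qed

text \<open>A nonzero submodule of \<open>Rx\<close> for which the left ideal of all \<open>a\<close> with \<open>ax \<in> L\<close> has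
  minimal rank is simple.\<close>
lemma simple_submodule_of_cyclic:
  fixes M :: "('a, 'm) module" (structure)
  assumes M: "left_module R M" and fl: "finite_length R (regular_module R)"
    and x: "x \<in> carrier M" "x \<noteq> \<zero>"
  obtains L where "submodule L R M" "simple_module R (M\<lparr>carrier := L\<rparr>)" "L \<subseteq> (\<lambda>a. a \<odot> x) ` carrier R"
proof -
  obtain \<rho> where \<rho>: "strict_rank R (regular_module R) \<rho>" using fl unfolding finite_length_def by blast
  let ?Rx = "(\<lambda>a. a \<odot> x) ` carrier R"
  let ?I = "\<lambda>H. {a \<in> carrier R. a \<odot> x \<in> H}"
  let ?P = "\<lambda>L. submodule L R M \<and> L \<noteq> {\<zero>} \<and> L \<subseteq> ?Rx"
  have "?P ?Rx" using submodule_orbit[OF M x(1)] x(2) by auto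
  then obtain L where L: "?P L" "\<And>H. ?P H \<Longrightarrow> \<rho> (?I L) \<le> \<rho> (?I H)"
    using ex_has_least_nat[of ?P ?Rx "\<lambda>H. \<rho> (?I H)"] by blast
  have "H = {\<zero>} \<or> H = L" if H: "submodule H R (M\<lparr>carrier := L\<rparr>)" for H
  proof (rule ccontr)
    assume n: "\<not> (H = {\<zero>} \<or> H = L)"
    have H': "H \<subseteq> L" "submodule H R M"
      using H submodule_of_submodule[OF M] L(1) by blast+
    then have le: "\<rho> (?I L) \<le> \<rho> (?I H)" using L n by blast
    have "?I H \<subset> ?I L" using H' n L(1) by blast
    then have "\<rho> (?I H) < \<rho> (?I L)"
      using \<rho> submodule_transporter[OF M x(1)] H'(2) L(1) unfolding strict_rank_def by blast
    then show False using le by simp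
  qed
  then have "simple_module R (M\<lparr>carrier := L\<rparr>)"
    using L(1) left_module_submodule[OF M] by (simp add: simple_module_def)
  then show thesis using that L(1) by blast
qed

text \<open>Every simple module is a quotient of the regular module.  Given a maximal submodule \<open>U'\<close> of
  \<open>U\<close>, a nonzero map from \<open>U\<close> to a simple module either is nonzero on \<open>U'\<close>, or its target is
  isomorphic to \<open>U/U'\<close>.\<close>

lemma finitely_many_simple_modules:
  fixes X :: "('a, 'm) module set"
  assumes R: "ring R" and fl: "finite_length R (regular_module R)"
    and X: "\<And>S. S \<in> X \<Longrightarrow> simple_module R S"
  obtains \<F> where "finite \<F>" "\<F> \<subseteq> X" "\<forall>S\<in>X. \<exists>S'\<in>\<F>. lmod_iso R S' S"
proof -
  let ?M = "regular_module R"
  have M: "left_module R ?M" by (rule left_module_regular[OF R])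
  obtain \<delta> where \<delta>: "strict_rank R ?M \<delta>" using fl unfolding finite_length_def by blast
  have lX: "left_module R S" if "S \<in> X" for S using X[OF that] by (simp add: simple_module_def)
  have main: "submodule U R ?M \<Longrightarrow> \<exists>\<F>. finite \<F> \<and> \<F> \<subseteq> X \<and>
      (\<forall>S\<in>X. \<forall>f\<in>lmod_hom R (?M\<lparr>carrier := U\<rparr>) S. (\<exists>u\<in>U. f u \<noteq> \<zero>\<^bsub>S\<^esub>) \<longrightarrow> (\<exists>S'\<in>\<F>. lmod_iso R S' S))"
    for U
  proof (induction "\<delta> U" arbitrary: U rule: less_induct)
    case less
    note lU = left_module_submodule[OF M less.prems]
    show ?case
    proof (cases "U = {\<zero>\<^bsub>R\<^esub>}")
      case True
      have "f u = \<zero>\<^bsub>S\<^esub>" if "S \<in> X" "f \<in> lmod_hom R (?M\<lparr>carrier := U\<rparr>) S" "u \<in> U" for S f u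
        using lmod_hom_zero[OF lU lX[OF that(1)] that(2)] that(3) True by simp
      then show ?thesis by blast
    next
      case False
      let ?P = "\<lambda>W. submodule W R ?M \<and> W \<subset> U"
      have bd: "\<delta> W < \<delta> U" if "?P W" for W using that \<delta> less.prems unfolding strict_rank_def by blast
      have "?P {\<zero>\<^bsub>R\<^esub>}" using submodule_zero[OF M] submoduleD(2)[OF M less.prems] False by auto
      then obtain U' where U': "?P U'" "\<And>W. ?P W \<Longrightarrow> \<delta> W \<le> \<delta> U'"
        using ex_has_greatest_nat[of ?P "{\<zero>\<^bsub>R\<^esub>}" \<delta> "\<delta> U"] bd by (metis less_imp_le)
      obtain \<F> where \<F>: "finite \<F>" "\<F> \<subseteq> X"
        "\<And>S f. S \<in> X \<Longrightarrow> f \<in> lmod_hom R (?M\<lparr>carrier := U'\<rparr>) S \<Longrightarrow> \<exists>u\<in>U'. f u \<noteq> \<zero>\<^bsub>S\<^esub> \<Longrightarrow> \<exists>S'\<in>\<F>. lmod_iso R S' S"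
      proof -
        have "submodule U' R ?M" using U'(1) by blast
        from less.hyps[OF bd[OF U'(1)] this] show ?thesis using that by metis
      qed
      define quot where "quot S f \<longleftrightarrow> S \<in> X \<and> f \<in> lmod_hom R (?M\<lparr>carrier := U\<rparr>) S \<and>
        (\<exists>u\<in>U. f u \<noteq> \<zero>\<^bsub>S\<^esub>) \<and> (\<forall>u\<in>U'. f u = \<zero>\<^bsub>S\<^esub>)" for S f
      have ker: "{u \<in> U. f u = \<zero>\<^bsub>S\<^esub>} = U'" if "quot S f" for S f
      proof (rule ccontr)
        assume n: "{u \<in> U. f u = \<zero>\<^bsub>S\<^esub>} \<noteq> U'"
        have f: "S \<in> X" "f \<in> lmod_hom R (?M\<lparr>carrier := U\<rparr>) S" using that by (auto simp: quot_def)
        have sub: "submodule {u \<in> U. f u = \<zero>\<^bsub>S\<^esub>} R ?M"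
          using submodule_kernel[OF lU lX[OF f(1)] f(2)] submodule_of_submodule[OF M less.prems] by simp
        have "{u \<in> U. f u = \<zero>\<^bsub>S\<^esub>} \<subset> U" using that by (auto simp: quot_def)
        then have "\<delta> {u \<in> U. f u = \<zero>\<^bsub>S\<^esub>} \<le> \<delta> U'" using U'(2) sub by blast
        moreover have "U' \<subset> {u \<in> U. f u = \<zero>\<^bsub>S\<^esub>}" using that U'(1) n by (auto simp: quot_def)
        then have "\<delta> U' < \<delta> {u \<in> U. f u = \<zero>\<^bsub>S\<^esub>}" using \<delta> sub U'(1) unfolding strict_rank_def by blast
        ultimately show False by simp
      qed
      have onto: "f ` U = carrier S" if "quot S f" for S f
      proof -
        obtain u where "S \<in> X" "f \<in> lmod_hom R (?M\<lparr>carrier := U\<rparr>) S" "u \<in> U" "f u \<noteq> \<zero>\<^bsub>S\<^esub>"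
          using \<open>quot S f\<close> unfolding quot_def by blast
        then show ?thesis using simple_module_hom_onto[OF X lU, of S f u] by simp
      qed
      have iso: "lmod_iso R S0 S" if t: "quot S0 f0" "quot S f" for S0 f0 S f
      proof -
        have S: "left_module R S0" "left_module R S" "f0 \<in> lmod_hom R (?M\<lparr>carrier := U\<rparr>) S0"
          "f \<in> lmod_hom R (?M\<lparr>carrier := U\<rparr>) S" using t lX by (auto simp: quot_def)
        obtain h where h: "h \<in> lmod_hom R S0 S" "\<forall>u\<in>carrier (?M\<lparr>carrier := U\<rparr>). h (f0 u) = f u"
          using factor_through_surjection[OF lU S(1,2,3) _ S(4)] onto[OF t(1)] ker[OF t(1)] ker[OF t(2)]
          by auto
        have "\<forall>y\<in>carrier S0. h y = \<zero>\<^bsub>S\<^esub> \<longrightarrow> y = \<zero>\<^bsub>S0\<^esub>"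
          unfolding onto[OF t(1), symmetric] using h(2) ker[OF t(1)] ker[OF t(2)] by auto
        then have "inj_on h (carrier S0)" unfolding inj_on_lmod_hom_iff[OF S(1,2) h(1)] .
        moreover have "h ` carrier S0 = carrier S"
          unfolding onto[OF t(1), symmetric] onto[OF t(2), symmetric] using h(2)
          by (auto simp: image_image)
        ultimately show ?thesis using h(1) unfolding lmod_iso_def bij_betw_def by blast
      qed
      define \<F>' where "\<F>' = (if \<exists>S f. quot S f then insert (SOME S. \<exists>f. quot S f) \<F> else \<F>)"
      have some: "\<exists>f. quot (SOME S. \<exists>f. quot S f) f" if "quot S f" for S f
        by (rule someI_ex) (use that in blast)
      have 1: "finite \<F>' \<and> \<F>' \<subseteq> X" using \<F>(1,2) some by (auto simp: \<F>'_def quot_def)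
      have "\<exists>S'\<in>\<F>'. lmod_iso R S' S"
        if S: "S \<in> X" "f \<in> lmod_hom R (?M\<lparr>carrier := U\<rparr>) S" "\<exists>u\<in>U. f u \<noteq> \<zero>\<^bsub>S\<^esub>" for S f
      proof (cases "\<exists>u\<in>U'. f u \<noteq> \<zero>\<^bsub>S\<^esub>")
        case True
        have "f \<in> lmod_hom R (?M\<lparr>carrier := U'\<rparr>) S" 
          using lmod_hom_restrict[OF lU _ S(2), of U'] submodule_of_submodule[OF M less.prems] U'(1) by auto
        then have "\<exists>S'\<in>\<F>. lmod_iso R S' S" using \<F>(3) S(1) True by blast
        then show ?thesis by (auto simp: \<F>'_def)
      next
        case False
        then have t: "quot S f" using S by (auto simp: quot_def)
        then obtain f0 where "quot (SOME S. \<exists>f. quot S f) f0" using some by blast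
        then have "lmod_iso R (SOME S. \<exists>f. quot S f) S" using iso t by blast
        then show ?thesis using t by (auto simp: \<F>'_def)
      qed
      then show ?thesis using 1 by blast
    qed
  qed
  obtain \<F> where \<F>: "finite \<F>" "\<F> \<subseteq> X"
    "\<And>S f. S \<in> X \<Longrightarrow> f \<in> lmod_hom R ?M S \<Longrightarrow> \<exists>u\<in>carrier R. f u \<noteq> \<zero>\<^bsub>S\<^esub> \<Longrightarrow> \<exists>S'\<in>\<F>. lmod_iso R S' S"
  proof -
    have "?M\<lparr>carrier := carrier R\<rparr> = ?M" by (simp add: regular_module_def)
    then show ?thesis
      using main[OF submodule_carrier[OF M], unfolded regular_module_simps] that by (simp only:) metis
  qed
  have "\<exists>S'\<in>\<F>. lmod_iso R S' S" if S: "S \<in> X" for S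
  proof -
    obtain x where x: "x \<in> carrier S" "x \<noteq> \<zero>\<^bsub>S\<^esub>" using simple_module_nonzero[OF X[OF S]] .
    obtain u where u: "u \<in> carrier R" "x = u \<odot>\<^bsub>S\<^esub> x"
      using submodule_orbit(2)[OF lX[OF S] x(1)] by blast
    have "\<exists>u\<in>carrier R. u \<odot>\<^bsub>S\<^esub> x \<noteq> \<zero>\<^bsub>S\<^esub>" by (rule bexI[OF _ u(1)]) (simp add: x(2) flip: u(2))
    then show ?thesis using \<F>(3)[OF S lmod_hom_orbit[OF lX[OF S] x(1)]] by blast
  qed
  then show thesis using that \<F>(1,2) by blast
qed

section \<open>Splitting off a projective summand\<close>

text \<open>Among the idempotent endomorphisms of \<open>N\<close> that are stably the identity take one with
  image \<open>H\<close> of least rank. A projective direct summand of \<open>H\<close> could be killed by a further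
  idempotent that is still stably the identity, so there is none but zero.\<close>
lemma (in frobenius_universe) projective_free_summand:
  fixes N :: "('a, 'm) module" (structure)
  assumes N: "left_module R N" and fl: "finite_length R N"
  obtains H where "direct_summand R N H" "projective_free R (N\<lparr>carrier := H\<rparr>)"
    "stable_retract R N (N\<lparr>carrier := H\<rparr>)"
proof -
  interpret N: left_module R N by fact
  obtain \<delta> where \<delta>: "strict_rank R N \<delta>" using fl unfolding finite_length_def by blast
  define good where "good \<pi> \<longleftrightarrow> \<pi> \<in> lmod_hom R N N \<and> (\<forall>x\<in>carrier N. \<pi> (\<pi> x) = \<pi> x) \<and>
    stably_zero R N N (\<lambda>x. \<pi> x \<ominus> x)" for \<pi>
  have "stably_zero R N N (\<lambda>x. id x \<ominus> x)" by (rule stably_zero_null[OF N N]) (simp add: N.minus_eq_zero_iff)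
  then have "good id" by (simp add: good_def lmod_hom_id)
  then obtain \<pi> where "good \<pi>" and min: "\<And>\<tau>. good \<tau> \<Longrightarrow> \<delta> (\<pi> ` carrier N) \<le> \<delta> (\<tau> ` carrier N)"
    using ex_has_least_nat[of good id "\<lambda>\<pi>. \<delta> (\<pi> ` carrier N)"] by blast
  then have \<pi>: "\<pi> \<in> lmod_hom R N N" "\<And>x. x \<in> carrier N \<Longrightarrow> \<pi> (\<pi> x) = \<pi> x"
    "stably_zero R N N (\<lambda>x. \<pi> x \<ominus> x)" by (simp_all add: good_def)
  have cl: "\<pi> x \<in> carrier N" if "x \<in> carrier N" for x using lmod_hom_closed[OF \<pi>(1) that] .
  define H where "H = \<pi> ` carrier N"
  have H: "submodule H R N" unfolding H_def by (rule submodule_image[OF N N \<pi>(1) submodule_carrier[OF N]])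
  have lH: "left_module R (N\<lparr>carrier := H\<rparr>)" by (rule left_module_submodule[OF N H])
  have HN: "x \<in> carrier N" "\<pi> x = x" if "x \<in> H" for x using that \<pi>(2) cl by (auto simp: H_def)
  have \<pi>H: "\<pi> \<in> lmod_hom R N (N\<lparr>carrier := H\<rparr>)" by (rule lmod_hom_corestrict[OF \<pi>(1)]) (simp add: H_def)
  have "D = {\<zero>}"
    if ds: "direct_summand R (N\<lparr>carrier := H\<rparr>) D" and pD: "projective_module R (N\<lparr>carrier := D\<rparr>)" for D
  proof -
    obtain D' where D: "submodule D R (N\<lparr>carrier := H\<rparr>)" "submodule D' R (N\<lparr>carrier := H\<rparr>)"
      and int: "D \<inter> D' = {\<zero>}" and sum: "D <+>\<^bsub>N\<lparr>carrier := H\<rparr>\<^esub> D' = H"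
      using ds unfolding direct_summand_def by auto
    have D': "submodule D R N" "D \<subseteq> H" using D submodule_of_submodule[OF N H] by blast+
    obtain p where p: "p \<in> lmod_hom R (N\<lparr>carrier := H\<rparr>) (N\<lparr>carrier := H\<rparr>)" "\<forall>x\<in>H. p x \<in> D"
      "\<forall>x\<in>H. x \<ominus>\<^bsub>N\<lparr>carrier := H\<rparr>\<^esub> p x \<in> D'" "\<forall>x\<in>D. p x = x" "\<forall>x\<in>D'. p x = \<zero>"
      using complement_projection[OF lH D] int sum by auto
    \<comment> \<open>The idempotent with image \<open>D'\<close>, killing \<open>D\<close> as well as the kernel of \<open>\<pi>\<close>.\<close>
    let ?\<tau> = "\<lambda>x. \<pi> x \<ominus> p (\<pi> x)"
    have p\<pi>: "p \<circ> \<pi> \<in> lmod_hom R N (N\<lparr>carrier := H\<rparr>)" by (rule lmod_hom_comp[OF p(1) \<pi>H])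
    have p\<pi>D: "p \<circ> \<pi> \<in> lmod_hom R N (N\<lparr>carrier := D\<rparr>)"
      using lmod_hom_corestrict[OF p\<pi>, of D] p(2) by (simp add: H_def)
    have p\<pi>N: "p \<circ> \<pi> \<in> lmod_hom R N N"
      using lmod_hom_comp[OF lmod_hom_inclusion[OF N H] p\<pi>] by simp
    have \<tau>: "?\<tau> \<in> lmod_hom R N N" using lmod_hom_diff[OF N \<pi>(1) p\<pi>N] by simp
    have \<tau>D': "?\<tau> x \<in> D'" if "x \<in> carrier N" for x
    proof -
      have x: "\<pi> x \<in> H" "p (\<pi> x) \<in> H" using that p(2) D'(2) by (auto simp: H_def)
      have "\<pi> x \<ominus>\<^bsub>N\<lparr>carrier := H\<rparr>\<^esub> p (\<pi> x) \<in> D'" using p(3) x(1) by blast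
      then show ?thesis
        using lmod_hom_minus[OF lH N lmod_hom_inclusion[OF N H], of "\<pi> x" "p (\<pi> x)"] x
        by (simp only: id_apply) simp
    qed
    have D'H: "D' \<subseteq> H" using D submodule_of_submodule[OF N H] by blast
    have "?\<tau> (?\<tau> x) = ?\<tau> x" if "x \<in> carrier N" for x
    proof -
      have y: "?\<tau> x \<in> D'" "?\<tau> x \<in> H" using \<tau>D'[OF that] D'H by blast+
      have "\<pi> (?\<tau> x) = ?\<tau> x" "p (?\<tau> x) = \<zero>" using HN(2)[OF y(2)] p(5) y(1) by blast+
      then show ?thesis using HN(1)[OF y(2)] by (simp add: a_minus_def)
    qed
    moreover have "stably_zero R N N (\<lambda>x. ?\<tau> x \<ominus> x)"
    proof -
      have "stably_zero R N N (p \<circ> \<pi>)"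
        by (rule stably_zeroI[OF pD p\<pi>D lmod_hom_inclusion[OF N D'(1)]]) simp
      from stably_zero_diff[OF N N \<pi>(3) this] show ?thesis
        by (rule stably_zero_cong) (use cl lmod_hom_closed[OF p\<pi>N] in \<open>simp add: a_minus_def N.a_ac\<close>)
    qed
    ultimately have "good ?\<tau>" using \<tau> by (simp add: good_def)
    then have "\<not> \<delta> (?\<tau> ` carrier N) < \<delta> H" using min[of ?\<tau>] unfolding H_def by simp
    moreover have "submodule (?\<tau> ` carrier N) R N"
      by (rule submodule_image[OF N N \<tau> submodule_carrier[OF N]])
    ultimately have "\<not> ?\<tau> ` carrier N \<subset> H" using \<delta> H unfolding strict_rank_def by blast
    moreover have im: "?\<tau> ` carrier N \<subseteq> D'" using \<tau>D' by (rule image_subsetI)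
    ultimately have "H \<subseteq> D'" using D'H by blast
    then show ?thesis using int D'(2) by blast
  qed
  then have pf: "projective_free R (N\<lparr>carrier := H\<rparr>)"
    unfolding projective_free_def using lH by simp
  have "direct_summand R N H"
    unfolding direct_summand_def
  proof (intro conjI exI H)
    let ?H' = "{x \<in> carrier N. \<pi> x = \<zero>}"
    show H': "submodule ?H' R N" by (rule submodule_kernel[OF N N \<pi>(1)])
    show "H \<inter> ?H' = {\<zero>}" using HN(2) submoduleD(2)[OF N H] submoduleD(2)[OF N H'] by force
    show "H <+>\<^bsub>N\<^esub> ?H' = carrier N"
    proof
      show "H <+>\<^bsub>N\<^esub> ?H' \<subseteq> carrier N" by (rule submoduleD(1)[OF N submodule_sum(1)[OF N H H']])
      show "carrier N \<subseteq> H <+>\<^bsub>N\<^esub> ?H'"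
      proof
        fix x assume x: "x \<in> carrier N"
        have "x = \<pi> x \<oplus> (x \<ominus> \<pi> x)" using x cl by (simp add: a_minus_def N.a_lcomm N.r_neg)
        moreover have "x \<ominus> \<pi> x \<in> ?H'"
          using x cl \<pi>(2) by (simp add: lmod_hom_minus[OF N N \<pi>(1)] N.minus_eq_zero_iff)
        moreover have "\<pi> x \<in> H" using x by (simp add: H_def)
        ultimately show "x \<in> H <+>\<^bsub>N\<^esub> ?H'" unfolding set_add_def' by blast
      qed
    qed
  qed
  moreover have "stably_eq R N N (id \<circ> \<pi>) id" using \<pi>(3) by (simp add: stably_eq_def)
  then have "stable_retract R N (N\<lparr>carrier := H\<rparr>)"
    unfolding stable_retract_def using N lH \<pi>H lmod_hom_inclusion[OF N H] by blast
  ultimately show thesis using that pf by blast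
qed

lemma set_add_update [simp]: "A <+>\<^bsub>M\<lparr>carrier := H\<rparr>\<^esub> B = A <+>\<^bsub>M\<^esub> B"
  by (simp add: set_add_def')

section \<open>A uniform bound from the simple modules\<close>

text \<open>Choose \<open>N \<le> M\<close> maximal among the submodules of ghost length at most \<open>m\<close>. A simple
  submodule outside \<open>N\<close> would form a direct sum with \<open>N\<close>, again of ghost length at most \<open>m\<close>;
  so \<open>N\<close> contains every simple submodule. Each nonzero cyclic module \<open>Rx\<close> meets such a
  submodule, whence the annihilator of the image of \<open>x\<close> in \<open>M/N\<close> is strictly larger than
  that of \<open>x\<close>. Since annihilators are left ideals of \<open>R\<close>, this can happen at most \<open>\<rho>
  (carrier R)\<close> times in succession, however large \<open>M\<close> is. The number \<open>d\<close> counts the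
  remaining steps, each of which costs \<open>m\<close> by subadditivity on extensions.\<close>
lemma (in ghost_setting) ghost_length_le_by_annihilators:
  fixes M :: "('a, 'm) module"
  assumes \<rho>: "strict_rank R (regular_module R) \<rho>"
    and simple: "\<And>S :: ('a, 'm) module. simple_module R S \<Longrightarrow> \<forall>x\<in>carrier S. e \<odot>\<^bsub>S\<^esub> x = x \<Longrightarrow> ghost_length_le m S"
    and M: "left_module R M" "finite_length R M" "\<forall>x\<in>carrier M. e \<odot>\<^bsub>M\<^esub> x = x"
    and d: "\<forall>x\<in>carrier M. \<rho> (carrier R) \<le> \<rho> (annihilator R M x) + d"
  shows "ghost_length_le (d * m) M"
  using M d
proof (induction d arbitrary: M)
  case 0
  interpret M: left_module R M by (rule 0)
  have "x = \<zero>\<^bsub>M\<^esub>" if x: "x \<in> carrier M" for x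
  proof -
    have "\<not> annihilator R M x \<subset> carrier R"
      using \<rho> submodule_annihilator[OF 0(1) x] submodule_carrier[OF left_module_regular[OF M.R.ring_axioms]]
        0(4) x unfolding strict_rank_def by (metis add.right_neutral leD regular_module_simps(1))
    then have "\<one>\<^bsub>R\<^esub> \<in> annihilator R M x" unfolding annihilator_def by auto
    then show ?thesis using M.smult_one[OF x] by (simp add: annihilator_def)
  qed
  then have "carrier M = {\<zero>\<^bsub>M\<^esub>}" using M.M.zero_closed by blast
  then show ?case using ghost_length_le_zero[OF 0(1)] by simp
next
  case (Suc d)
  note M = Suc.prems(1)
  interpret M: left_module R M by (rule M)
  have fl: "finite_length R (regular_module R)" using \<rho> unfolding finite_length_def by blast
  obtain \<delta> where \<delta>: "strict_rank R M \<delta>" using Suc.prems(2) unfolding finite_length_def by blast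
  let ?P = "\<lambda>N. submodule N R M \<and> ghost_length_le m (M\<lparr>carrier := N\<rparr>)"
  have "ghost_length_le 0 (M\<lparr>carrier := {\<zero>\<^bsub>M\<^esub>}\<rparr>)"
    by (rule ghost_length_le_zero) (simp_all add: left_module_submodule submodule_zero M)
  then have P0: "?P {\<zero>\<^bsub>M\<^esub>}" using submodule_zero[OF M] ghost_length_le_mono by blast
  have bd: "\<delta> N \<le> \<delta> (carrier M)" if "submodule N R M" for N
    using \<delta> that submodule_carrier[OF M] submoduleD(1)[OF M that] unfolding strict_rank_def
    by (metis less_imp_le order_refl psubsetI)
  have "\<exists>N. ?P N \<and> (\<forall>H. ?P H \<longrightarrow> \<delta> H \<le> \<delta> N)"
    by (rule ex_has_greatest_nat[where P = ?P and f = \<delta> and k = "{\<zero>\<^bsub>M\<^esub>}" and b = "Suc (\<delta> (carrier M))", OF P0])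
      (use bd in \<open>simp add: less_Suc_eq_le\<close>)
  then obtain N where N: "?P N" "\<forall>H. ?P H \<longrightarrow> \<delta> H \<le> \<delta> N" by blast
  have soc: "L \<subseteq> N" if L: "submodule L R M" "simple_module R (M\<lparr>carrier := L\<rparr>)" for L
  proof (rule ccontr)
    assume nsub: "\<not> L \<subseteq> N"
    have "submodule (N \<inter> L) R (M\<lparr>carrier := L\<rparr>)"
      unfolding submodule_of_submodule[OF M L(1)] using submodule_Int[OF M _ L(1)] N(1) by blast
    then have int: "N \<inter> L = {\<zero>\<^bsub>M\<^esub>}" using L(2) nsub unfolding simple_module_def by auto
    let ?E = "N <+>\<^bsub>M\<^esub> L"
    note E = submodule_sum[OF M conjunct1[OF N(1)] L(1)]
    have "\<forall>x\<in>carrier (M\<lparr>carrier := L\<rparr>). e \<odot>\<^bsub>M\<lparr>carrier := L\<rparr>\<^esub> x = x"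
      using Suc.prems(3) submoduleD(1)[OF M L(1)] by auto
    then have gL: "ghost_length_le m (M\<lparr>carrier := L\<rparr>)" by (rule simple[OF L(2)])
    have "ghost_length_le m (M\<lparr>carrier := ?E\<rparr>)"
    proof (rule ghost_length_le_direct_sum[OF left_module_submodule[OF M E(1)], of N L])
      show "submodule N R (M\<lparr>carrier := ?E\<rparr>)" "submodule L R (M\<lparr>carrier := ?E\<rparr>)"
        unfolding submodule_of_submodule[OF M E(1)] using E N(1) L(1) by auto
    qed (use N(1) gL int in simp_all)
    then have "\<delta> ?E \<le> \<delta> N" using N(2) E(1) by blast
    moreover have "N \<subset> ?E" using E(2,3) nsub by blast
    then have "\<delta> N < \<delta> ?E" using \<delta> N(1) E(1) unfolding strict_rank_def by blast
    ultimately show False by simp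
  qed
  obtain C :: "('a, 'm) module" and q where ses: "short_exact R (M\<lparr>carrier := N\<rparr>) id M q C"
    and eC: "\<forall>a. (\<forall>x\<in>carrier M. a \<odot>\<^bsub>M\<^esub> x = x) \<longrightarrow> (\<forall>x\<in>carrier C. a \<odot>\<^bsub>C\<^esub> x = x)"
    by (rule short_exact_quotient[OF left_module_submodule[OF M] M lmod_hom_inclusion[OF M]])
      (use N(1) in auto)
  note S = short_exactD[OF ses]
  have "ghost_length_le (d * m) C"
  proof (rule Suc.IH[OF S(3)])
    show "finite_length R C" by (rule finite_length_image[OF S(2,3,5,7) Suc.prems(2)])
    show "\<forall>x\<in>carrier C. e \<odot>\<^bsub>C\<^esub> x = x" using eC Suc.prems(3) by blast
    show "\<forall>y\<in>carrier C. \<rho> (carrier R) \<le> \<rho> (annihilator R C y) + d"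
    proof
      fix y assume "y \<in> carrier C"
      then have "y \<in> q ` carrier M" by (simp add: S(7))
      then obtain x where x: "x \<in> carrier M" "y = q x" by blast
      have yC: "y \<in> carrier C" by fact
      show "\<rho> (carrier R) \<le> \<rho> (annihilator R C y) + d"
      proof (cases "x = \<zero>\<^bsub>M\<^esub>")
        case True
        then have "y = \<zero>\<^bsub>C\<^esub>" using x lmod_hom_zero[OF S(2,3,5)] by simp
        then have "annihilator R C y = carrier R"
          unfolding annihilator_def using left_module_smult_zero[OF S(3)] by auto
        then show ?thesis by simp
      next
        case False
        obtain L where L: "submodule L R M" "simple_module R (M\<lparr>carrier := L\<rparr>)"
          "L \<subseteq> (\<lambda>a. a \<odot>\<^bsub>M\<^esub> x) ` carrier R"
          by (rule simple_submodule_of_cyclic[OF M fl x(1) False])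
        obtain l where l: "l \<in> L" "l \<noteq> \<zero>\<^bsub>M\<^esub>" using simple_module_nonzero[OF L(2)] by auto
        then obtain a where a: "a \<in> carrier R" "l = a \<odot>\<^bsub>M\<^esub> x" using L(3) by blast
        have "l \<in> N" using soc[OF L(1,2)] l(1) by blast
        then have "q l = \<zero>\<^bsub>C\<^esub>" using S(8)[of l] by simp
        then have "a \<in> annihilator R C y" using a x by (simp add: annihilator_def lmod_hom_smult[OF S(5)])
        moreover have "a \<notin> annihilator R M x" using a l by (simp add: annihilator_def)
        moreover have "annihilator R M x \<subseteq> annihilator R C y"
        proof
          fix b assume b: "b \<in> annihilator R M x"
          then have "b \<in> carrier R" by (simp add: annihilator_def)
          then have "b \<odot>\<^bsub>C\<^esub> y = q (b \<odot>\<^bsub>M\<^esub> x)" by (simp only: x(2) lmod_hom_smult[OF S(5) _ x(1)])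
          also have "\<dots> = \<zero>\<^bsub>C\<^esub>" using b lmod_hom_zero[OF S(2,3,5)] by (simp add: annihilator_def)
          finally show "b \<in> annihilator R C y" using b by (simp add: annihilator_def)
        qed
        ultimately have "annihilator R M x \<subset> annihilator R C y" by blast
        then have "\<rho> (annihilator R M x) < \<rho> (annihilator R C y)"
          using \<rho> submodule_annihilator[OF M x(1)] submodule_annihilator[OF S(3) yC]
          unfolding strict_rank_def by blast
        then show ?thesis using Suc.prems(4) x(1) by fastforce
      qed
    qed
  qed
  then have "ghost_length_le (m + d * m) M"
    using ghost_length_le_extension[OF ses] N(1) by blast
  then show ?case by simp
qed

section \<open>Linear algebra over a field\<close>

lemma additive_map_finsum:
  assumes "abelian_group M" "abelian_group N" "f \<in> carrier M \<rightarrow> carrier N"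
    and add: "\<And>x y. x \<in> carrier M \<Longrightarrow> y \<in> carrier M \<Longrightarrow> f (x \<oplus>\<^bsub>M\<^esub> y) = f x \<oplus>\<^bsub>N\<^esub> f y"
    and "finite A" "F \<in> A \<rightarrow> carrier M"
  shows "f (\<Oplus>\<^bsub>M\<^esub>i\<in>A. F i) = (\<Oplus>\<^bsub>N\<^esub>i\<in>A. f (F i))"
proof -
  interpret M: abelian_group M by fact
  interpret N: abelian_group N by fact
  have cl: "f x \<in> carrier N" if "x \<in> carrier M" for x using assms(3) that by auto
  have "f \<zero>\<^bsub>M\<^esub> \<oplus>\<^bsub>N\<^esub> f \<zero>\<^bsub>M\<^esub> = f \<zero>\<^bsub>M\<^esub>" using add[of "\<zero>\<^bsub>M\<^esub>" "\<zero>\<^bsub>M\<^esub>"] by simp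
  then have zero: "f \<zero>\<^bsub>M\<^esub> = \<zero>\<^bsub>N\<^esub>" using cl[of "\<zero>\<^bsub>M\<^esub>"] by simp
  show ?thesis
    using assms(5,6)
  proof (induction A rule: finite_induct)
    case empty
    then show ?case using zero by simp
  next
    case (insert x A)
    have "F \<in> A \<rightarrow> carrier M" "F x \<in> carrier M" using insert.prems by auto
    moreover have "(\<lambda>i. f (F i)) \<in> A \<rightarrow> carrier N" using calculation(1) cl by auto
    ultimately show ?case using insert by (simp add: add cl)
  qed
qed

text \<open>A maximal subspace meeting \<open>A\<close> trivially is a complement: a vector \<open>v\<close> outside \<open>A + B\<close>
  could be adjoined to \<open>B\<close>, since scalars are invertible.\<close>
lemma subspace_complement:
  fixes V :: "('k, 'm) module" (structure)
  assumes "field K" and V: "left_module K V" and A: "submodule A K V"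
  obtains B where "submodule B K V" "A \<inter> B = {\<zero>}" "A <+>\<^bsub>V\<^esub> B = carrier V"
proof -
  interpret K: field K by fact
  interpret V: left_module K V by fact
  note Ad = submoduleD[OF V A]
  let ?S = "{B. submodule B K V \<and> A \<inter> B = {\<zero>}}"
  have "\<exists>B\<in>?S. \<forall>X\<in>?S. B \<subseteq> X \<longrightarrow> X = B"
  proof (rule subset_Zorn_nonempty)
    show "?S \<noteq> {}" using submodule_zero[OF V] Ad(2) by blast
    fix C assume C: "C \<noteq> {}" "subset.chain ?S C"
    then have CS: "C \<subseteq> ?S" by (auto simp: subset_chain_def)
    have dir: "\<exists>Z\<in>C. X \<subseteq> Z \<and> Y \<subseteq> Z" if XY: "X \<in> C" "Y \<in> C" for X Y
    proof -
      have "\<forall>X\<in>C. \<forall>Y\<in>C. X \<subseteq> Y \<or> Y \<subseteq> X" using C(2) by (simp add: subset_chain_def)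
      then have "X \<subseteq> Y \<or> Y \<subseteq> X" using XY by simp
      then show ?thesis using XY by auto
    qed
    have sub: "submodule X K V" if "X \<in> C" for X using CS that by blast
    have "submodule (\<Union>C) K V"
    proof (rule submoduleI[OF V])
      show "\<Union>C \<subseteq> carrier V" using submoduleD(1)[OF V sub] by blast
      show "\<zero> \<in> \<Union>C" using submoduleD(2)[OF V sub] C(1) by blast
      show "x \<oplus> y \<in> \<Union>C" if xy: "x \<in> \<Union>C" "y \<in> \<Union>C" for x y
      proof -
        obtain X Y where "X \<in> C" "Y \<in> C" "x \<in> X" "y \<in> Y" using xy by blast
        then obtain Z where Z: "Z \<in> C" "x \<in> Z" "y \<in> Z" using dir by blast
        then show ?thesis using submoduleD(3)[OF V sub[OF Z(1)] Z(2,3)] by blast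
      qed
      show "a \<odot> x \<in> \<Union>C" if "a \<in> carrier K" "x \<in> \<Union>C" for a x
        using submoduleD(6)[OF V sub that(1)] that(2) by blast
    qed
    moreover have "A \<inter> \<Union>C = {\<zero>}" using C(1) CS by blast
    ultimately show "\<Union>C \<in> ?S" by blast
  qed
  then obtain B where BS: "B \<in> ?S" and BX: "\<forall>X\<in>?S. B \<subseteq> X \<longrightarrow> X = B" by (rule bexE)
  have B: "submodule B K V" "A \<inter> B = {\<zero>}" using BS by simp_all
  have max: "X = B" if "submodule X K V" "A \<inter> X = {\<zero>}" "B \<subseteq> X" for X
    using BX that by simp
  note Bd = submoduleD[OF V B(1)] and AB = submodule_sum[OF V A B(1)]
  note ABd = submoduleD[OF V AB(1)]
  have "v \<in> A <+>\<^bsub>V\<^esub> B" if v: "v \<in> carrier V" for v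
  proof (rule ccontr)
    assume nv: "v \<notin> A <+>\<^bsub>V\<^esub> B"
    let ?Kv = "(\<lambda>c. c \<odot> v) ` carrier K"
    note Kv = submodule_orbit[OF V v] and BK = submodule_sum[OF V B(1) submodule_orbit(1)[OF V v]]
    have "x = \<zero>" if x: "x \<in> A" "x \<in> B <+>\<^bsub>V\<^esub> ?Kv" for x
    proof -
      obtain b c where bc: "b \<in> B" "c \<in> carrier K" "x = b \<oplus> c \<odot> v"
        using x(2) unfolding set_add_def' by blast
      have cl: "b \<in> carrier V" "c \<odot> v \<in> carrier V"
        using bc(1) Bd(1) V.smult_closed[OF bc(2) v] by auto
      have "c = \<zero>\<^bsub>K\<^esub>"
      proof (rule ccontr)
        assume "c \<noteq> \<zero>\<^bsub>K\<^esub>"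
        then have u: "c \<in> Units K" using bc(2) K.field_Units by blast
        have "c \<odot> v = \<ominus> b \<oplus> x" using cl by (simp add: bc(3) V.r_neg1)
        then have "c \<odot> v \<in> A <+>\<^bsub>V\<^esub> B"
          using ABd(3)[of "\<ominus> b" x] AB(2,3) x(1) Bd(4)[OF bc(1)] by auto
        then have "inv\<^bsub>K\<^esub> c \<odot> (c \<odot> v) \<in> A <+>\<^bsub>V\<^esub> B"
          using ABd(6) K.Units_inv_closed[OF u] by blast
        moreover have "inv\<^bsub>K\<^esub> c \<odot> (c \<odot> v) = v"
          using v bc(2) u K.Units_inv_closed[OF u]
          by (simp add: V.smult_assoc[symmetric] K.Units_l_inv V.smult_one)
        ultimately show False using nv by simp
      qed
      then have "x = b" using bc(3) cl left_module_zero_smult[OF V v] by simp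
      then show ?thesis using B(2) x(1) bc(1) by blast
    qed
    then have "A \<inter> (B <+>\<^bsub>V\<^esub> ?Kv) = {\<zero>}" using Ad(2) submoduleD(2)[OF V BK(1)] by blast
    then have "B <+>\<^bsub>V\<^esub> ?Kv = B" using max[OF BK(1)] BK(2) by blast
    then have "v \<in> B" using BK(3) Kv(2) by blast
    then show False using nv AB(3) by blast
  qed
  then have "A <+>\<^bsub>V\<^esub> B = carrier V" using ABd(1) by blast
  then show thesis using that B by blast
qed

lemma linear_section:
  fixes V W :: "('k, 'm) module"
  assumes "field K" "left_module K V" "left_module K W" "q \<in> lmod_hom K V W" "q ` carrier V = carrier W"
  obtains \<sigma> where "\<sigma> \<in> lmod_hom K W V" "\<forall>x\<in>carrier W. q (\<sigma> x) = x"
proof -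
  interpret V: left_module K V by fact
  interpret W: left_module K W by fact
  note ker = submodule_kernel[OF assms(2-4)]
  obtain B where B: "submodule B K V" "{x \<in> carrier V. q x = \<zero>\<^bsub>W\<^esub>} \<inter> B = {\<zero>\<^bsub>V\<^esub>}"
    "{x \<in> carrier V. q x = \<zero>\<^bsub>W\<^esub>} <+>\<^bsub>V\<^esub> B = carrier V"
    by (rule subspace_complement[OF assms(1,2) ker])
  obtain \<pi> where \<pi>: "\<pi> \<in> lmod_hom K V V" "\<forall>x\<in>carrier V. \<pi> x \<in> {x \<in> carrier V. q x = \<zero>\<^bsub>W\<^esub>}"
    "\<forall>a\<in>{x \<in> carrier V. q x = \<zero>\<^bsub>W\<^esub>}. \<pi> a = a"
    by (rule complement_projection[OF assms(2) ker B])
  have d: "(\<lambda>x. id x \<ominus>\<^bsub>V\<^esub> \<pi> x) \<in> lmod_hom K V V" by (rule lmod_hom_diff[OF assms(2) lmod_hom_id \<pi>(1)])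
  obtain \<sigma> where \<sigma>: "\<sigma> \<in> lmod_hom K W V" "\<forall>x\<in>carrier V. \<sigma> (q x) = id x \<ominus>\<^bsub>V\<^esub> \<pi> x"
    by (rule factor_through_surjection[OF assms(2,3,2,4,5) d]) (use \<pi>(3) in \<open>simp add: V.minus_eq_zero_iff\<close>)
  have "q (\<sigma> y) = y" if "y \<in> carrier W" for y
  proof -
    have "y \<in> q ` carrier V" using that assms(5) by simp
    then obtain x where x: "x \<in> carrier V" "y = q x" by blast
    have "q (\<sigma> y) = q x \<ominus>\<^bsub>W\<^esub> q (\<pi> x)"
      using x \<sigma>(2) lmod_hom_closed[OF \<pi>(1)] by (simp add: lmod_hom_minus[OF assms(2-4)])
    then show ?thesis using x \<pi>(2) lmod_hom_closed[OF assms(4) x(1)] by (simp add: a_minus_def)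
  qed
  then show thesis using that \<sigma>(1) by blast
qed

lemma linear_retraction:
  fixes V W :: "('k, 'm) module"
  assumes "field K" "left_module K V" "left_module K W" "i \<in> lmod_hom K V W" "inj_on i (carrier V)"
  obtains r where "r \<in> lmod_hom K W V" "\<forall>x\<in>carrier V. r (i x) = x"
proof -
  note im = submodule_image[OF assms(2-4) submodule_carrier[OF assms(2)]]
  obtain B where B: "submodule B K W" "i ` carrier V \<inter> B = {\<zero>\<^bsub>W\<^esub>}" "i ` carrier V <+>\<^bsub>W\<^esub> B = carrier W"
    by (rule subspace_complement[OF assms(1,3) im])
  obtain \<pi> where \<pi>: "\<pi> \<in> lmod_hom K W W" "\<forall>x\<in>carrier W. \<pi> x \<in> i ` carrier V" "\<forall>a\<in>i ` carrier V. \<pi> a = a"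
    by (rule complement_projection[OF assms(3) im B])
  obtain r where r: "r \<in> lmod_hom K W V" "\<forall>x\<in>carrier W. i (r x) = \<pi> x"
    by (rule lift_through_injection[OF assms(2,3,4,5) \<pi>(1)]) (use \<pi>(2) in simp)
  have "r (i x) = x" if x: "x \<in> carrier V" for x
    using inj_onD[OF assms(5), of "r (i x)" x] r \<pi>(3) x lmod_hom_closed[OF assms(4) x] lmod_hom_closed[OF r(1)]
    by simp
  then show thesis using that r(1) by blast
qed

section \<open>Group algebras over a field\<close>

locale finite_group_algebra = K: field K + G: group G
    for K :: "('k, 'r) ring_scheme" and G :: "('g, 's) monoid_scheme" (structure) +
  assumes fin: "finite (carrier G)"
begin

abbreviation KG :: "('g \<Rightarrow> 'k) ring" where "KG \<equiv> group_algebra K G"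

text \<open>The element \<open>c \<cdot> g\<close> of the group algebra; \<open>single c \<one>\<close> is the scalar \<open>c\<close>.\<close>
definition single :: "'k \<Rightarrow> 'g \<Rightarrow> 'g \<Rightarrow> 'k" where
  "single c g = (\<lambda>x\<in>carrier G. if x = g then c else \<zero>\<^bsub>K\<^esub>)"

lemma KG_simps:
  "carrier KG = carrier G \<rightarrow>\<^sub>E carrier K"
  "\<one>\<^bsub>KG\<^esub> = single \<one>\<^bsub>K\<^esub> \<one>"
  "\<zero>\<^bsub>KG\<^esub> = (\<lambda>x\<in>carrier G. \<zero>\<^bsub>K\<^esub>)"
  "a \<oplus>\<^bsub>KG\<^esub> b = (\<lambda>x\<in>carrier G. a x \<oplus>\<^bsub>K\<^esub> b x)"
  by (simp_all add: group_algebra_def single_def)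

lemma KG_mult:
  "a \<otimes>\<^bsub>KG\<^esub> b = (\<lambda>x\<in>carrier G. \<Oplus>\<^bsub>K\<^esub>y\<in>carrier G. a y \<otimes>\<^bsub>K\<^esub> b (inv y \<otimes> x))"
  by (simp add: group_algebra_def)

lemma KG_val: "a \<in> carrier KG \<Longrightarrow> x \<in> carrier G \<Longrightarrow> a x \<in> carrier K"
  by (auto simp: KG_simps)

lemma KG_ext: "a \<in> carrier KG \<Longrightarrow> b \<in> carrier KG \<Longrightarrow> (\<And>x. x \<in> carrier G \<Longrightarrow> a x = b x) \<Longrightarrow> a = b"
  unfolding KG_simps by (rule PiE_ext)

lemma single_closed [simp]: "c \<in> carrier K \<Longrightarrow> single c g \<in> carrier KG"
  by (auto simp: single_def KG_simps)

lemma single_app: "x \<in> carrier G \<Longrightarrow> single c g x = (if x = g then c else \<zero>\<^bsub>K\<^esub>)"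
  by (simp add: single_def)

lemma single_mult_app:
  assumes "c \<in> carrier K" "g \<in> carrier G" "b \<in> carrier KG" "x \<in> carrier G"
  shows "(single c g \<otimes>\<^bsub>KG\<^esub> b) x = c \<otimes>\<^bsub>K\<^esub> b (inv g \<otimes> x)"
proof -
  have b: "b (inv y \<otimes> x) \<in> carrier K" if "y \<in> carrier G" for y
    using assms(3,4) that by (simp add: KG_val)
  have "(\<Oplus>\<^bsub>K\<^esub>y\<in>carrier G. single c g y \<otimes>\<^bsub>K\<^esub> b (inv y \<otimes> x)) =
      (\<Oplus>\<^bsub>K\<^esub>y\<in>carrier G. if y = g then c \<otimes>\<^bsub>K\<^esub> b (inv y \<otimes> x) else \<zero>\<^bsub>K\<^esub>)"
    by (rule K.finsum_cong') (auto simp: single_app b assms(1))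
  also have "\<dots> = c \<otimes>\<^bsub>K\<^esub> b (inv g \<otimes> x)"
    by (rule K.add.finprod_singleton_swap[OF assms(2) fin]) (simp add: b assms(1))
  finally show ?thesis using assms(4) by (simp add: KG_mult)
qed

lemma mult_single_app:
  assumes "c \<in> carrier K" "g \<in> carrier G" "b \<in> carrier KG" "x \<in> carrier G"
  shows "(b \<otimes>\<^bsub>KG\<^esub> single c g) x = b (x \<otimes> inv g) \<otimes>\<^bsub>K\<^esub> c"
proof -
  have eq: "inv y \<otimes> x = g \<longleftrightarrow> y = x \<otimes> inv g" if "y \<in> carrier G" for y
    using that assms(2,4) by (metis G.inv_closed G.inv_solve_left' G.inv_solve_right' G.m_closed)
  have "(\<Oplus>\<^bsub>K\<^esub>y\<in>carrier G. b y \<otimes>\<^bsub>K\<^esub> single c g (inv y \<otimes> x)) =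
      (\<Oplus>\<^bsub>K\<^esub>y\<in>carrier G. if y = x \<otimes> inv g then b y \<otimes>\<^bsub>K\<^esub> c else \<zero>\<^bsub>K\<^esub>)"
    by (rule K.finsum_cong') (auto simp: single_app eq KG_val assms)
  also have "\<dots> = b (x \<otimes> inv g) \<otimes>\<^bsub>K\<^esub> c"
    by (rule K.add.finprod_singleton_swap[OF _ fin]) (auto simp: KG_val assms)
  finally show ?thesis using assms(4) by (simp add: KG_mult)
qed

lemma single_mult:
  assumes "c \<in> carrier K" "d \<in> carrier K" "g \<in> carrier G" "h \<in> carrier G"
  shows "single c g \<otimes>\<^bsub>KG\<^esub> single d h = single (c \<otimes>\<^bsub>K\<^esub> d) (g \<otimes> h)"
proof
  fix x
  have eq: "inv g \<otimes> x = h \<longleftrightarrow> x = g \<otimes> h" if "x \<in> carrier G"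
    using that assms(3,4) by (metis G.inv_closed G.inv_inv G.inv_solve_left')
  show "(single c g \<otimes>\<^bsub>KG\<^esub> single d h) x = single (c \<otimes>\<^bsub>K\<^esub> d) (g \<otimes> h) x"
  proof (cases "x \<in> carrier G")
    case True
    then show ?thesis using assms by (simp add: single_mult_app single_app eq)
  next
    case False
    then show ?thesis by (simp add: KG_mult single_def)
  qed
qed

lemma single_add:
  assumes "c \<in> carrier K" "d \<in> carrier K"
  shows "single (c \<oplus>\<^bsub>K\<^esub> d) g = single c g \<oplus>\<^bsub>KG\<^esub> single d g"
  using assms by (auto simp: single_def KG_simps fun_eq_iff)

lemma KG_induct [consumes 1, case_names zero add single]:
  assumes a: "a \<in> carrier KG"
    and zero: "P \<zero>\<^bsub>KG\<^esub>"
    and add: "\<And>a b. a \<in> carrier KG \<Longrightarrow> b \<in> carrier KG \<Longrightarrow> P a \<Longrightarrow> P b \<Longrightarrow> P (a \<oplus>\<^bsub>KG\<^esub> b)"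
    and single: "\<And>c g. c \<in> carrier K \<Longrightarrow> g \<in> carrier G \<Longrightarrow> P (single c g)"
  shows "P a"
proof -
  have "P a" if "finite A" "A \<subseteq> carrier G" "a \<in> carrier KG" "\<And>x. x \<in> carrier G - A \<Longrightarrow> a x = \<zero>\<^bsub>K\<^esub>" for A a
    using that
  proof (induction A arbitrary: a rule: finite_induct)
    case empty
    then have "a = \<zero>\<^bsub>KG\<^esub>" by (intro KG_ext) (auto simp: KG_simps)
    then show ?case using zero by simp
  next
    case (insert g A)
    have g: "g \<in> carrier G" using insert.prems by simp
    define b where "b = (\<lambda>x\<in>carrier G. if x = g then \<zero>\<^bsub>K\<^esub> else a x)"
    have b: "b \<in> carrier KG" using insert.prems(2) by (auto simp: b_def KG_simps PiE_iff)
    have "P b" using insert.prems by (intro insert.IH b) (auto simp: b_def)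
    moreover have "a = b \<oplus>\<^bsub>KG\<^esub> single (a g) g"
    proof (rule KG_ext[OF insert.prems(2)])
      show "b \<oplus>\<^bsub>KG\<^esub> single (a g) g \<in> carrier KG"
        using b single_closed[OF KG_val[OF insert.prems(2) g], of g] by (auto simp: KG_simps PiE_iff)
      show "a x = (b \<oplus>\<^bsub>KG\<^esub> single (a g) g) x" if "x \<in> carrier G" for x
        using that g by (simp add: KG_simps(4) single_app b_def KG_val[OF insert.prems(2)])
    qed
    ultimately show ?case
      using add[OF b single_closed[OF KG_val[OF insert.prems(2) g]] _ single[OF KG_val[OF insert.prems(2) g] g]]
      by metis
  qed
  from this[OF fin order_refl a] show ?thesis by simp
qed

subsection \<open>The underlying vector space and the group action\<close>

definition restrict_scalars :: "('g \<Rightarrow> 'k, 'm) module \<Rightarrow> ('k, 'm) module" where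
  "restrict_scalars M = \<lparr>carrier = carrier M, mult = mult M, one = one M, zero = zero M, add = add M,
     smult = (\<lambda>c x. single c \<one> \<odot>\<^bsub>M\<^esub> x)\<rparr>"

lemma restrict_scalars_simps [simp]:
  "carrier (restrict_scalars M) = carrier M" "zero (restrict_scalars M) = zero M"
  "add (restrict_scalars M) = add M"
  "c \<odot>\<^bsub>restrict_scalars M\<^esub> x = single c \<one> \<odot>\<^bsub>M\<^esub> x"
  by (simp_all add: restrict_scalars_def)

lemma left_module_restrict_scalars:
  assumes "left_module KG M" shows "left_module K (restrict_scalars M)"
proof -
  interpret M: left_module KG M by fact
  have "abelian_group (restrict_scalars M)"
    by (rule abelian_groupI) (auto simp: M.M.a_ac intro: M.M.l_neg M.M.a_inv_closed)
  moreover have "left_module_axioms K (restrict_scalars M)"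
  proof (rule left_module_axioms.intro; simp)
    show "single a \<one> \<odot>\<^bsub>M\<^esub> x \<in> carrier M" if "a \<in> carrier K" "x \<in> carrier M" for a x
      using that by (simp add: M.smult_closed)
    show "single (a \<oplus>\<^bsub>K\<^esub> b) \<one> \<odot>\<^bsub>M\<^esub> x = single a \<one> \<odot>\<^bsub>M\<^esub> x \<oplus>\<^bsub>M\<^esub> single b \<one> \<odot>\<^bsub>M\<^esub> x"
      if "a \<in> carrier K" "b \<in> carrier K" "x \<in> carrier M" for a b x
      using that by (simp add: single_add M.smult_l_distr)
    show "single a \<one> \<odot>\<^bsub>M\<^esub> (x \<oplus>\<^bsub>M\<^esub> y) = single a \<one> \<odot>\<^bsub>M\<^esub> x \<oplus>\<^bsub>M\<^esub> single a \<one> \<odot>\<^bsub>M\<^esub> y"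
      if "a \<in> carrier K" "x \<in> carrier M" "y \<in> carrier M" for a x y
      using that by (simp add: M.smult_r_distr)
    show "single (a \<otimes>\<^bsub>K\<^esub> b) \<one> \<odot>\<^bsub>M\<^esub> x = single a \<one> \<odot>\<^bsub>M\<^esub> (single b \<one> \<odot>\<^bsub>M\<^esub> x)"
      if "a \<in> carrier K" "b \<in> carrier K" "x \<in> carrier M" for a b x
      using that by (simp add: M.smult_assoc[symmetric] single_mult)
    show "single \<one>\<^bsub>K\<^esub> \<one> \<odot>\<^bsub>M\<^esub> x = x" if "x \<in> carrier M" for x
      using that M.smult_one by (simp add: KG_simps(2))
  qed
  ultimately show ?thesis using K.ring_axioms by (simp add: left_module_def)
qed

definition linear_maps :: "('g \<Rightarrow> 'k, 'm) module \<Rightarrow> ('g \<Rightarrow> 'k, 'n) module \<Rightarrow> ('m \<Rightarrow> 'n) set" where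
  "linear_maps M N = lmod_hom K (restrict_scalars M) (restrict_scalars N)"

definition act :: "('g \<Rightarrow> 'k, 'm) module \<Rightarrow> 'g \<Rightarrow> 'm \<Rightarrow> 'm" where
  "act M g x = single \<one>\<^bsub>K\<^esub> g \<odot>\<^bsub>M\<^esub> x"

lemma linear_maps_iff:
  "f \<in> linear_maps M N \<longleftrightarrow> f \<in> carrier M \<rightarrow> carrier N \<and>
    (\<forall>x\<in>carrier M. \<forall>y\<in>carrier M. f (x \<oplus>\<^bsub>M\<^esub> y) = f x \<oplus>\<^bsub>N\<^esub> f y) \<and>
    (\<forall>c\<in>carrier K. \<forall>x\<in>carrier M. f (single c \<one> \<odot>\<^bsub>M\<^esub> x) = single c \<one> \<odot>\<^bsub>N\<^esub> f x)"
  by (simp add: linear_maps_def lmod_hom_def)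

lemma linear_maps_closed: "f \<in> linear_maps M N \<Longrightarrow> x \<in> carrier M \<Longrightarrow> f x \<in> carrier N"
  by (auto simp: linear_maps_iff)

lemma linear_maps_comp: "g \<in> linear_maps N L \<Longrightarrow> f \<in> linear_maps M N \<Longrightarrow> g \<circ> f \<in> linear_maps M L"
  unfolding linear_maps_def by (rule lmod_hom_comp)

lemma lmod_hom_linear: "f \<in> lmod_hom KG M N \<Longrightarrow> f \<in> linear_maps M N"
  by (auto simp: linear_maps_iff lmod_hom_def)

lemma lmod_hom_act: "f \<in> lmod_hom KG M N \<Longrightarrow> g \<in> carrier G \<Longrightarrow> x \<in> carrier M \<Longrightarrow> f (act M g x) = act N g (f x)"
  by (simp add: act_def lmod_hom_smult)

context
  fixes M :: "('g \<Rightarrow> 'k, 'm) module"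
  assumes M: "left_module KG M"
begin

lemma act_closed: "g \<in> carrier G \<Longrightarrow> x \<in> carrier M \<Longrightarrow> act M g x \<in> carrier M"
  unfolding act_def by (rule left_module.smult_closed[OF M]) simp_all

lemma act_one: "x \<in> carrier M \<Longrightarrow> act M \<one> x = x"
  unfolding act_def using left_module.smult_one[OF M] by (simp add: KG_simps(2))

lemma act_act:
  "g \<in> carrier G \<Longrightarrow> h \<in> carrier G \<Longrightarrow> x \<in> carrier M \<Longrightarrow> act M g (act M h x) = act M (g \<otimes> h) x"
  unfolding act_def by (simp add: left_module.smult_assoc[OF M, symmetric] single_mult)

lemma act_linear: "g \<in> carrier G \<Longrightarrow> act M g \<in> linear_maps M M"
  using left_module.smult_closed[OF M] left_module.smult_r_distr[OF M]
  by (auto simp: linear_maps_iff act_def left_module.smult_assoc[OF M, symmetric] single_mult)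

end

text \<open>The group algebra is spanned over \<open>K\<close> by the elements of \<open>G\<close>.\<close>
lemma equivariant_linear_hom:
  fixes M :: "('g \<Rightarrow> 'k, 'm) module" and N :: "('g \<Rightarrow> 'k, 'n) module"
  assumes M: "left_module KG M" and N: "left_module KG N" and f: "f \<in> linear_maps M N"
    and eq: "\<And>g x. g \<in> carrier G \<Longrightarrow> x \<in> carrier M \<Longrightarrow> f (act M g x) = act N g (f x)"
  shows "f \<in> lmod_hom KG M N"
proof (rule lmod_homI)
  interpret M: left_module KG M by fact
  interpret N: left_module KG N by fact
  have fM: "\<And>x. x \<in> carrier M \<Longrightarrow> f x \<in> carrier N"
    and fadd: "\<And>x y. x \<in> carrier M \<Longrightarrow> y \<in> carrier M \<Longrightarrow> f (x \<oplus>\<^bsub>M\<^esub> y) = f x \<oplus>\<^bsub>N\<^esub> f y"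
    and fsc: "\<And>c x. c \<in> carrier K \<Longrightarrow> x \<in> carrier M \<Longrightarrow> f (single c \<one> \<odot>\<^bsub>M\<^esub> x) = single c \<one> \<odot>\<^bsub>N\<^esub> f x"
    using f by (auto simp: linear_maps_iff)
  show "x \<in> carrier M \<Longrightarrow> f x \<in> carrier N" for x by (rule fM)
  show "x \<in> carrier M \<Longrightarrow> y \<in> carrier M \<Longrightarrow> f (x \<oplus>\<^bsub>M\<^esub> y) = f x \<oplus>\<^bsub>N\<^esub> f y" for x y by (rule fadd)
  show "f (a \<odot>\<^bsub>M\<^esub> x) = a \<odot>\<^bsub>N\<^esub> f x" if "a \<in> carrier KG" and x: "x \<in> carrier M" for a x
    using that(1)
  proof (induction a rule: KG_induct)
    case zero
    have "f \<zero>\<^bsub>M\<^esub> = \<zero>\<^bsub>N\<^esub>"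
      using lmod_hom_zero[OF left_module_restrict_scalars[OF M] left_module_restrict_scalars[OF N]]
        f unfolding linear_maps_def by simp
    then show ?case using fM x by (simp add: left_module_zero_smult[OF M] left_module_zero_smult[OF N])
  next
    case (add a b)
    then show ?case using x fM by (simp add: M.smult_l_distr N.smult_l_distr fadd M.smult_closed)
  next
    case (single c g)
    have s: "single c g = single c \<one> \<otimes>\<^bsub>KG\<^esub> single \<one>\<^bsub>K\<^esub> g"
      using single by (simp add: single_mult)
    have "f (single c g \<odot>\<^bsub>M\<^esub> x) = f (single c \<one> \<odot>\<^bsub>M\<^esub> act M g x)"
      unfolding act_def s using single x by (subst M.smult_assoc) simp_all
    also have "\<dots> = single c \<one> \<odot>\<^bsub>N\<^esub> act N g (f x)"
      using single x by (simp add: fsc act_closed[OF M] eq)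
    also have "\<dots> = single c g \<odot>\<^bsub>N\<^esub> f x"
      unfolding act_def s using single fM[OF x] by (subst N.smult_assoc) simp_all
    finally show ?case .
  qed
qed

subsection \<open>The trace of a linear map\<close>

text \<open>The relative trace from the trivial subgroup, \<open>x \<mapsto> \<Sum>g. g \<theta>(g\<^sup>-\<^sup>1 x)\<close>.\<close>
definition trace :: "('g \<Rightarrow> 'k, 'm) module \<Rightarrow> ('g \<Rightarrow> 'k, 'n) module \<Rightarrow> ('m \<Rightarrow> 'n) \<Rightarrow> 'm \<Rightarrow> 'n" where
  "trace M N \<theta> x = (\<Oplus>\<^bsub>N\<^esub>g\<in>carrier G. act N g (\<theta> (act M (inv g) x)))"

lemma trace_term_closed:
  assumes "left_module KG M" "left_module KG N" "\<theta> \<in> linear_maps M N" "x \<in> carrier M" "g \<in> carrier G"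
  shows "act N g (\<theta> (act M (inv g) x)) \<in> carrier N"
  using assms by (intro act_closed linear_maps_closed[OF assms(3)]) simp_all

lemma trace_cong:
  assumes "left_module KG M" "left_module KG N" "\<theta> \<in> linear_maps M N"
    "\<And>x. x \<in> carrier M \<Longrightarrow> \<eta> x = \<theta> x" "x \<in> carrier M"
  shows "trace M N \<eta> x = trace M N \<theta> x"
proof -
  interpret N: left_module KG N by fact
  show ?thesis
    unfolding trace_def
    by (rule N.finsum_cong') (auto simp: trace_term_closed[OF assms(1-3,5)] assms(4) act_closed[OF assms(1)] assms(5))
qed

text \<open>Multiplication by \<open>h\<close> permutes the summands of the trace.\<close>
lemma trace_hom:
  fixes M :: "('g \<Rightarrow> 'k, 'm) module" and N :: "('g \<Rightarrow> 'k, 'n) module"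
  assumes M: "left_module KG M" and N: "left_module KG N" and \<theta>: "\<theta> \<in> linear_maps M N"
  shows "trace M N \<theta> \<in> lmod_hom KG M N"
proof (rule equivariant_linear_hom[OF M N])
  interpret M: left_module KG M by fact
  interpret N: left_module KG N by fact
  let ?t = "\<lambda>x g. act N g (\<theta> (act M (inv g) x))"
  have t: "?t x \<in> carrier G \<rightarrow> carrier N" if "x \<in> carrier M" for x
    using trace_term_closed[OF M N \<theta> that] by blast
  have lin: "(\<lambda>x. ?t x g) \<in> linear_maps M N" if "g \<in> carrier G" for g
    using linear_maps_comp[OF act_linear[OF N that] linear_maps_comp[OF \<theta> act_linear[OF M G.inv_closed[OF that]]]]
    by (simp add: comp_def)
  have tc: "trace M N \<theta> x \<in> carrier N" if "x \<in> carrier M" for x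
    unfolding trace_def using t[OF that] by (rule N.finsum_closed)
  have "trace M N \<theta> (x \<oplus>\<^bsub>M\<^esub> y) = trace M N \<theta> x \<oplus>\<^bsub>N\<^esub> trace M N \<theta> y"
    if xy: "x \<in> carrier M" "y \<in> carrier M" for x y
  proof -
    have "trace M N \<theta> (x \<oplus>\<^bsub>M\<^esub> y) = (\<Oplus>\<^bsub>N\<^esub>g\<in>carrier G. ?t x g \<oplus>\<^bsub>N\<^esub> ?t y g)"
      unfolding trace_def
      by (rule N.finsum_cong') (use lin xy t in \<open>auto simp: linear_maps_iff Pi_iff\<close>)
    also have "\<dots> = trace M N \<theta> x \<oplus>\<^bsub>N\<^esub> trace M N \<theta> y"
      unfolding trace_def using t xy by (intro N.finsum_addf) auto
    finally show ?thesis .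
  qed
  moreover have "trace M N \<theta> (single c \<one> \<odot>\<^bsub>M\<^esub> x) = single c \<one> \<odot>\<^bsub>N\<^esub> trace M N \<theta> x"
    if cx: "c \<in> carrier K" "x \<in> carrier M" for c x
  proof -
    have "trace M N \<theta> (single c \<one> \<odot>\<^bsub>M\<^esub> x) = (\<Oplus>\<^bsub>N\<^esub>g\<in>carrier G. single c \<one> \<odot>\<^bsub>N\<^esub> ?t x g)"
      unfolding trace_def
      by (rule N.finsum_cong') (use lin cx t N.smult_closed in \<open>auto simp: linear_maps_iff Pi_iff\<close>)
    also have "\<dots> = single c \<one> \<odot>\<^bsub>N\<^esub> trace M N \<theta> x"
      unfolding trace_def
      by (rule additive_map_finsum[symmetric, OF N.M.abelian_group_axioms N.M.abelian_group_axioms _ _ fin t[OF cx(2)]])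
        (use cx in \<open>auto simp: N.smult_closed N.smult_r_distr\<close>)
    finally show ?thesis .
  qed
  ultimately show "trace M N \<theta> \<in> linear_maps M N" using tc by (auto simp: linear_maps_iff)
  show "trace M N \<theta> (act M h x) = act N h (trace M N \<theta> x)" if h: "h \<in> carrier G" and x: "x \<in> carrier M" for h x
  proof -
    have img: "(\<lambda>k. h \<otimes> k) ` carrier G = carrier G" using G.surj_const_mult[OF h] .
    have inj: "inj_on (\<lambda>k. h \<otimes> k) (carrier G)" using G.inj_on_cmult[OF h] .
    have hx: "act M h x \<in> carrier M" by (rule act_closed[OF M h x])
    have "trace M N \<theta> (act M h x) = (\<Oplus>\<^bsub>N\<^esub>g\<in>(\<lambda>k. h \<otimes> k) ` carrier G. ?t (act M h x) g)"
      unfolding img trace_def ..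
    also have "\<dots> = (\<Oplus>\<^bsub>N\<^esub>k\<in>carrier G. ?t (act M h x) (h \<otimes> k))"
      by (rule N.finsum_reindex[OF _ inj]) (simp only: img t[OF hx])
    also have "\<dots> = (\<Oplus>\<^bsub>N\<^esub>k\<in>carrier G. act N h (?t x k))"
    proof (rule N.finsum_cong'[OF refl])
      show "(\<lambda>k. act N h (?t x k)) \<in> carrier G \<rightarrow> carrier N"
        using t[OF x] h by (auto intro: act_closed[OF N])
      fix k assume k: "k \<in> carrier G"
      have "act M (inv (h \<otimes> k)) (act M h x) = act M (inv k) x"
        using k h x by (simp add: act_act[OF M] G.inv_mult_group G.m_assoc)
      then show "?t (act M h x) (h \<otimes> k) = act N h (?t x k)"
        using k h x by (simp add: act_act[OF N] linear_maps_closed[OF \<theta>] act_closed[OF M])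
    qed
    also have "\<dots> = act N h (trace M N \<theta> x)"
      unfolding trace_def
      by (rule additive_map_finsum[symmetric, OF N.M.abelian_group_axioms N.M.abelian_group_axioms _ _ fin t[OF x]])
        (use act_linear[OF N h] in \<open>auto simp: linear_maps_iff\<close>)
    finally show ?thesis .
  qed
qed

lemma trace_postcomp:
  assumes "left_module KG M" "left_module KG N" "left_module KG L" "\<theta> \<in> linear_maps M N" "f \<in> lmod_hom KG N L"
    "x \<in> carrier M"
  shows "f (trace M N \<theta> x) = trace M L (f \<circ> \<theta>) x"
proof -
  interpret L: left_module KG L by fact
  note c = trace_term_closed[OF assms(1,2,4,6)]
  have "f (trace M N \<theta> x) = (\<Oplus>\<^bsub>L\<^esub>g\<in>carrier G. f (act N g (\<theta> (act M (inv g) x))))"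
    unfolding trace_def by (rule additive_map_finsum[OF left_moduleD(2)[OF assms(2)] left_moduleD(2)[OF assms(3)] _ _ fin])
      (use c lmod_hom_closed[OF assms(5)] lmod_hom_add[OF assms(5)] in blast)+
  also have "\<dots> = trace M L (f \<circ> \<theta>) x"
    unfolding trace_def
  proof (rule L.finsum_cong'[OF refl])
    show "(\<lambda>g. act L g ((f \<circ> \<theta>) (act M (inv g) x))) \<in> carrier G \<rightarrow> carrier L"
      using trace_term_closed[OF assms(1,3) linear_maps_comp[OF lmod_hom_linear[OF assms(5)] assms(4)] assms(6)] by blast
    show "f (act N g (\<theta> (act M (inv g) x))) = act L g ((f \<circ> \<theta>) (act M (inv g) x))" if "g \<in> carrier G" for g
      using that assms(6) by (simp add: lmod_hom_act[OF assms(5)] linear_maps_closed[OF assms(4)] act_closed[OF assms(1)])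
  qed
  finally show ?thesis .
qed

lemma trace_precomp:
  assumes "left_module KG L" "left_module KG M" "left_module KG N" "\<theta> \<in> linear_maps M N" "f \<in> lmod_hom KG L M"
    "x \<in> carrier L"
  shows "trace M N \<theta> (f x) = trace L N (\<theta> \<circ> f) x"
proof -
  interpret N: left_module KG N by fact
  show ?thesis
    unfolding trace_def
  proof (rule N.finsum_cong'[OF refl])
    show "(\<lambda>g. act N g ((\<theta> \<circ> f) (act L (inv g) x))) \<in> carrier G \<rightarrow> carrier N"
      using trace_term_closed[OF assms(1,3) linear_maps_comp[OF assms(4) lmod_hom_linear[OF assms(5)]] assms(6)] by blast
  qed (use assms(6) in \<open>simp add: lmod_hom_act[OF assms(5)]\<close>)
qed

end

section \<open>Copies of modules in the universe\<close>

lemma transport_module: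
  fixes M :: "('a, 'm) module" and \<kappa> :: "'m \<Rightarrow> 'n"
  assumes M: "left_module R M" and inj: "inj_on \<kappa> (carrier M)"
  obtains N :: "('a, 'n) module" and \<mu> where "left_module R N" "\<kappa> \<in> lmod_hom R M N" "\<mu> \<in> lmod_hom R N M"
    "\<forall>x\<in>carrier M. \<mu> (\<kappa> x) = x" "\<forall>y\<in>carrier N. \<kappa> (\<mu> y) = y"
proof -
  interpret M: left_module R M by fact
  define \<mu> where "\<mu> = inv_into (carrier M) \<kappa>"
  have \<mu>: "\<mu> (\<kappa> x) = x" if "x \<in> carrier M" for x unfolding \<mu>_def using inj that by (rule inv_into_f_f)
  define N :: "('a, 'n) module" where "N = \<lparr>carrier = \<kappa> ` carrier M, mult = undefined, one = undefined,
    zero = \<kappa> \<zero>\<^bsub>M\<^esub>, add = \<lambda>x y. \<kappa> (\<mu> x \<oplus>\<^bsub>M\<^esub> \<mu> y), smult = \<lambda>a x. \<kappa> (a \<odot>\<^bsub>M\<^esub> \<mu> x)\<rparr>"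
  show thesis
  proof (rule that)
    show "left_module R N" by (rule left_module_image[OF M, of \<kappa>]) (simp_all add: N_def \<mu>)
    show "\<kappa> \<in> lmod_hom R M N" by (rule lmod_homI) (simp_all add: N_def \<mu>)
    show "\<mu> \<in> lmod_hom R N M" by (rule lmod_homI) (auto simp: N_def \<mu> M.smult_closed)
    show "\<forall>x\<in>carrier M. \<mu> (\<kappa> x) = x" "\<forall>y\<in>carrier N. \<kappa> (\<mu> y) = y" using \<mu> by (auto simp: N_def)
  qed
qed

text \<open>By induction on \<open>A\<close>, since an infinite set \<open>U\<close> is equipotent with \<open>U \<times> U\<close>.\<close>
lemma functions_inject_into_infinite_type:
  assumes "finite A" "infinite (UNIV :: 'm set)"
  shows "\<exists>\<kappa> :: ('g \<Rightarrow> 'm) \<Rightarrow> 'm. inj_on \<kappa> (A \<rightarrow>\<^sub>E UNIV)"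
  using assms(1)
proof (induction A rule: finite_induct)
  case empty
  show ?case by (intro exI[of _ "\<lambda>_. undefined"]) (simp add: PiE_empty_domain)
next
  case (insert x A)
  then obtain \<kappa> :: "('g \<Rightarrow> 'm) \<Rightarrow> 'm" where \<kappa>: "inj_on \<kappa> (A \<rightarrow>\<^sub>E UNIV)" by blast
  obtain pr :: "'m \<times> 'm \<Rightarrow> 'm" where pr: "inj pr"
    using card_of_Times_same_infinite[OF assms(2)] card_of_ordIso[of "UNIV \<times> UNIV" "UNIV :: 'm set"]
    by (auto simp: bij_betw_def)
  have "inj_on (\<lambda>f. pr (f x, \<kappa> (restrict f A))) (insert x A \<rightarrow>\<^sub>E UNIV)"
  proof (rule inj_onI)
    fix f f' assume f: "f \<in> insert x A \<rightarrow>\<^sub>E UNIV" "f' \<in> insert x A \<rightarrow>\<^sub>E UNIV"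
      and "pr (f x, \<kappa> (restrict f A)) = pr (f' x, \<kappa> (restrict f' A))"
    then have e: "f x = f' x" "\<kappa> (restrict f A) = \<kappa> (restrict f' A)" using injD[OF pr] by blast+
    have "restrict f A = restrict f' A" by (rule inj_onD[OF \<kappa>, OF e(2)]) auto
    then have "f y = f' y" if "y \<in> A" for y using that by (metis restrict_apply')
    then show "f = f'" using f e(1) by (intro PiE_ext[OF f]) auto
  qed
  then show ?case by blast
qed

context finite_group_algebra
begin

section \<open>Projective and injective modules over the group algebra\<close>

text \<open>The module \<open>Hom\<^sub>K(KG, X)\<close> with \<open>(a\<phi>)(b) = \<phi>(ba)\<close>. Written as functions on the group
  algebra rather than on \<open>G\<close>, it is a module by the associativity of \<open>KG\<close>.\<close>
definition coinduced :: "('g \<Rightarrow> 'k, 'm) module \<Rightarrow> ('g \<Rightarrow> 'k, ('g \<Rightarrow> 'k) \<Rightarrow> 'm) module" where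
  "coinduced X = \<lparr>carrier = linear_maps (regular_module KG) X \<inter> extensional (carrier KG),
     mult = undefined, one = undefined, zero = (\<lambda>b\<in>carrier KG. \<zero>\<^bsub>X\<^esub>),
     add = (\<lambda>\<phi> \<psi>. \<lambda>b\<in>carrier KG. \<phi> b \<oplus>\<^bsub>X\<^esub> \<psi> b), smult = (\<lambda>a \<phi>. \<lambda>b\<in>carrier KG. \<phi> (b \<otimes>\<^bsub>KG\<^esub> a))\<rparr>"

lemma coinduced_simps:
  "\<zero>\<^bsub>coinduced X\<^esub> = (\<lambda>b\<in>carrier KG. \<zero>\<^bsub>X\<^esub>)"
  "\<phi> \<oplus>\<^bsub>coinduced X\<^esub> \<psi> = (\<lambda>b\<in>carrier KG. \<phi> b \<oplus>\<^bsub>X\<^esub> \<psi> b)"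
  "a \<odot>\<^bsub>coinduced X\<^esub> \<phi> = (\<lambda>b\<in>carrier KG. \<phi> (b \<otimes>\<^bsub>KG\<^esub> a))"
  by (simp_all add: coinduced_def)

lemma coinduced_carrier_iff:
  "\<phi> \<in> carrier (coinduced X) \<longleftrightarrow> \<phi> \<in> extensional (carrier KG) \<and> (\<forall>b\<in>carrier KG. \<phi> b \<in> carrier X) \<and>
    (\<forall>b\<in>carrier KG. \<forall>b'\<in>carrier KG. \<phi> (b \<oplus>\<^bsub>KG\<^esub> b') = \<phi> b \<oplus>\<^bsub>X\<^esub> \<phi> b') \<and>
    (\<forall>c\<in>carrier K. \<forall>b\<in>carrier KG. \<phi> (single c \<one> \<otimes>\<^bsub>KG\<^esub> b) = single c \<one> \<odot>\<^bsub>X\<^esub> \<phi> b)"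
  by (auto simp: coinduced_def linear_maps_iff)

context
  fixes X :: "('g \<Rightarrow> 'k, 'm) module"
  assumes X: "left_module KG X"
begin

interpretation X: left_module KG X by (rule X)

lemma coinduced_ext:
  "\<phi> \<in> carrier (coinduced X) \<Longrightarrow> \<psi> \<in> carrier (coinduced X) \<Longrightarrow> (\<And>b. b \<in> carrier KG \<Longrightarrow> \<phi> b = \<psi> b) \<Longrightarrow> \<phi> = \<psi>"
  unfolding coinduced_carrier_iff by (auto intro: extensionalityI)

lemma coinduced_value: "\<phi> \<in> carrier (coinduced X) \<Longrightarrow> b \<in> carrier KG \<Longrightarrow> \<phi> b \<in> carrier X"
  by (simp add: coinduced_carrier_iff)

lemma left_module_coinduced: "left_module KG (coinduced X)"
proof -
  have "abelian_group (coinduced X)"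
  proof (rule abelian_groupI)
    show "\<phi> \<oplus>\<^bsub>coinduced X\<^esub> \<psi> \<in> carrier (coinduced X)"
      if "\<phi> \<in> carrier (coinduced X)" "\<psi> \<in> carrier (coinduced X)" for \<phi> \<psi>
      using that by (simp add: coinduced_carrier_iff coinduced_simps X.M.a_ac X.smult_r_distr)
    show "\<zero>\<^bsub>coinduced X\<^esub> \<in> carrier (coinduced X)"
      by (simp add: coinduced_carrier_iff coinduced_simps left_module_smult_zero[OF X])
    show "\<exists>\<psi>\<in>carrier (coinduced X). \<psi> \<oplus>\<^bsub>coinduced X\<^esub> \<phi> = \<zero>\<^bsub>coinduced X\<^esub>"
      if "\<phi> \<in> carrier (coinduced X)" for \<phi>
    proof (rule bexI)
      show "(\<lambda>b\<in>carrier KG. \<ominus>\<^bsub>X\<^esub> \<phi> b) \<in> carrier (coinduced X)"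
        using that by (simp add: coinduced_carrier_iff X.minus_add left_module_smult_minus[OF X])
      then show "(\<lambda>b\<in>carrier KG. \<ominus>\<^bsub>X\<^esub> \<phi> b) \<oplus>\<^bsub>coinduced X\<^esub> \<phi> = \<zero>\<^bsub>coinduced X\<^esub>"
        using that by (auto simp: coinduced_simps coinduced_value X.M.l_neg restrict_def fun_eq_iff)
    qed
    fix \<phi> assume p: "\<phi> \<in> carrier (coinduced X)"
    show "\<zero>\<^bsub>coinduced X\<^esub> \<oplus>\<^bsub>coinduced X\<^esub> \<phi> = \<phi>"
      using p by (auto simp: coinduced_simps coinduced_carrier_iff extensional_def fun_eq_iff)
    fix \<psi> assume q: "\<psi> \<in> carrier (coinduced X)"
    show "\<phi> \<oplus>\<^bsub>coinduced X\<^esub> \<psi> = \<psi> \<oplus>\<^bsub>coinduced X\<^esub> \<phi>"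
      using p q by (auto simp: coinduced_simps coinduced_value X.M.a_comm fun_eq_iff)
    fix \<chi> assume r: "\<chi> \<in> carrier (coinduced X)"
    show "\<phi> \<oplus>\<^bsub>coinduced X\<^esub> \<psi> \<oplus>\<^bsub>coinduced X\<^esub> \<chi> = \<phi> \<oplus>\<^bsub>coinduced X\<^esub> (\<psi> \<oplus>\<^bsub>coinduced X\<^esub> \<chi>)"
      using p q r by (auto simp: coinduced_simps coinduced_value X.M.a_assoc fun_eq_iff)
  qed
  moreover have "left_module_axioms KG (coinduced X)"
  proof (rule left_module_axioms.intro)
    fix a \<phi> assume a: "a \<in> carrier KG" and p: "\<phi> \<in> carrier (coinduced X)"
    show "a \<odot>\<^bsub>coinduced X\<^esub> \<phi> \<in> carrier (coinduced X)"
      using a p by (simp add: coinduced_carrier_iff coinduced_simps X.R.l_distr X.R.m_assoc)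
    fix b assume b: "b \<in> carrier KG"
    show "(a \<oplus>\<^bsub>KG\<^esub> b) \<odot>\<^bsub>coinduced X\<^esub> \<phi> = a \<odot>\<^bsub>coinduced X\<^esub> \<phi> \<oplus>\<^bsub>coinduced X\<^esub> b \<odot>\<^bsub>coinduced X\<^esub> \<phi>"
      using a b p by (auto simp: coinduced_carrier_iff coinduced_simps X.R.r_distr fun_eq_iff)
    show "(a \<otimes>\<^bsub>KG\<^esub> b) \<odot>\<^bsub>coinduced X\<^esub> \<phi> = a \<odot>\<^bsub>coinduced X\<^esub> (b \<odot>\<^bsub>coinduced X\<^esub> \<phi>)"
      using a b p by (auto simp: coinduced_simps X.R.m_assoc fun_eq_iff)
  next
    fix a \<phi> \<psi> assume a: "a \<in> carrier KG" and p: "\<phi> \<in> carrier (coinduced X)" "\<psi> \<in> carrier (coinduced X)"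
    show "a \<odot>\<^bsub>coinduced X\<^esub> (\<phi> \<oplus>\<^bsub>coinduced X\<^esub> \<psi>) = a \<odot>\<^bsub>coinduced X\<^esub> \<phi> \<oplus>\<^bsub>coinduced X\<^esub> a \<odot>\<^bsub>coinduced X\<^esub> \<psi>"
      using a p by (auto simp: coinduced_simps fun_eq_iff)
  next
    fix \<phi> assume p: "\<phi> \<in> carrier (coinduced X)"
    show "\<one>\<^bsub>KG\<^esub> \<odot>\<^bsub>coinduced X\<^esub> \<phi> = \<phi>"
      using p by (auto simp: coinduced_simps coinduced_carrier_iff extensional_def fun_eq_iff)
  qed
  ultimately show ?thesis using X.R.ring_axioms by (simp add: left_module_def)
qed

lemma coinduced_determined:
  assumes "\<phi> \<in> carrier (coinduced X)" "\<psi> \<in> carrier (coinduced X)"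
    "\<And>g. g \<in> carrier G \<Longrightarrow> \<phi> (single \<one>\<^bsub>K\<^esub> g) = \<psi> (single \<one>\<^bsub>K\<^esub> g)"
  shows "\<phi> = \<psi>"
proof (rule coinduced_ext[OF assms(1,2)])
  have z: "\<chi> \<zero>\<^bsub>KG\<^esub> = \<zero>\<^bsub>X\<^esub>" if "\<chi> \<in> carrier (coinduced X)" for \<chi>
  proof -
    have "\<chi> \<zero>\<^bsub>KG\<^esub> \<oplus>\<^bsub>X\<^esub> \<chi> \<zero>\<^bsub>KG\<^esub> = \<chi> (\<zero>\<^bsub>KG\<^esub> \<oplus>\<^bsub>KG\<^esub> \<zero>\<^bsub>KG\<^esub>)"
      using that X.R.zero_closed unfolding coinduced_carrier_iff by metis
    then show ?thesis using coinduced_value[OF that X.R.zero_closed] by simp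
  qed
  fix b assume "b \<in> carrier KG"
  then show "\<phi> b = \<psi> b"
  proof (induction b rule: KG_induct)
    case zero
    then show ?case by (simp add: z assms)
  next
    case (add a b)
    then show ?case using assms(1,2) by (simp add: coinduced_carrier_iff)
  next
    case (single c g)
    have "single c g = single c \<one> \<otimes>\<^bsub>KG\<^esub> single \<one>\<^bsub>K\<^esub> g" using single by (simp add: single_mult)
    then show ?case using single assms by (simp add: coinduced_carrier_iff)
  qed
qed

definition coinduced_unit :: "'m \<Rightarrow> ('g \<Rightarrow> 'k) \<Rightarrow> 'm" where
  "coinduced_unit x = (\<lambda>b\<in>carrier KG. b \<odot>\<^bsub>X\<^esub> x)"

definition coinduced_eval :: "(('g \<Rightarrow> 'k) \<Rightarrow> 'm) \<Rightarrow> 'm" where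
  "coinduced_eval \<phi> = \<phi> \<one>\<^bsub>KG\<^esub>"

text \<open>The function on \<open>G\<close> with value \<open>x\<close> at \<open>1\<close> and zero elsewhere, extended linearly to
  \<open>KG\<close>.\<close>
definition coinduced_delta :: "'m \<Rightarrow> ('g \<Rightarrow> 'k) \<Rightarrow> 'm" where
  "coinduced_delta x = (\<lambda>b\<in>carrier KG. single (b \<one>) \<one> \<odot>\<^bsub>X\<^esub> x)"

lemma coinduced_unit_hom: "coinduced_unit \<in> lmod_hom KG X (coinduced X)"
proof (rule lmod_homI)
  show "coinduced_unit x \<in> carrier (coinduced X)" if "x \<in> carrier X" for x
    using that by (simp add: coinduced_unit_def coinduced_carrier_iff X.smult_closed X.smult_l_distr X.smult_assoc)
  show "coinduced_unit (x \<oplus>\<^bsub>X\<^esub> y) = coinduced_unit x \<oplus>\<^bsub>coinduced X\<^esub> coinduced_unit y"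
    if "x \<in> carrier X" "y \<in> carrier X" for x y
    using that by (auto simp: coinduced_unit_def coinduced_simps X.smult_r_distr fun_eq_iff)
  show "coinduced_unit (a \<odot>\<^bsub>X\<^esub> x) = a \<odot>\<^bsub>coinduced X\<^esub> coinduced_unit x"
    if "a \<in> carrier KG" "x \<in> carrier X" for a x
    using that by (auto simp: coinduced_unit_def coinduced_simps X.smult_assoc fun_eq_iff)
qed

lemma coinduced_eval_linear: "coinduced_eval \<in> linear_maps (coinduced X) X"
proof -
  have "\<phi> (\<one>\<^bsub>KG\<^esub> \<otimes>\<^bsub>KG\<^esub> single c \<one>) = single c \<one> \<odot>\<^bsub>X\<^esub> \<phi> \<one>\<^bsub>KG\<^esub>"
    if c: "c \<in> carrier K" and p: "\<phi> \<in> carrier (coinduced X)" for c \<phi>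
  proof -
    have "\<one>\<^bsub>KG\<^esub> \<otimes>\<^bsub>KG\<^esub> single c \<one> = single c \<one> \<otimes>\<^bsub>KG\<^esub> \<one>\<^bsub>KG\<^esub>" using c by simp
    then show ?thesis using c p X.R.one_closed unfolding coinduced_carrier_iff by metis
  qed
  then show ?thesis
    by (auto simp: linear_maps_iff coinduced_eval_def coinduced_value coinduced_simps)
qed

lemma single_value_mult:
  assumes "c \<in> carrier K" "b \<in> carrier KG"
  shows "(single c \<one> \<otimes>\<^bsub>KG\<^esub> b) \<one> = c \<otimes>\<^bsub>K\<^esub> b \<one>"
  using assms by (simp add: single_mult_app)

lemma coinduced_delta_linear: "coinduced_delta \<in> linear_maps X (coinduced X)"
  unfolding linear_maps_iff
proof (intro conjI ballI funcsetI)
  note v = KG_val[OF _ G.one_closed]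
  show "coinduced_delta x \<in> carrier (coinduced X)" if x: "x \<in> carrier X" for x
    unfolding coinduced_carrier_iff
  proof (intro conjI ballI)
    show "coinduced_delta x \<in> extensional (carrier KG)" by (simp add: coinduced_delta_def)
    show "coinduced_delta x b \<in> carrier X" if "b \<in> carrier KG" for b
      using that x v by (simp add: coinduced_delta_def X.smult_closed)
    show "coinduced_delta x (b \<oplus>\<^bsub>KG\<^esub> b') = coinduced_delta x b \<oplus>\<^bsub>X\<^esub> coinduced_delta x b'"
      if b: "b \<in> carrier KG" "b' \<in> carrier KG" for b b'
    proof -
      have "(b \<oplus>\<^bsub>KG\<^esub> b') \<one> = b \<one> \<oplus>\<^bsub>K\<^esub> b' \<one>" by (simp add: KG_simps(4))
      then show ?thesis using b x v X.R.a_closed[OF b] by (simp add: coinduced_delta_def single_add X.smult_l_distr)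
    qed
    show "coinduced_delta x (single c \<one> \<otimes>\<^bsub>KG\<^esub> b) = single c \<one> \<odot>\<^bsub>X\<^esub> coinduced_delta x b"
      if b: "c \<in> carrier K" "b \<in> carrier KG" for c b
      using b x v by (simp add: coinduced_delta_def single_value_mult X.smult_assoc[symmetric] single_mult)
  qed
  show "coinduced_delta (x \<oplus>\<^bsub>X\<^esub> y) = coinduced_delta x \<oplus>\<^bsub>coinduced X\<^esub> coinduced_delta y"
    if "x \<in> carrier X" "y \<in> carrier X" for x y
    using that v by (auto simp: coinduced_delta_def coinduced_simps X.smult_r_distr fun_eq_iff)
  show "coinduced_delta (single c \<one> \<odot>\<^bsub>X\<^esub> x) = single c \<one> \<odot>\<^bsub>coinduced X\<^esub> coinduced_delta x"
    if cx: "c \<in> carrier K" "x \<in> carrier X" for c x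
  proof
    fix b
    show "coinduced_delta (single c \<one> \<odot>\<^bsub>X\<^esub> x) b = (single c \<one> \<odot>\<^bsub>coinduced X\<^esub> coinduced_delta x) b"
    proof (cases "b \<in> carrier KG")
      case True
      have "(b \<otimes>\<^bsub>KG\<^esub> single c \<one>) \<one> = b \<one> \<otimes>\<^bsub>K\<^esub> c"
        using cx True by (simp add: mult_single_app)
      then show ?thesis
        using True cx v by (simp add: coinduced_delta_def coinduced_simps X.smult_assoc[symmetric] single_mult)
    qed (simp add: coinduced_delta_def coinduced_simps)
  qed
qed

lemma coinduced_eval_act:
  assumes "\<phi> \<in> carrier (coinduced X)" "g \<in> carrier G"
  shows "coinduced_eval (act (coinduced X) g \<phi>) = \<phi> (single \<one>\<^bsub>K\<^esub> g)"
  using assms by (simp add: coinduced_eval_def act_def coinduced_simps)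

lemma coinduced_eval_unit: "x \<in> carrier X \<Longrightarrow> coinduced_eval (coinduced_unit x) = x"
  by (simp add: coinduced_eval_def coinduced_unit_def X.smult_one)

lemma trace_eval_delta:
  assumes x: "x \<in> carrier X"
  shows "trace (coinduced X) X coinduced_eval (coinduced_delta x) = x"
proof -
  have dx: "coinduced_delta x \<in> carrier (coinduced X)"
    using linear_maps_closed[OF coinduced_delta_linear x] .
  have s0: "single \<zero>\<^bsub>K\<^esub> \<one> = \<zero>\<^bsub>KG\<^esub>" by (simp add: single_def KG_simps cong: restrict_cong)
  have "act X g (coinduced_eval (act (coinduced X) (inv g) (coinduced_delta x))) =
      (if g = \<one> then act X g x else \<zero>\<^bsub>X\<^esub>)" if g: "g \<in> carrier G" for g
  proof -
    have "\<one> = inv g \<longleftrightarrow> g = \<one>" using g by (metis G.inv_inv G.inv_one)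
    then have "coinduced_delta x (single \<one>\<^bsub>K\<^esub> (inv g)) = (if g = \<one> then x else \<zero>\<^bsub>X\<^esub>)"
      using x g X.smult_one[OF x]
      by (simp add: coinduced_delta_def single_app KG_simps(2) s0 left_module_zero_smult[OF X])
    moreover have "act X g \<zero>\<^bsub>X\<^esub> = \<zero>\<^bsub>X\<^esub>" by (simp add: act_def left_module_smult_zero[OF X])
    ultimately show ?thesis using g dx by (simp add: coinduced_eval_act)
  qed
  then have "trace (coinduced X) X coinduced_eval (coinduced_delta x) =
      (\<Oplus>\<^bsub>X\<^esub>g\<in>carrier G. if g = \<one> then act X g x else \<zero>\<^bsub>X\<^esub>)"
    unfolding trace_def using x by (intro X.M.finsum_cong') (auto simp: act_closed[OF X])
  also have "\<dots> = act X \<one> x"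
    by (rule X.M.add.finprod_singleton_swap[OF G.one_closed fin]) (use x in \<open>auto simp: act_closed[OF X]\<close>)
  finally show ?thesis using x by (simp add: act_one[OF X])
qed

text \<open>Higman's criterion for \<open>Hom\<^sub>K(KG, X)\<close>: an element \<open>\<phi>\<close> is the sum over \<open>g\<close> of the
  functions that agree with \<open>\<phi>\<close> at \<open>g\<^sup>-\<^sup>1\<close> and vanish elsewhere on \<open>G\<close>, and these are the
  summands of the trace.\<close>
lemma trace_delta_eval:
  assumes p: "\<phi> \<in> carrier (coinduced X)"
  shows "trace (coinduced X) (coinduced X) (coinduced_delta \<circ> coinduced_eval) \<phi> = \<phi>"
proof -
  note E = left_module_coinduced
  interpret E: left_module KG "coinduced X" by (rule E)
  have lin: "coinduced_delta \<circ> coinduced_eval \<in> linear_maps (coinduced X) (coinduced X)"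
    by (rule linear_maps_comp[OF coinduced_delta_linear coinduced_eval_linear])
  let ?t = "\<lambda>g. act (coinduced X) g ((coinduced_delta \<circ> coinduced_eval) (act (coinduced X) (inv g) \<phi>))"
  have t: "?t \<in> carrier G \<rightarrow> carrier (coinduced X)" using trace_term_closed[OF E E lin p] by blast
  have tr: "trace (coinduced X) (coinduced X) (coinduced_delta \<circ> coinduced_eval) \<phi> \<in> carrier (coinduced X)"
    unfolding trace_def using t by (rule E.M.finsum_closed)
  show ?thesis
  proof (rule coinduced_determined[OF tr p])
    fix h assume h: "h \<in> carrier G"
    let ?b = "single \<one>\<^bsub>K\<^esub> h"
    have b: "?b \<in> carrier KG" by simp
    have s0: "single \<zero>\<^bsub>K\<^esub> \<one> = \<zero>\<^bsub>KG\<^esub>" by (simp add: single_def KG_simps cong: restrict_cong)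
    have "trace (coinduced X) (coinduced X) (coinduced_delta \<circ> coinduced_eval) \<phi> ?b = (\<Oplus>\<^bsub>X\<^esub>g\<in>carrier G. ?t g ?b)"
      unfolding trace_def
      by (rule additive_map_finsum[OF E.M.abelian_group_axioms X.M.abelian_group_axioms _ _ fin t, of "\<lambda>\<psi>. \<psi> ?b"])
        (auto simp: coinduced_value[OF _ b] coinduced_simps)
    also have "\<dots> = (\<Oplus>\<^bsub>X\<^esub>g\<in>carrier G. if g = inv h then \<phi> (single \<one>\<^bsub>K\<^esub> (inv g)) else \<zero>\<^bsub>X\<^esub>)"
    proof (rule X.M.finsum_cong'[OF refl])
      show "(\<lambda>g. if g = inv h then \<phi> (single \<one>\<^bsub>K\<^esub> (inv g)) else \<zero>\<^bsub>X\<^esub>) \<in> carrier G \<rightarrow> carrier X"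
        using coinduced_value[OF p] by auto
      fix g assume g: "g \<in> carrier G"
      have v: "\<phi> (single \<one>\<^bsub>K\<^esub> (inv g)) \<in> carrier X" using coinduced_value[OF p] by simp
      have "?t g ?b = coinduced_delta (\<phi> (single \<one>\<^bsub>K\<^esub> (inv g))) (single \<one>\<^bsub>K\<^esub> (h \<otimes> g))"
        using g h p by (simp add: act_def[of _ g] coinduced_simps single_mult coinduced_eval_act)
      also have "\<dots> = single (if \<one> = h \<otimes> g then \<one>\<^bsub>K\<^esub> else \<zero>\<^bsub>K\<^esub>) \<one> \<odot>\<^bsub>X\<^esub> \<phi> (single \<one>\<^bsub>K\<^esub> (inv g))"
        by (simp add: coinduced_delta_def single_app)
      also have "\<one> = h \<otimes> g \<longleftrightarrow> g = inv h"
        using g h by (metis G.inv_equality G.inv_closed G.r_inv G.inv_comm)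
      finally show "?t g ?b = (if g = inv h then \<phi> (single \<one>\<^bsub>K\<^esub> (inv g)) else \<zero>\<^bsub>X\<^esub>)"
        using v X.smult_one[OF v] h by (auto simp: KG_simps(2) s0 left_module_zero_smult[OF X])
    qed
    also have "\<dots> = \<phi> (single \<one>\<^bsub>K\<^esub> (inv (inv h)))"
      by (rule X.M.add.finprod_singleton_swap[OF _ fin]) (use h coinduced_value[OF p] in auto)
    finally show "trace (coinduced X) (coinduced X) (coinduced_delta \<circ> coinduced_eval) \<phi> ?b = \<phi> ?b"
      using h by simp
  qed
qed

end

text \<open>A function in \<open>Hom\<^sub>K(KG, X)\<close> is determined by its values on the finite set \<open>G\<close>, so the
  module has a copy \<open>E\<close> in any infinite universe containing \<open>X\<close>. Its identity is a trace,
  \<open>X\<close> embeds in it, and the trace of evaluation at \<open>1\<close> maps it onto \<open>X\<close>.\<close>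
lemma coinduced_copy:
  fixes X :: "('g \<Rightarrow> 'k, 'm) module"
  assumes inf: "infinite (UNIV :: 'm set)" and X: "left_module KG X"
  obtains E :: "('g \<Rightarrow> 'k, 'm) module" and u \<epsilon> \<theta> where "left_module KG E"
    "u \<in> lmod_hom KG X E" "inj_on u (carrier X)"
    "\<epsilon> \<in> linear_maps E X" "trace E X \<epsilon> ` carrier E = carrier X"
    "\<theta> \<in> linear_maps E E" "\<forall>y\<in>carrier E. trace E E \<theta> y = y"
proof -
  note C = left_module_coinduced[OF X]
  obtain \<iota> :: "('g \<Rightarrow> 'm) \<Rightarrow> 'm" where \<iota>: "inj_on \<iota> (carrier G \<rightarrow>\<^sub>E UNIV)"
    using functions_inject_into_infinite_type[OF fin inf] by blast
  let ?\<kappa> = "\<lambda>\<phi>. \<iota> (\<lambda>g\<in>carrier G. \<phi> (single \<one>\<^bsub>K\<^esub> g))"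
  have "inj_on ?\<kappa> (carrier (coinduced X))"
  proof (rule inj_onI)
    fix \<phi> \<psi> assume p: "\<phi> \<in> carrier (coinduced X)" "\<psi> \<in> carrier (coinduced X)" "?\<kappa> \<phi> = ?\<kappa> \<psi>"
    have "(\<lambda>g\<in>carrier G. \<phi> (single \<one>\<^bsub>K\<^esub> g)) = (\<lambda>g\<in>carrier G. \<psi> (single \<one>\<^bsub>K\<^esub> g))"
      by (rule inj_onD[OF \<iota>, OF p(3)]) auto
    then have "\<phi> (single \<one>\<^bsub>K\<^esub> g) = \<psi> (single \<one>\<^bsub>K\<^esub> g)" if "g \<in> carrier G" for g
      using that by (auto simp: fun_eq_iff dest: spec[of _ g])
    then show "\<phi> = \<psi>" by (rule coinduced_determined[OF X p(1,2)])
  qed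
  then obtain E :: "('g \<Rightarrow> 'k, 'm) module" and \<mu> \<kappa> where E: "left_module KG E"
    and \<kappa>: "\<kappa> \<in> lmod_hom KG (coinduced X) E" and \<mu>: "\<mu> \<in> lmod_hom KG E (coinduced X)"
    and \<mu>\<kappa>: "\<forall>x\<in>carrier (coinduced X). \<mu> (\<kappa> x) = x" and \<kappa>\<mu>: "\<forall>y\<in>carrier E. \<kappa> (\<mu> y) = y"
    by (rule transport_module[OF C])
  note de = coinduced_delta_linear[OF X] and ev = coinduced_eval_linear[OF X]
  have ev\<mu>: "coinduced_eval \<circ> \<mu> \<in> linear_maps E X" by (rule linear_maps_comp[OF ev lmod_hom_linear[OF \<mu>]])
  have \<kappa>de: "\<kappa> \<circ> coinduced_delta X \<in> linear_maps X E" by (rule linear_maps_comp[OF lmod_hom_linear[OF \<kappa>] de])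
  have dev: "coinduced_delta X \<circ> coinduced_eval \<in> linear_maps (coinduced X) (coinduced X)"
    by (rule linear_maps_comp[OF de ev])
  have \<kappa>dev: "\<kappa> \<circ> (coinduced_delta X \<circ> coinduced_eval) \<in> linear_maps (coinduced X) E"
    by (rule linear_maps_comp[OF lmod_hom_linear[OF \<kappa>] dev])
  have evu: "(coinduced_eval \<circ> \<mu>) ((\<kappa> \<circ> coinduced_unit X) x) = x" if x: "x \<in> carrier X" for x
    using \<mu>\<kappa> lmod_hom_closed[OF coinduced_unit_hom[OF X] x] coinduced_eval_unit[OF X x] by simp
  show thesis
  proof (rule that[OF E lmod_hom_comp[OF \<kappa> coinduced_unit_hom[OF X]] _ ev\<mu> _ linear_maps_comp[OF \<kappa>de ev\<mu>]])
    show "inj_on (\<kappa> \<circ> coinduced_unit X) (carrier X)" using evu by (metis inj_onI)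
    have tr: "trace E X (coinduced_eval \<circ> \<mu>) ((\<kappa> \<circ> coinduced_delta X) x) = x" if x: "x \<in> carrier X" for x
    proof -
      have d: "coinduced_delta X x \<in> carrier (coinduced X)" by (rule linear_maps_closed[OF de x])
      then have "trace E X (coinduced_eval \<circ> \<mu>) (\<kappa> (coinduced_delta X x)) =
          trace (coinduced X) X (coinduced_eval) (\<mu> (\<kappa> (coinduced_delta X x)))"
        by (intro trace_precomp[symmetric, OF E C X ev \<mu>] lmod_hom_closed[OF \<kappa>])
      then show ?thesis using d \<mu>\<kappa> trace_eval_delta[OF X x] by simp
    qed
    show "trace E X (coinduced_eval \<circ> \<mu>) ` carrier E = carrier X"
    proof (intro equalityI image_subsetI subsetI)
      show "x \<in> trace E X (coinduced_eval \<circ> \<mu>) ` carrier E" if "x \<in> carrier X" for x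
        using tr[OF that] linear_maps_closed[OF \<kappa>de that] by (metis image_eqI)
    qed (rule lmod_hom_closed[OF trace_hom[OF E X ev\<mu>]])
    show "\<forall>y\<in>carrier E. trace E E ((\<kappa> \<circ> coinduced_delta X) \<circ> (coinduced_eval \<circ> \<mu>)) y = y"
    proof
      fix y assume y: "y \<in> carrier E"
      have my: "\<mu> y \<in> carrier (coinduced X)" by (rule lmod_hom_closed[OF \<mu> y])
      have "trace E E ((\<kappa> \<circ> (coinduced_delta X \<circ> coinduced_eval)) \<circ> \<mu>) y =
          trace (coinduced X) E (\<kappa> \<circ> (coinduced_delta X \<circ> coinduced_eval)) (\<mu> y)"
        by (rule trace_precomp[symmetric, OF E C E \<kappa>dev \<mu> y])
      also have "\<dots> = \<kappa> (trace (coinduced X) (coinduced X) (coinduced_delta X \<circ> coinduced_eval) (\<mu> y))"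
        by (rule trace_postcomp[symmetric, OF C C E dev \<kappa> my])
      also have "\<dots> = y" using trace_delta_eval[OF X my] \<kappa>\<mu> y by simp
      finally show "trace E E ((\<kappa> \<circ> coinduced_delta X) \<circ> (coinduced_eval \<circ> \<mu>)) y = y" by (simp add: comp_assoc)
    qed
  qed
qed

text \<open>To lift \<open>f\<close> along \<open>q\<close>, take the trace of \<open>\<sigma> f \<theta>\<close> with \<open>\<sigma>\<close> a linear section of \<open>q\<close>;
  composing with \<open>q\<close> turns it into the trace of \<open>f \<theta>\<close>, which is \<open>f\<close>.\<close>
lemma projective_if_trace:
  fixes P :: "('g \<Rightarrow> 'k, 'm) module"
  assumes P: "left_module KG P" and \<theta>: "\<theta> \<in> linear_maps P P" and id: "\<forall>x\<in>carrier P. trace P P \<theta> x = x"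
  shows "projective_module KG P"
  unfolding projective_module_def
proof (intro conjI allI impI P)
  fix M N :: "('g \<Rightarrow> 'k, 'm) module" and q f
  assume "left_module KG M \<and> left_module KG N \<and> q \<in> lmod_hom KG M N \<and> q ` carrier M = carrier N \<and> f \<in> lmod_hom KG P N"
  then have M: "left_module KG M" and N: "left_module KG N" and q: "q \<in> lmod_hom KG M N" "q ` carrier M = carrier N"
    and f: "f \<in> lmod_hom KG P N" by blast+
  have ql: "q \<in> lmod_hom K (restrict_scalars M) (restrict_scalars N)"
    using lmod_hom_linear[OF q(1)] by (simp add: linear_maps_def)
  obtain \<sigma> where \<sigma>: "\<sigma> \<in> linear_maps N M" "\<forall>y\<in>carrier N. q (\<sigma> y) = y"
    using linear_section[OF K.field_axioms left_module_restrict_scalars[OF M] left_module_restrict_scalars[OF N] ql] q(2)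
    unfolding linear_maps_def by auto
  have l1: "f \<circ> \<theta> \<in> linear_maps P N" by (rule linear_maps_comp[OF lmod_hom_linear[OF f] \<theta>])
  have l2: "\<sigma> \<circ> (f \<circ> \<theta>) \<in> linear_maps P M" by (rule linear_maps_comp[OF \<sigma>(1) l1])
  show "\<exists>h\<in>lmod_hom KG P M. \<forall>x\<in>carrier P. q (h x) = f x"
  proof (rule bexI[OF _ trace_hom[OF P M l2]], rule ballI)
    fix x assume x: "x \<in> carrier P"
    have "q (trace P M (\<sigma> \<circ> (f \<circ> \<theta>)) x) = trace P N (q \<circ> (\<sigma> \<circ> (f \<circ> \<theta>))) x"
      by (rule trace_postcomp[OF P M N l2 q(1) x])
    also have "\<dots> = trace P N (f \<circ> \<theta>) x"
      by (rule trace_cong[OF P N l1 _ x]) (use \<sigma>(2) linear_maps_closed[OF l1] in simp)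
    also have "\<dots> = f (trace P P \<theta> x)" by (rule trace_postcomp[symmetric, OF P P N \<theta> f x])
    also have "\<dots> = f x" using id x by simp
    finally show "q (trace P M (\<sigma> \<circ> (f \<circ> \<theta>)) x) = f x" .
  qed
qed

text \<open>Conversely, a projective module is a retract of the coinduced module mapping onto it
  by a trace, and a trace composed with a homomorphism is a trace.\<close>
lemma projective_trace:
  fixes P :: "('g \<Rightarrow> 'k, 'm) module"
  assumes inf: "infinite (UNIV :: 'm set)" and P: "projective_module KG P"
  obtains \<theta> where "\<theta> \<in> linear_maps P P" "\<forall>x\<in>carrier P. trace P P \<theta> x = x"
proof -
  note lP = projective_left_module[OF P]
  obtain E :: "('g \<Rightarrow> 'k, 'm) module" and u \<epsilon> \<theta> where E: "left_module KG E"
    "u \<in> lmod_hom KG P E" "inj_on u (carrier P)"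
    "\<epsilon> \<in> linear_maps E P" "trace E P \<epsilon> ` carrier E = carrier P"
    "\<theta> \<in> linear_maps E E" "\<forall>y\<in>carrier E. trace E E \<theta> y = y"
    by (rule coinduced_copy[OF inf lP])
  obtain s where s: "s \<in> lmod_hom KG P E" "\<forall>x\<in>carrier P. trace E P \<epsilon> (s x) = id x"
    by (rule projective_lift[OF P E(1) lP trace_hom[OF E(1) lP E(4)] E(5) lmod_hom_id])
  have "trace P P (\<epsilon> \<circ> s) x = x" if "x \<in> carrier P" for x
    using trace_precomp[OF lP E(1) lP E(4) s(1) that] s(2) that by simp
  then show thesis using that linear_maps_comp[OF E(4) lmod_hom_linear[OF s(1)]] by blast
qed

text \<open>Projectives are injective because a linear retraction \<open>r\<close> of \<open>i\<close> makes the trace of \<open>\<theta>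
  u r\<close> an extension of \<open>u\<close>. The coinduced modules provide enough projectives and the
  embeddings into them.\<close>
lemma frobenius_universe_KG:
  assumes inf: "infinite (UNIV :: 'm set)"
  shows "frobenius_universe TYPE('m) KG"
proof
  fix X :: "('g \<Rightarrow> 'k, 'm) module" assume X: "left_module KG X"
  obtain E :: "('g \<Rightarrow> 'k, 'm) module" and u \<epsilon> \<theta> where E: "left_module KG E"
    "u \<in> lmod_hom KG X E" "inj_on u (carrier X)"
    "\<epsilon> \<in> linear_maps E X" "trace E X \<epsilon> ` carrier E = carrier X"
    "\<theta> \<in> linear_maps E E" "\<forall>y\<in>carrier E. trace E E \<theta> y = y"
    by (rule coinduced_copy[OF inf X])
  have P: "projective_module KG E" by (rule projective_if_trace[OF E(1,6,7)])
  show "\<exists>(P :: ('g \<Rightarrow> 'k, 'm) module) u. projective_module KG P \<and> u \<in> lmod_hom KG X P \<and> inj_on u (carrier X)"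
    using P E(2,3) by blast
  show "\<exists>(P :: ('g \<Rightarrow> 'k, 'm) module) q. projective_module KG P \<and> q \<in> lmod_hom KG P X \<and> q ` carrier P = carrier X"
    using P trace_hom[OF E(1) X E(4)] E(5) by blast
next
  fix P A B :: "('g \<Rightarrow> 'k, 'm) module" and i u
  assume P: "projective_module KG P" and A: "left_module KG A" and B: "left_module KG B"
    and i: "i \<in> lmod_hom KG A B" "inj_on i (carrier A)" and u: "u \<in> lmod_hom KG A P"
  note lP = projective_left_module[OF P]
  obtain \<theta> where \<theta>: "\<theta> \<in> linear_maps P P" "\<forall>x\<in>carrier P. trace P P \<theta> x = x"
    by (rule projective_trace[OF inf P])
  have il: "i \<in> lmod_hom K (restrict_scalars A) (restrict_scalars B)"
    using lmod_hom_linear[OF i(1)] by (simp add: linear_maps_def)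
  obtain r where r: "r \<in> linear_maps B A" "\<forall>x\<in>carrier A. r (i x) = x"
    using linear_retraction[OF K.field_axioms left_module_restrict_scalars[OF A] left_module_restrict_scalars[OF B] il] i(2)
    unfolding linear_maps_def by auto
  have l1: "\<theta> \<circ> u \<in> linear_maps A P" by (rule linear_maps_comp[OF \<theta>(1) lmod_hom_linear[OF u]])
  have l2: "(\<theta> \<circ> u) \<circ> r \<in> linear_maps B P" by (rule linear_maps_comp[OF l1 r(1)])
  show "\<exists>e\<in>lmod_hom KG B P. \<forall>x\<in>carrier A. e (i x) = u x"
  proof (rule bexI[OF _ trace_hom[OF B lP l2]], rule ballI)
    fix x assume x: "x \<in> carrier A"
    have "trace B P ((\<theta> \<circ> u) \<circ> r) (i x) = trace A P (((\<theta> \<circ> u) \<circ> r) \<circ> i) x"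
      by (rule trace_precomp[OF A B lP l2 i(1) x])
    also have "\<dots> = trace A P (\<theta> \<circ> u) x" by (rule trace_cong[OF A lP l1 _ x]) (use r(2) in simp)
    also have "\<dots> = trace P P \<theta> (u x)" by (rule trace_precomp[symmetric, OF A lP lP \<theta>(1) u x])
    also have "\<dots> = u x" using \<theta>(2) lmod_hom_closed[OF u x] by simp
    finally show "trace B P ((\<theta> \<circ> u) \<circ> r) (i x) = u x" .
  qed
qed

lemma finite_length_field: "finite_length K (regular_module K)"
  unfolding finite_length_def strict_rank_def
proof (intro exI[of _ "\<lambda>U. if U = {\<zero>\<^bsub>K\<^esub>} then 0 else 1"] allI impI)
  fix U V assume a: "submodule U K (regular_module K) \<and> submodule V K (regular_module K) \<and> U \<subset> V"
  note lK = left_module_regular[OF K.ring_axioms]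
  note U = submoduleD[OF lK conjunct1[OF a]]
  have V: "V \<subseteq> carrier K" using submoduleD(1)[OF lK] a by auto
  have "U = {\<zero>\<^bsub>K\<^esub>}"
  proof (rule ccontr)
    assume "U \<noteq> {\<zero>\<^bsub>K\<^esub>}"
    then obtain x where x: "x \<in> U" "x \<noteq> \<zero>\<^bsub>K\<^esub>" using U(2) by auto
    then have u: "x \<in> Units K" using U(1) K.field_Units by auto
    have "y \<in> U" if y: "y \<in> carrier K" for y
    proof -
      have "(y \<otimes>\<^bsub>K\<^esub> inv\<^bsub>K\<^esub> x) \<otimes>\<^bsub>K\<^esub> x \<in> U" using U(6)[OF _ x(1), of "y \<otimes>\<^bsub>K\<^esub> inv\<^bsub>K\<^esub> x"] y u by simp
      then show ?thesis using y u U(1) x(1) by (simp add: K.m_assoc K.Units_l_inv subset_iff)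
    qed
    then show False using V a by blast
  qed
  moreover have "V \<noteq> {\<zero>\<^bsub>K\<^esub>}" using a U(2) by auto
  ultimately show "(if U = {\<zero>\<^bsub>K\<^esub>} then 0 else 1) < (if V = {\<zero>\<^bsub>K\<^esub>} then 0 else (1 :: nat))" by simp
qed

text \<open>Left ideals are subspaces, and \<open>KG\<close> is spanned by the finite set \<open>G\<close>.\<close>
lemma finite_length_KG:
  assumes R: "ring KG" shows "finite_length KG (regular_module KG)"
proof -
  note lR = left_module_regular[OF R]
  note lK = left_module_restrict_scalars[OF lR]
  have "finite_length K (restrict_scalars (regular_module KG))"
  proof (rule finite_length_finitely_generated[OF lK finite_length_field, of "single \<one>\<^bsub>K\<^esub> ` carrier G"])
    fix H assume H: "submodule H K (restrict_scalars (regular_module KG))" "single \<one>\<^bsub>K\<^esub> ` carrier G \<subseteq> H"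
    note Hd = submoduleD[OF lK H(1)]
    have "b \<in> H" if "b \<in> carrier KG" for b
      using that
    proof (induction b rule: KG_induct)
      case zero
      then show ?case using Hd(2) by simp
    next
      case (add a b)
      then show ?case using Hd(3) by simp
    next
      case (single c g)
      have "single \<one>\<^bsub>K\<^esub> g \<in> H" using H(2) single by blast
      then have "single c \<one> \<otimes>\<^bsub>KG\<^esub> single \<one>\<^bsub>K\<^esub> g \<in> H" using Hd(6)[OF single(1)] by simp
      then show ?case using single by (simp add: single_mult)
    qed
    then show "H = carrier (restrict_scalars (regular_module KG))" using Hd(1) by auto
  qed (use fin in auto)
  then obtain \<delta> where \<delta>: "strict_rank K (restrict_scalars (regular_module KG)) \<delta>"
    unfolding finite_length_def by blast
  have "submodule U K (restrict_scalars (regular_module KG))"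
    if "submodule U KG (regular_module KG)" for U
    by (rule submoduleI[OF lK]) (use submoduleD[OF lR that] in auto)
  then have "strict_rank KG (regular_module KG) \<delta>" using \<delta> unfolding strict_rank_def by simp
  then show ?thesis unfolding finite_length_def by blast
qed

end

section \<open>The ghost number\<close>

lemma large_universe_infinite:
  assumes "field K" "large_universe TYPE('m) K" shows "infinite (UNIV :: 'm set)"
proof
  interpret K: field K by fact
  assume fin: "finite (UNIV :: 'm set)"
  obtain j :: "_ \<times> nat \<Rightarrow> 'm" where j: "inj_on j (carrier K \<times> UNIV)" using assms(2) unfolding large_universe_def by blast
  have "finite (carrier K \<times> (UNIV :: nat set))"
    by (rule inj_on_finite[OF j subset_UNIV fin])
  moreover have "infinite (carrier K \<times> (UNIV :: nat set))"
    using K.zero_closed by (metis finite_cartesian_productD2 equals0D infinite_UNIV_nat)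
  ultimately show False by simp
qed

lemma (in ghost_setting) ghost_chain_composite:
  assumes "\<forall>i\<le>n. left_module R (X i)" "\<forall>i<n. ghostly (X i) (X (Suc i)) (f i)"
  shows "ghost_chain (X 0) n (X n) (composite f n)"
  using assms
proof (induction n)
  case 0
  then show ?case unfolding composite.simps by (intro ghost_chain.start lmod_hom_id) simp
next
  case (Suc n)
  then have "ghost_chain (X 0) n (X n) (composite f n)" by simp
  then show ?case unfolding composite.simps using Suc.prems by (intro ghost_chain.step) auto
qed

theorem theorem4p7:
  fixes K :: "('k, 'r) ring_scheme" and G :: "('g, 's) monoid_scheme" and p :: nat
  assumes "field K" and "has_characteristic K p"
    and "group G" and "finite (carrier G)" and "p dvd order G"
    and "large_universe TYPE('m) K"
    and "(thick_trivial K G :: ('g \<Rightarrow> 'k, 'm) module set) = stmod_principal_block K G"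
  shows "ghost_number TYPE('m) K G < \<infinity>"
proof -
  interpret finite_group_algebra K G
    using assms(1,3,4) by (simp add: finite_group_algebra_def finite_group_algebra_axioms_def)
  let ?T = "thick_trivial K G :: ('g \<Rightarrow> 'k, 'm) module set"
  let ?e = "principal_idempotent K G"
  have T_lm: "left_module KG X" if "X \<in> ?T" for X
    using that unfolding assms(7) stmod_principal_block_def stmod_def stably_isomorphic_def stable_iso_map_def
    by blast
  have "\<exists>n. ghost_composites_vanish TYPE('m) K G n"
  proof (cases "?T = {}")
    case True
    then have "ghost_composites_vanish TYPE('m) K G 0" unfolding ghost_composites_vanish_def by blast
    then show ?thesis ..
  next
    case False
    then obtain X0 where X0: "X0 \<in> ?T" by blast
    \<comment> \<open>The axioms of a left module include those of its ring of scalars.\<close>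
    have ring: "ring KG" using left_moduleD(1)[OF T_lm[OF X0]] .
    note fl = finite_length_KG[OF ring]
    obtain \<rho> where \<rho>: "strict_rank KG (regular_module KG) \<rho>" using fl unfolding finite_length_def by blast
    interpret ghost_setting KG "TYPE('m)" "{T. is_trivial_module K G T}"
      by (intro ghost_setting.intro ghost_setting_axioms.intro
          frobenius_universe_KG[OF large_universe_infinite[OF assms(1,6)]]) (simp add: is_trivial_module_def)
    have ghost_iff: "ghost K G X Y f \<longleftrightarrow> ghostly X Y f" for X Y :: "('g \<Rightarrow> 'k, 'm) module" and f
      unfolding ghost_def relative_ghost_def test_modules_def by blast
    have "thick_subcategory KG {X. \<exists>n. ghost_length_le n X}"
      by (rule thick_finite_ghost_length[OF T_lm[OF X0]])
    then have T_fin: "\<exists>n. ghost_length_le n X" if "X \<in> ?T" for X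
      using that ghost_length_le_test unfolding thick_trivial_def by blast
    have T_retract: "N \<in> ?T" if "M \<in> ?T" "stably_isomorphic KG M N" for M N
      using that unfolding thick_trivial_def thick_subcategory_def triangulated_subcategory_def by blast
    define S where "S = {L :: ('g \<Rightarrow> 'k, 'm) module. simple_module KG L \<and> (\<forall>x\<in>carrier L. ?e \<odot>\<^bsub>L\<^esub> x = x)}"
    \<comment> \<open>A simple module on which \<open>e\<^sub>0\<close> acts as the identity is finitely generated and in the principal
      block; the hypothesis places it in the thick subcategory generated by \<open>k\<close>.\<close>
    have "L \<in> ?T" if L: "L \<in> S" for L
    proof -
      have lL: "left_module KG L" and sL: "simple_module KG L" and eL: "\<forall>x\<in>carrier L. ?e \<odot>\<^bsub>L\<^esub> x = x"
        using L by (auto simp: S_def simple_module_def)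
      have "stable_iso_map KG L L id"
        unfolding stable_iso_map_def stably_eq_def
        using lL lmod_hom_id[of KG L] abelian_group.minus_eq_zero_iff[OF left_moduleD(2)[OF lL]]
        by (auto intro!: bexI[of _ id] stably_zero_null)
      then have "L \<in> stmod KG"
        unfolding stmod_def stably_isomorphic_def using simple_module_fin_gen[OF sL] by blast
      moreover have "H \<subseteq> carrier L" if "direct_summand KG L H" for H
        using that submoduleD(1)[OF lL] unfolding direct_summand_def by blast
      ultimately show ?thesis unfolding assms(7) stmod_principal_block_def using eL by blast
    qed
    then have S_fin: "\<exists>n. ghost_length_le n L" if "L \<in> S" for L using T_fin that by blast
    obtain \<F> where \<F>: "finite \<F>" "\<F> \<subseteq> S" "\<forall>L\<in>S. \<exists>L'\<in>\<F>. lmod_iso KG L' L"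
      by (rule finitely_many_simple_modules[OF ring fl, of S]) (simp add: S_def)
    define \<nu> where "\<nu> L = (SOME n. ghost_length_le n L)" for L
    have \<nu>: "ghost_length_le (\<nu> L) L" if "L \<in> S" for L
      unfolding \<nu>_def using S_fin[OF that] by (rule someI_ex)
    \<comment> \<open>Any common upper bound of the finitely many \<open>\<nu> L\<close> would do.\<close>
    define m where "m = (\<Sum>L\<in>\<F>. \<nu> L)"
    have simple: "ghost_length_le m L" if L: "simple_module KG L" "\<forall>x\<in>carrier L. ?e \<odot>\<^bsub>L\<^esub> x = x"
      for L :: "('g \<Rightarrow> 'k, 'm) module"
    proof -
      have LS: "L \<in> S" using L by (simp add: S_def)
      then obtain L' where L': "L' \<in> \<F>" "lmod_iso KG L' L" using \<F>(3) by blast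
      have "L' \<in> S" using L'(1) \<F>(2) by blast
      have "\<nu> L' \<le> m" unfolding m_def by (rule member_le_sum[OF L'(1) _ \<F>(1)]) simp
      then have "ghost_length_le m L'" using \<nu>[OF \<open>L' \<in> S\<close>] ghost_length_le_mono by blast
      moreover have "stable_retract KG L L'"
        using stable_retract_of_iso[OF _ _ L'(2)] L(1) \<open>L' \<in> S\<close> by (simp add: S_def simple_module_def)
      ultimately show ?thesis using ghost_length_le_retract by blast
    qed
    let ?n = "\<rho> (carrier KG) * m"
    have bound: "ghost_length_le ?n M" if M: "M \<in> ?T" for M
    proof -
      obtain N f where N: "fin_gen_module KG N" "stable_iso_map KG M N f"
        using M unfolding assms(7) stmod_principal_block_def stmod_def stably_isomorphic_def by blast
      have NT: "N \<in> ?T" using T_retract M N(2) unfolding stably_isomorphic_def by blast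
      have lN: "left_module KG N" by (rule T_lm[OF NT])
      have flN: "finite_length KG N"
        using N(1) unfolding fin_gen_module_def
        by (auto intro: finite_length_finitely_generated[OF lN fl])
      obtain H where H: "direct_summand KG N H" "projective_free KG (N\<lparr>carrier := H\<rparr>)"
        "stable_retract KG N (N\<lparr>carrier := H\<rparr>)"
        by (rule projective_free_summand[OF lN flN])
      have sub: "submodule H KG N" using H(1) by (simp add: direct_summand_def)
      \<comment> \<open>The module \<open>N\<close> lies again in the thick subcategory, that is, in the principal block, which
        by definition constrains its projective-free summands.\<close>
      have eH: "\<forall>x\<in>H. ?e \<odot>\<^bsub>N\<^esub> x = x"
        using NT H(1,2) unfolding assms(7) stmod_principal_block_def by blast
      have "ghost_length_le ?n (N\<lparr>carrier := H\<rparr>)"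
        by (rule ghost_length_le_by_annihilators[OF \<rho> simple])
          (use eH left_module_submodule[OF lN sub] finite_length_submodule[OF lN sub flN] in auto)
      then have "ghost_length_le ?n N" using H(3) ghost_length_le_retract by blast
      then show ?thesis using ghost_length_le_retract stable_retract_of_iso_map(1)[OF N(2)] by blast
    qed
    have "ghost_composites_vanish TYPE('m) K G ?n"
      unfolding ghost_composites_vanish_def
    proof (intro allI impI)
      fix X :: "nat \<Rightarrow> ('g \<Rightarrow> 'k, 'm) module" and f
      assume X: "(\<forall>i\<le>?n. X i \<in> ?T) \<and> (\<forall>i<?n. ghost K G (X i) (X (Suc i)) (f i))"
      have "ghost_chain (X 0) ?n (X ?n) (composite f ?n)"
        by (rule ghost_chain_composite) (use X T_lm ghost_iff in auto)
      then show "stably_zero KG (X 0) (X ?n) (composite f ?n)"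
        using ghost_length_leD[OF bound] X by blast
    qed
    then show ?thesis ..
  qed
  then obtain n where "ghost_composites_vanish TYPE('m) K G n" ..
  then have "ghost_number TYPE('m) K G \<le> enat n" unfolding ghost_number_def by (intro Inf_lower) simp
  then show ?thesis by (rule order_le_less_trans) simp
qed

end
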